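(* Let $G$ be a discrete group. Suppose that $|FC(G)| < \infty$, and let $\mathcal{T}$ be a transversal for $FC(G)$ in $G$. The weak*-closed ideals of $\ell^1(G)$ are exactly the subspaces of the form $$\bigoplus_{t \in \mathcal{T}} \delta_t*K(\Omega),$$ where $\Omega \subset \widehat{FC(G)}$ is a union of orbits for the action of $G$ on $\widehat{FC(G)}$ induced by conjugation.
   Context: $\ell^1(G)$ is the complex convolution algebra of the discrete group $G$, with weak*-topology given by $\ell^1(G)=c_0(G)^*$. "Ideal" means two-sided ideal. $FC(G)=\{t\in G : \text{the conjugacy class of } t \text{ in } G \text{ is finite}\}$, a normal subgroup of $G$. A transversal for a normal subgroup is a set of coset representatives. $\widehat{FC(G)}$ is the unitary dual of $FC(G)$, i.e. the set of equivalence classes of irreducible unitary representations on Hilbert spaces; each $\pi\in\widehat{FC(G)}$ is extended linearly to a representation of $\ell^1(FC(G))$, $\pi(f)=\sum_n f(n)\pi(n)$, and $\ker\pi$ denotes its kernel in $\ell^1(FC(G))$. The group $G$ acts on $\widehat{FC(G)}$ by $(t\cdot\pi)(n)=\pi(t^{-1}nt)$ for $t\in G$, $n\in FC(G)$. For $\Omega\subset\widehat{FC(G)}$, $K(\Omega)=\bigcap_{\pi\in\Omega}\ker\pi$, an ideal of $\ell^1(FC(G))$ (with $K(\emptyset)=\ell^1(FC(G))$). $\ell^1(FC(G))$ is regarded as a subset of $\ell^1(G)$ via extension by zero. For a subspace $J$ of $\ell^1(FC(G))$, $\bigoplus_{t\in\mathcal T}\delta_t*J$ is the set of all $f\in\ell^1(G)$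 of the form $f=\sum_{t\in\mathcal T}\delta_t*f_t$ (convergent in $\ell^1$-norm) with each $f_t\in J$. *)

theory Defs
  imports
    "HOL-Analysis.Analysis"
    "HOL-Algebra.Left_Coset"
    "HOL-Library.Function_Algebras"
begin

section \<open>The convolution algebra of a discrete group\<close>

text \<open>Functions on a group \<open>G\<close> are functions on the ambient type that vanish outside
  \<open>carrier G\<close>. Hence, for a subgroup \<open>N\<close>, extension by zero from \<open>N\<close> to \<open>G\<close> is the
  identity, and \<open>l1 (G\<lparr>carrier := N\<rparr>) \<subseteq> l1 G\<close>.\<close>

definition l1 :: "('a, 'b) monoid_scheme \<Rightarrow> ('a \<Rightarrow> complex) set" where
  "l1 G = {f. (\<forall>x. x \<notin> carrier G \<longrightarrow> f x = 0) \<and> (\<lambda>x. norm (f x)) summable_on carrier G}"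

definition l1_norm :: "('a, 'b) monoid_scheme \<Rightarrow> ('a \<Rightarrow> complex) \<Rightarrow> real" where
  "l1_norm G f = (\<Sum>\<^sub>\<infinity>x\<in>carrier G. norm (f x))"

definition conv ::
  "('a, 'b) monoid_scheme \<Rightarrow> ('a \<Rightarrow> complex) \<Rightarrow> ('a \<Rightarrow> complex) \<Rightarrow> 'a \<Rightarrow> complex" where
  "conv G f g = (\<lambda>x. if x \<in> carrier G
     then \<Sum>\<^sub>\<infinity>y\<in>carrier G. f y * g (inv\<^bsub>G\<^esub> y \<otimes>\<^bsub>G\<^esub> x) else 0)"

definition delta :: "'a \<Rightarrow> 'a \<Rightarrow> complex" where
  "delta t = (\<lambda>x. if x = t then 1 else 0)"

text \<open>Addition on functions is the pointwise one of \<^theory>\<open>HOL-Library.Function_Algebras\<close>.\<close>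

definition fscale :: "complex \<Rightarrow> ('i \<Rightarrow> complex) \<Rightarrow> 'i \<Rightarrow> complex" where
  "fscale c f = (\<lambda>x. c * f x)"

global_interpretation cfun: vector_space fscale
  by standard (auto simp: fscale_def algebra_simps fun_eq_iff)

definition l1_ideal :: "('a, 'b) monoid_scheme \<Rightarrow> ('a \<Rightarrow> complex) set \<Rightarrow> bool" where
  "l1_ideal G I \<longleftrightarrow> I \<subseteq> l1 G \<and> cfun.subspace I \<and>
     (\<forall>f\<in>l1 G. \<forall>g\<in>I. conv G f g \<in> I \<and> conv G g f \<in> I)"

definition c0 :: "('a, 'b) monoid_scheme \<Rightarrow> ('a \<Rightarrow> complex) set" where
  "c0 G = {\<phi>. (\<forall>x. x \<notin> carrier G \<longrightarrow> \<phi> x = 0) \<and>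
     (\<forall>e>0. finite {x \<in> carrier G. norm (\<phi> x) \<ge> e})}"

text \<open>The coarsest topology on \<open>l1 G\<close> for which the pairing with every element of \<open>c0 G\<close>
  is continuous.\<close>

definition weak_star :: "('a, 'b) monoid_scheme \<Rightarrow> ('a \<Rightarrow> complex) topology" where
  "weak_star G = topology_generated_by
     {{f \<in> l1 G. (\<Sum>\<^sub>\<infinity>x\<in>carrier G. f x * \<phi> x) \<in> U} | \<phi> U. \<phi> \<in> c0 G \<and> open U}"


section \<open>Finite conjugacy classes and transversals\<close>

definition FC :: "('a, 'b) monoid_scheme \<Rightarrow> 'a set" where
  "FC G = {t \<in> carrier G. finite {s \<otimes>\<^bsub>G\<^esub> t \<otimes>\<^bsub>G\<^esub> inv\<^bsub>G\<^esub> s | s. s \<in> carrier G}}"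

abbreviation FC_group :: "('a, 'b) monoid_scheme \<Rightarrow> ('a, 'b) monoid_scheme" where
  "FC_group G \<equiv> G\<lparr>carrier := FC G\<rparr>"

text \<open>We use left cosets; for a normal subgroup these are also the right cosets.\<close>

definition transversal :: "('a, 'b) monoid_scheme \<Rightarrow> 'a set \<Rightarrow> 'a set \<Rightarrow> bool" where
  "transversal G N T \<longleftrightarrow> T \<subseteq> carrier G \<and> (\<forall>C\<in>lcosets\<^bsub>G\<^esub> N. \<exists>!t. t \<in> T \<and> t \<in> C)"

definition l1_direct_sum ::
  "('a, 'b) monoid_scheme \<Rightarrow> 'a set \<Rightarrow> ('a \<Rightarrow> complex) set \<Rightarrow> ('a \<Rightarrow> complex) set" where
  "l1_direct_sum G T J = {f \<in> l1 G. \<exists>F. (\<forall>t\<in>T. F t \<in> J) \<and>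
     ((\<lambda>A. l1_norm G (f - (\<Sum>t\<in>A. conv G (delta t) (F t)))) \<longlongrightarrow> 0) (finite_subsets_at_top T)}"


section \<open>Unitary representations on Hilbert spaces\<close>

text \<open>A complex Hilbert space: the underlying vector space \<open>hcarrier\<close> is a linear subspace of
  the space of all functions \<open>'i \<Rightarrow> complex\<close>, and \<open>hinner\<close> is an arbitrary inner product on it,
  linear in the first argument; it need not be related to the coordinates of the functions.\<close>

record 'i hspace =
  hcarrier :: "('i \<Rightarrow> complex) set"
  hinner :: "('i \<Rightarrow> complex) \<Rightarrow> ('i \<Rightarrow> complex) \<Rightarrow> complex"

text \<open>The value 0 off the carrier matters only because \<^locale>\<open>Metric_space\<close> requires its distance
  function to be nonnegative and symmetric on the whole type.\<close>

definition hdist :: "('i, 'z) hspace_scheme \<Rightarrow> ('i \<Rightarrow> complex) \<Rightarrow> ('i \<Rightarrow> complex) \<Rightarrow> real" where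
  "hdist H u v = (if u \<in> hcarrier H \<and> v \<in> hcarrier H
     then sqrt (Re (hinner H (u - v) (u - v))) else 0)"

abbreviation htopology :: "('i, 'z) hspace_scheme \<Rightarrow> ('i \<Rightarrow> complex) topology" where
  "htopology H \<equiv> Metric_space.mtopology (hcarrier H) (hdist H)"

definition hilbert_space :: "('i, 'z) hspace_scheme \<Rightarrow> bool" where
  "hilbert_space H \<longleftrightarrow>
     cfun.subspace (hcarrier H) \<and>
     (\<forall>u\<in>hcarrier H. \<forall>v\<in>hcarrier H. \<forall>w\<in>hcarrier H.
        hinner H (u + v) w = hinner H u w + hinner H v w) \<and>
     (\<forall>u\<in>hcarrier H. \<forall>w\<in>hcarrier H. \<forall>c. hinner H (fscale c u) w = c * hinner H u w) \<and>
     (\<forall>u\<in>hcarrier H. \<forall>w\<in>hcarrier H. hinner H w u = cnj (hinner H u w)) \<and>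
     (\<forall>u\<in>hcarrier H. u \<noteq> 0 \<longrightarrow> Re (hinner H u u) > 0) \<and>
     Metric_space.mcomplete (hcarrier H) (hdist H)"

definition unitary_map ::
  "('i, 'z) hspace_scheme \<Rightarrow> ('j, 'y) hspace_scheme \<Rightarrow> (('i \<Rightarrow> complex) \<Rightarrow> 'j \<Rightarrow> complex) \<Rightarrow> bool"
  where
  "unitary_map H H' U \<longleftrightarrow>
     bij_betw U (hcarrier H) (hcarrier H') \<and>
     (\<forall>u\<in>hcarrier H. \<forall>v\<in>hcarrier H. U (u + v) = U u + U v) \<and>
     (\<forall>u\<in>hcarrier H. \<forall>c. U (fscale c u) = fscale c (U u)) \<and>
     (\<forall>u\<in>hcarrier H. \<forall>v\<in>hcarrier H. hinner H' (U u) (U v) = hinner H u v)"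

record ('n, 'i) urep = "'i hspace" +
  rop :: "'n \<Rightarrow> ('i \<Rightarrow> complex) \<Rightarrow> 'i \<Rightarrow> complex"

definition unitary_rep :: "('n, 'b) monoid_scheme \<Rightarrow> ('n, 'i) urep \<Rightarrow> bool" where
  "unitary_rep N \<pi> \<longleftrightarrow> hilbert_space \<pi> \<and>
     (\<forall>n\<in>carrier N. unitary_map \<pi> \<pi> (rop \<pi> n)) \<and>
     (\<forall>m\<in>carrier N. \<forall>n\<in>carrier N. \<forall>u\<in>hcarrier \<pi>.
        rop \<pi> (m \<otimes>\<^bsub>N\<^esub> n) u = rop \<pi> m (rop \<pi> n u))"

definition irreducible_unitary_rep :: "('n, 'b) monoid_scheme \<Rightarrow> ('n, 'i) urep \<Rightarrow> bool" where
  "irreducible_unitary_rep N \<pi> \<longleftrightarrow> unitary_rep N \<pi> \<and> hcarrier \<pi> \<noteq> {0} \<and>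
     (\<forall>W. cfun.subspace W \<and> closedin (htopology \<pi>) W \<and>
          (\<forall>n\<in>carrier N. \<forall>w\<in>W. rop \<pi> n w \<in> W) \<longrightarrow>
        W = {0} \<or> W = hcarrier \<pi>)"

definition rep_equiv ::
  "('n, 'b) monoid_scheme \<Rightarrow> ('n, 'i) urep \<Rightarrow> ('n, 'j) urep \<Rightarrow> bool" where
  "rep_equiv N \<pi> \<sigma> \<longleftrightarrow> (\<exists>U. unitary_map \<pi> \<sigma> U \<and>
     (\<forall>n\<in>carrier N. \<forall>u\<in>hcarrier \<pi>. U (rop \<pi> n u) = rop \<sigma> n (U u)))"

text \<open>The extension of a representation to \<open>l1 N\<close>. The series converges absolutely in operator
  norm, so its sum is determined by its sums at the individual vectors.\<close>

definition rep_l1 ::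
  "('n, 'b) monoid_scheme \<Rightarrow> ('n, 'i) urep \<Rightarrow> ('n \<Rightarrow> complex) \<Rightarrow> ('i \<Rightarrow> complex) \<Rightarrow> 'i \<Rightarrow> complex"
  where
  "rep_l1 N \<pi> f v = (THE u. limitin (htopology \<pi>)
     (\<lambda>A. \<Sum>n\<in>A. fscale (f n) (rop \<pi> n v)) u (finite_subsets_at_top (carrier N)))"

definition rep_kernel ::
  "('n, 'b) monoid_scheme \<Rightarrow> ('n, 'i) urep \<Rightarrow> ('n \<Rightarrow> complex) set" where
  "rep_kernel N \<pi> = {f \<in> l1 N. \<forall>v\<in>hcarrier \<pi>. rep_l1 N \<pi> f v = 0}"


section \<open>Basic facts about Hilbert spaces and unitary representations\<close>

lemma hilbert_spaceD:
  assumes "hilbert_space H"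
  shows "cfun.subspace (hcarrier H)"
    and "\<And>u v w. u \<in> hcarrier H \<Longrightarrow> v \<in> hcarrier H \<Longrightarrow> w \<in> hcarrier H \<Longrightarrow>
        hinner H (u + v) w = hinner H u w + hinner H v w"
    and "\<And>u w c. u \<in> hcarrier H \<Longrightarrow> w \<in> hcarrier H \<Longrightarrow>
        hinner H (fscale c u) w = c * hinner H u w"
    and "\<And>u w. u \<in> hcarrier H \<Longrightarrow> w \<in> hcarrier H \<Longrightarrow> hinner H w u = cnj (hinner H u w)"
    and "\<And>u. u \<in> hcarrier H \<Longrightarrow> u \<noteq> 0 \<Longrightarrow> Re (hinner H u u) > 0"
    and "Metric_space.mcomplete (hcarrier H) (hdist H)"
  using assms unfolding hilbert_space_def by blast+

context
  fixes H :: "('i, 'z) hspace_scheme"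
  assumes H: "hilbert_space H"
begin

lemma hcarrier_closed:
  "0 \<in> hcarrier H"
  "u \<in> hcarrier H \<Longrightarrow> w \<in> hcarrier H \<Longrightarrow> u + w \<in> hcarrier H"
  "u \<in> hcarrier H \<Longrightarrow> w \<in> hcarrier H \<Longrightarrow> u - w \<in> hcarrier H"
  "u \<in> hcarrier H \<Longrightarrow> fscale c u \<in> hcarrier H"
  using hilbert_spaceD(1)[OF H] cfun.subspace_add cfun.subspace_diff cfun.subspace_scale
    cfun.subspace_0 by auto

lemma hinner_diff_left:
  assumes "u \<in> hcarrier H" "v \<in> hcarrier H" "w \<in> hcarrier H"
  shows "hinner H (u - v) w = hinner H u w - hinner H v w"
proof -
  have "hinner H ((u - v) + v) w = hinner H (u - v) w + hinner H v w"
    using hilbert_spaceD(2)[OF H, of "u - v" v w] hcarrier_closed assms by auto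
  then show ?thesis by simp
qed

lemma hinner_diff_right:
  assumes "u \<in> hcarrier H" "v \<in> hcarrier H" "w \<in> hcarrier H"
  shows "hinner H w (u - v) = hinner H w u - hinner H w v"
  using hilbert_spaceD(4)[OF H] hinner_diff_left[of u v w] assms hcarrier_closed(3)
  by (metis complex_cnj_diff)

lemma hinner_scale_right:
  assumes "u \<in> hcarrier H" "w \<in> hcarrier H"
  shows "hinner H w (fscale c u) = cnj c * hinner H w u"
  using hilbert_spaceD(3,4)[OF H] assms hcarrier_closed(4)
  by (metis complex_cnj_mult)

lemma hinner_zero: "w \<in> hcarrier H \<Longrightarrow> hinner H 0 w = 0"
  using hinner_diff_left[of 0 0 w] hcarrier_closed by simp

lemma hinner_self:
  assumes "u \<in> hcarrier H"
  shows "hinner H u u = of_real (Re (hinner H u u))" "Re (hinner H u u) \<ge> 0"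
proof -
  have "hinner H u u = cnj (hinner H u u)" using hilbert_spaceD(4)[OF H] assms by blast
  then show "hinner H u u = of_real (Re (hinner H u u))"
    by (metis Reals_cnj_iff of_real_Re)
  show "Re (hinner H u u) \<ge> 0"
    using hilbert_spaceD(5)[OF H assms] hinner_zero[OF assms] by (cases "u = 0") auto
qed

lemma hinner_Cauchy_Schwarz:
  assumes u: "u \<in> hcarrier H" and v: "v \<in> hcarrier H"
  shows "cmod (hinner H u v) \<le> sqrt (Re (hinner H u u)) * sqrt (Re (hinner H v v))"
proof (cases "v = 0")
  case True
  have "hinner H u 0 = 0" "hinner H 0 (0 :: 'i \<Rightarrow> complex) = 0"
    using hinner_zero[OF u] hinner_zero[OF hcarrier_closed(1)]
      hilbert_spaceD(4)[OF H hcarrier_closed(1) u] by simp_all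
  then show ?thesis using True by simp
next
  case False
  define b where "b = Re (hinner H v v)"
  have b: "b > 0" using hilbert_spaceD(5)[OF H v False] b_def by simp
  have bb: "hinner H v v = of_real b" using hinner_self(1)[OF v] b_def by simp
  define z where "z = hinner H u v"
  have zz: "hinner H v u = cnj z" using hilbert_spaceD(4)[OF H] u v z_def by blast
  define c where "c = z / of_real b"
  define w where "w = u - fscale c v"
  have cv: "fscale c v \<in> hcarrier H" using hcarrier_closed v by blast
  have w: "w \<in> hcarrier H" using w_def hcarrier_closed u cv by blast
  have "hinner H w w = hinner H u u - cnj c * z - (c * cnj z - cnj c * (c * of_real b))"
    unfolding w_def
    using u v cv w
    by (simp add: hinner_diff_left hinner_diff_right hcarrier_closed hinner_scale_right
        hilbert_spaceD(3)[OF H] zz bb z_def algebra_simps)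
  also have "cnj c * z = of_real ((cmod z)\<^sup>2 / b)"
    using complex_norm_square[of z] by (simp add: c_def mult.commute)
  also have "c * cnj z = of_real ((cmod z)\<^sup>2 / b)"
    using complex_norm_square[of z] by (simp add: c_def)
  also have "cnj c * (c * of_real b) = of_real ((cmod z)\<^sup>2 / b)"
  proof -
    have "c * of_real b = z" using b by (simp add: c_def)
    then show ?thesis using \<open>cnj c * z = of_real ((cmod z)\<^sup>2 / b)\<close> by simp
  qed
  finally have "Re (hinner H w w) = Re (hinner H u u) - (cmod z)\<^sup>2 / b"
    by simp
  with hinner_self(2)[OF w] have "(cmod z)\<^sup>2 / b \<le> Re (hinner H u u)" by simp
  then have "(cmod z)\<^sup>2 \<le> Re (hinner H u u) * b" using b by (simp add: field_simps)
  then have "cmod z \<le> sqrt (Re (hinner H u u) * b)" by (simp add: real_le_rsqrt)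
  then show ?thesis by (simp add: real_sqrt_mult b_def z_def)
qed

lemma Metric_space_hdist: "Metric_space (hcarrier H) (hdist H)"
proof
  fix u v :: "'i \<Rightarrow> complex"
  show "0 \<le> hdist H u v" using hinner_self(2) hcarrier_closed(3) by (auto simp: hdist_def)
  show "hdist H u v = hdist H v u"
    by (auto simp: hdist_def hinner_diff_left hinner_diff_right hcarrier_closed algebra_simps)
next
  fix u v assume uv: "u \<in> hcarrier H" "v \<in> hcarrier H"
  have "hinner H 0 0 = 0" using hinner_zero hcarrier_closed(1) by blast
  then show "hdist H u v = 0 \<longleftrightarrow> u = v"
    using uv hilbert_spaceD(5)[OF H, of "u - v"] hcarrier_closed(3)[OF uv]
    by (force simp: hdist_def)
next
  fix u v w assume uv: "u \<in> hcarrier H" "v \<in> hcarrier H" "w \<in> hcarrier H"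
  define x y where "x = u - v" and "y = v - w"
  have x: "x \<in> hcarrier H" and y: "y \<in> hcarrier H" using x_def y_def uv hcarrier_closed by auto
  define a b where "a = sqrt (Re (hinner H x x))" and "b = sqrt (Re (hinner H y y))"
  have ab: "a \<ge> 0" "b \<ge> 0" "a\<^sup>2 = Re (hinner H x x)" "b\<^sup>2 = Re (hinner H y y)"
    using hinner_self(2) x y by (auto simp: a_def b_def)
  have xy: "x + y \<in> hcarrier H" using hcarrier_closed x y by blast
  have *: "hinner H (x + y) (x + y) = hinner H x (x + y) + hinner H y (x + y)"
    using hilbert_spaceD(2)[OF H x y xy] .
  have **: "hinner H z (x + y) = hinner H z x + hinner H z y" if z: "z \<in> hcarrier H" for z
    using hilbert_spaceD(2)[OF H x y z] hilbert_spaceD(4)[OF H] x y xy z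
    by (metis complex_cnj_add)
  have "Re (hinner H y x) = Re (hinner H x y)"
    using hilbert_spaceD(4)[OF H x y] by simp
  moreover have "Re (hinner H x y) \<le> a * b"
    using hinner_Cauchy_Schwarz[OF x y] complex_Re_le_cmod[of "hinner H x y"]
    by (simp add: a_def b_def)
  ultimately have "Re (hinner H (x + y) (x + y)) \<le> (a + b)\<^sup>2"
    using ab * **[OF x] **[OF y] by (simp add: power2_sum)
  then have "sqrt (Re (hinner H (x + y) (x + y))) \<le> a + b"
    using ab by (simp add: real_le_lsqrt)
  moreover have "x + y = u - w" by (simp add: x_def y_def)
  ultimately show "hdist H u w \<le> hdist H u v + hdist H v w"
    using uv by (simp add: hdist_def a_def b_def x_def y_def)
qed

lemma limitin_hdist:
  "limitin (htopology H) s l F \<longleftrightarrow>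
   l \<in> hcarrier H \<and> (\<forall>e>0. \<forall>\<^sub>F x in F. s x \<in> hcarrier H \<and> hdist H (s x) l < e)"
  using Metric_space.limitin_metric[OF Metric_space_hdist] .

lemma closedin_annihilator:
  assumes B: "B \<subseteq> hcarrier H"
  shows "closedin (htopology H) {u \<in> hcarrier H. \<forall>w\<in>B. hinner H u w = 0}"
  unfolding Metric_space.metric_closedin_iff_sequentially_closed[OF Metric_space_hdist]
proof (intro conjI allI impI)
  fix s l
  assume a: "range s \<subseteq> {u \<in> hcarrier H. \<forall>w\<in>B. hinner H u w = 0} \<and>
    limitin (htopology H) s l sequentially"
  then have l: "l \<in> hcarrier H"
    and lim: "\<And>e. e > 0 \<Longrightarrow> \<forall>\<^sub>F k in sequentially. hdist H (s k) l < e"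
    unfolding limitin_hdist by (auto elim: eventually_mono)
  have "hinner H l w = 0" if w: "w \<in> B" for w
  proof (rule ccontr)
    assume nz: "hinner H l w \<noteq> 0"
    define c where "c = sqrt (Re (hinner H w w))"
    have wH: "w \<in> hcarrier H" using w B by blast
    have c: "c \<ge> 0" using hinner_self(2)[OF wH] c_def by simp
    have "\<forall>\<^sub>F k in sequentially. hdist H (s k) l < cmod (hinner H l w) / (c + 1)"
      using lim nz c by simp
    then obtain k where k: "hdist H (s k) l < cmod (hinner H l w) / (c + 1)"
      using eventually_happens' by fastforce
    have sk: "s k \<in> hcarrier H" "hinner H (s k) w = 0" using a w by auto
    have "cmod (hinner H l w) = cmod (hinner H (s k - l) w)"
      using sk l wH by (simp add: hinner_diff_left)
    also have "\<dots> \<le> hdist H (s k) l * c"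
      using hinner_Cauchy_Schwarz[of "s k - l" w] sk l wH hcarrier_closed
      by (simp add: hdist_def c_def)
    also have "\<dots> \<le> hdist H (s k) l * (c + 1)"
      using Metric_space.nonneg[OF Metric_space_hdist] by (simp add: mult_left_mono)
    also have "\<dots> < cmod (hinner H l w)" using k c by (simp add: field_simps)
    finally show False by simp
  qed
  then show "l \<in> {u \<in> hcarrier H. \<forall>w\<in>B. hinner H u w = 0}" using l by blast
qed auto

end

lemma unitary_mapD:
  assumes "unitary_map H H' U"
  shows "bij_betw U (hcarrier H) (hcarrier H')"
    and "\<And>u v. u \<in> hcarrier H \<Longrightarrow> v \<in> hcarrier H \<Longrightarrow> U (u + v) = U u + U v"
    and "\<And>u c. u \<in> hcarrier H \<Longrightarrow> U (fscale c u) = fscale c (U u)"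
    and "\<And>u v. u \<in> hcarrier H \<Longrightarrow> v \<in> hcarrier H \<Longrightarrow> hinner H' (U u) (U v) = hinner H u v"
    and "\<And>u. u \<in> hcarrier H \<Longrightarrow> U u \<in> hcarrier H'"
  using assms bij_betwE unfolding unitary_map_def by blast+

lemma unitary_map_trans:
  assumes "unitary_map A B U" "unitary_map B C V"
  shows "unitary_map A C (V \<circ> U)"
  using unitary_mapD[OF assms(1)] unitary_mapD[OF assms(2)]
  by (auto simp: unitary_map_def intro: bij_betw_trans)

lemma unitary_map_inv:
  assumes A: "cfun.subspace (hcarrier A)" and U: "unitary_map A B U"
  shows "unitary_map B A (inv_into (hcarrier A) U)"
proof -
  note D = unitary_mapD[OF U]
  let ?V = "inv_into (hcarrier A) U"
  have V: "?V b \<in> hcarrier A" "U (?V b) = b" if "b \<in> hcarrier B" for b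
    using D(1) that by (auto simp: bij_betw_def inv_into_into f_inv_into_f)
  have VU: "?V (U a) = a" if "a \<in> hcarrier A" for a
    using D(1) that by (auto simp: bij_betw_def)
  have "?V (x + y) = ?V x + ?V y" if "x \<in> hcarrier B" "y \<in> hcarrier B" for x y
    using VU[of "?V x + ?V y"] D(2) V that cfun.subspace_add[OF A] by simp
  moreover have "?V (fscale c x) = fscale c (?V x)" if "x \<in> hcarrier B" for x c
    using VU[of "fscale c (?V x)"] D(3) V that cfun.subspace_scale[OF A] by simp
  moreover have "hinner A (?V x) (?V y) = hinner B x y" if "x \<in> hcarrier B" "y \<in> hcarrier B" for x y
    using D(4)[of "?V x" "?V y"] V that by simp
  ultimately show ?thesis unfolding unitary_map_def using bij_betw_inv_into[OF D(1)] by blast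
qed

lemma irreducible_unitary_repD:
  assumes "irreducible_unitary_rep N \<pi>"
  shows "hilbert_space \<pi>"
    and "\<And>n. n \<in> carrier N \<Longrightarrow> unitary_map \<pi> \<pi> (rop \<pi> n)"
    and "\<And>n u. n \<in> carrier N \<Longrightarrow> u \<in> hcarrier \<pi> \<Longrightarrow> rop \<pi> n u \<in> hcarrier \<pi>"
    and "\<And>m n u. m \<in> carrier N \<Longrightarrow> n \<in> carrier N \<Longrightarrow> u \<in> hcarrier \<pi> \<Longrightarrow>
        rop \<pi> (m \<otimes>\<^bsub>N\<^esub> n) u = rop \<pi> m (rop \<pi> n u)"
    and "hcarrier \<pi> \<noteq> {0}"
    and "\<And>W. cfun.subspace W \<Longrightarrow> closedin (htopology \<pi>) W \<Longrightarrow>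
        (\<And>n w. n \<in> carrier N \<Longrightarrow> w \<in> W \<Longrightarrow> rop \<pi> n w \<in> W) \<Longrightarrow> W = {0} \<or> W = hcarrier \<pi>"
  using assms unitary_mapD(5)
  unfolding irreducible_unitary_rep_def unitary_rep_def by blast+


section \<open>The unitary dual\<close>

definition rep_equiv_rel ::
  "('n, 'b) monoid_scheme \<Rightarrow> (('n, 'n) urep \<times> ('n, 'n) urep) set" where
  "rep_equiv_rel N = {(\<pi>, \<sigma>). irreducible_unitary_rep N \<pi> \<and> irreducible_unitary_rep N \<sigma> \<and>
     rep_equiv N \<pi> \<sigma>}"

definition unitary_dual :: "('n, 'b) monoid_scheme \<Rightarrow> ('n, 'n) urep set set" where
  "unitary_dual N = {\<pi>. irreducible_unitary_rep N \<pi>} // rep_equiv_rel N"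

lemma equiv_rep_equiv_rel:
  assumes "group N"
  shows "equiv {\<pi>. irreducible_unitary_rep N \<pi>} (rep_equiv_rel N)"
proof (rule equivI)
  show "rep_equiv_rel N \<subseteq> {\<pi>. irreducible_unitary_rep N \<pi>} \<times> {\<pi>. irreducible_unitary_rep N \<pi>}"
    by (auto simp: rep_equiv_rel_def)
  have "unitary_map \<pi> \<pi> (\<lambda>u. u)" for \<pi> :: "('a, 'a) urep"
    unfolding unitary_map_def by (auto simp: bij_betw_def)
  then have "rep_equiv N \<pi> \<pi>" for \<pi> :: "('a, 'a) urep"
    unfolding rep_equiv_def by (intro exI[of _ "\<lambda>u. u"]) auto
  then show "refl_on {\<pi>. irreducible_unitary_rep N \<pi>} (rep_equiv_rel N)"
    by (auto simp: refl_on_def rep_equiv_rel_def)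
  have "rep_equiv N \<sigma> \<pi>"
    if irr: "irreducible_unitary_rep N \<pi>" "irreducible_unitary_rep N \<sigma>" and e: "rep_equiv N \<pi> \<sigma>"
    for \<pi> \<sigma> :: "('a, 'a) urep"
  proof -
    obtain U where U: "unitary_map \<pi> \<sigma> U"
      "\<And>n u. n \<in> carrier N \<Longrightarrow> u \<in> hcarrier \<pi> \<Longrightarrow> U (rop \<pi> n u) = rop \<sigma> n (U u)"
      using e unfolding rep_equiv_def by auto
    let ?V = "inv_into (hcarrier \<pi>) U"
    have b: "bij_betw U (hcarrier \<pi>) (hcarrier \<sigma>)" using unitary_mapD(1)[OF U(1)] .
    have "?V (rop \<sigma> n w) = rop \<pi> n (?V w)" if n: "n \<in> carrier N" and w: "w \<in> hcarrier \<sigma>" for n w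
    proof -
      have *: "?V w \<in> hcarrier \<pi>" "U (?V w) = w"
        using b w by (auto simp: bij_betw_def inv_into_into f_inv_into_f)
      then have "rop \<pi> n (?V w) \<in> hcarrier \<pi>"
        using irreducible_unitary_repD(3)[OF irr(1) n] by blast
      then have "?V (U (rop \<pi> n (?V w))) = rop \<pi> n (?V w)"
        using b by (auto simp: bij_betw_def)
      then show ?thesis using U(2)[OF n *(1)] * by simp
    qed
    moreover have "unitary_map \<sigma> \<pi> ?V"
      by (rule unitary_map_inv[OF hilbert_spaceD(1)[OF irreducible_unitary_repD(1)[OF irr(1)]] U(1)])
    ultimately show ?thesis unfolding rep_equiv_def by blast
  qed
  then show "sym (rep_equiv_rel N)" by (auto simp: sym_def rep_equiv_rel_def)
  have "rep_equiv N \<pi> \<tau>" if e: "rep_equiv N \<pi> \<sigma>" "rep_equiv N \<sigma> \<tau>" for \<pi> \<sigma> \<tau> :: "('a, 'a) urep"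
  proof -
    obtain U V where "unitary_map \<pi> \<sigma> U" "unitary_map \<sigma> \<tau> V"
      "\<forall>n\<in>carrier N. \<forall>u\<in>hcarrier \<pi>. U (rop \<pi> n u) = rop \<sigma> n (U u)"
      "\<forall>n\<in>carrier N. \<forall>u\<in>hcarrier \<sigma>. V (rop \<sigma> n u) = rop \<tau> n (V u)"
      using e unfolding rep_equiv_def by blast
    then show ?thesis unfolding rep_equiv_def
      by (intro exI[of _ "V \<circ> U"]) (auto intro: unitary_map_trans simp: unitary_mapD(5))
  qed
  then show "trans (rep_equiv_rel N)" unfolding trans_def rep_equiv_rel_def by blast
qed

lemma unitary_image_irreducible:
  fixes \<pi> :: "('n, 'i) urep" and \<sigma> :: "('n, 'j) urep"
  assumes irr: "irreducible_unitary_rep N \<pi>"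
    and S: "cfun.subspace (hcarrier \<sigma>)"
    and U: "unitary_map \<pi> \<sigma> U"
    and int: "\<And>n u. n \<in> carrier N \<Longrightarrow> u \<in> hcarrier \<pi> \<Longrightarrow> U (rop \<pi> n u) = rop \<sigma> n (U u)"
    and N: "\<And>m n. m \<in> carrier N \<Longrightarrow> n \<in> carrier N \<Longrightarrow> m \<otimes>\<^bsub>N\<^esub> n \<in> carrier N"
  shows "irreducible_unitary_rep N \<sigma>"
proof -
  note P = irreducible_unitary_repD[OF irr]
  note Hp = hilbert_spaceD[OF P(1)]
  note D = unitary_mapD[OF U]
  have sub_pi: "cfun.subspace (hcarrier \<pi>)" by (rule Hp)
  have inj: "inj_on U (hcarrier \<pi>)" and im: "hcarrier \<sigma> = U ` hcarrier \<pi>"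
    using D(1) by (auto simp: bij_betw_def)
  have U0: "U 0 = 0"
    using D(2)[of 0 0] cfun.subspace_0[OF sub_pi] by simp
  have Ud: "U (u - v) = U u - U v" if "u \<in> hcarrier \<pi>" "v \<in> hcarrier \<pi>" for u v
    using D(2)[of "u - v" v] cfun.subspace_diff[OF sub_pi] that by (simp add: algebra_simps)
  have dist: "hdist \<sigma> (U u) (U v) = hdist \<pi> u v" if "u \<in> hcarrier \<pi>" "v \<in> hcarrier \<pi>" for u v
    using that D(4)[of "u - v" "u - v"] D(5) Ud[OF that] cfun.subspace_diff[OF sub_pi]
    by (simp add: hdist_def)
  have Mp: "Metric_space (hcarrier \<pi>) (hdist \<pi>)" by (rule Metric_space_hdist[OF P(1)])
  have pre: "\<forall>u\<in>hcarrier \<sigma>. \<forall>v\<in>hcarrier \<sigma>. \<forall>w\<in>hcarrier \<sigma>.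
        hinner \<sigma> (u + v) w = hinner \<sigma> u w + hinner \<sigma> v w"
     "\<forall>u\<in>hcarrier \<sigma>. \<forall>w\<in>hcarrier \<sigma>. \<forall>c. hinner \<sigma> (fscale c u) w = c * hinner \<sigma> u w"
     "\<forall>u\<in>hcarrier \<sigma>. \<forall>w\<in>hcarrier \<sigma>. hinner \<sigma> w u = cnj (hinner \<sigma> u w)"
     "\<forall>u\<in>hcarrier \<sigma>. u \<noteq> 0 \<longrightarrow> Re (hinner \<sigma> u u) > 0"
    subgoal unfolding im ball_simps
    proof (intro ballI)
      fix u v w assume u: "u \<in> hcarrier \<pi>" "v \<in> hcarrier \<pi>" "w \<in> hcarrier \<pi>"
      then have "hinner \<sigma> (U u + U v) (U w) = hinner \<pi> (u + v) w"
        using D(2)[OF u(1,2)] D(4)[of "u + v" w] cfun.subspace_add[OF sub_pi] by simp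
      then show "hinner \<sigma> (U u + U v) (U w) = hinner \<sigma> (U u) (U w) + hinner \<sigma> (U v) (U w)"
        using D(4) Hp(2) u by simp
    qed
    subgoal unfolding im ball_simps
    proof (intro ballI allI)
      fix u w c assume u: "u \<in> hcarrier \<pi>" "w \<in> hcarrier \<pi>"
      then have "hinner \<sigma> (fscale c (U u)) (U w) = hinner \<pi> (fscale c u) w"
        using D(3)[OF u(1)] D(4)[of "fscale c u" w] cfun.subspace_scale[OF sub_pi] by simp
      then show "hinner \<sigma> (fscale c (U u)) (U w) = c * hinner \<sigma> (U u) (U w)"
        using D(4) Hp(3) u by simp
    qed
    subgoal unfolding im ball_simps
    proof (intro ballI)
      fix u w assume u: "u \<in> hcarrier \<pi>" "w \<in> hcarrier \<pi>"
      show "hinner \<sigma> (U w) (U u) = cnj (hinner \<sigma> (U u) (U w))"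
        using D(4)[OF u] D(4)[OF u(2,1)] Hp(4)[OF u] by simp
    qed
    subgoal unfolding im using D(4) Hp(5) U0 by fastforce
    done
  have Ms: "Metric_space (hcarrier \<sigma>) (hdist \<sigma>)"
  proof
    have ext: "u \<in> hcarrier \<sigma> \<Longrightarrow> \<exists>a\<in>hcarrier \<pi>. u = U a" for u using im by blast
    show "0 \<le> hdist \<sigma> u v" for u v
    proof (cases "u \<in> hcarrier \<sigma> \<and> v \<in> hcarrier \<sigma>")
      case True
      then show ?thesis using ext dist Metric_space.nonneg[OF Mp] by metis
    qed (auto simp: hdist_def)
    show "hdist \<sigma> u v = hdist \<sigma> v u" for u v
    proof (cases "u \<in> hcarrier \<sigma> \<and> v \<in> hcarrier \<sigma>")
      case True
      then show ?thesis using ext dist Metric_space.commute[OF Mp] by metis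
    qed (auto simp: hdist_def)
    show "hdist \<sigma> u v = 0 \<longleftrightarrow> u = v" if "u \<in> hcarrier \<sigma>" "v \<in> hcarrier \<sigma>" for u v
      using that ext dist Metric_space.zero[OF Mp] inj by (metis inj_onD)
    show "hdist \<sigma> u w \<le> hdist \<sigma> u v + hdist \<sigma> v w"
      if "u \<in> hcarrier \<sigma>" "v \<in> hcarrier \<sigma>" "w \<in> hcarrier \<sigma>" for u v w
      using that ext dist Metric_space.triangle[OF Mp] by metis
  qed
  have lim: "limitin (htopology \<sigma>) (\<lambda>k. U (s k)) (U l) sequentially"
    if l: "limitin (htopology \<pi>) s l sequentially" and s: "range s \<subseteq> hcarrier \<pi>"
    for s :: "nat \<Rightarrow> _" and l
    unfolding Metric_space.limitin_metric[OF Ms]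
  proof (intro conjI allI impI)
    have lH: "l \<in> hcarrier \<pi>" using l limitin_hdist[OF P(1)] by blast
    then show "U l \<in> hcarrier \<sigma>" by (rule D(5))
    fix e :: real assume "e > 0"
    then have "\<forall>\<^sub>F k in sequentially. s k \<in> hcarrier \<pi> \<and> hdist \<pi> (s k) l < e"
      using l limitin_hdist[OF P(1)] by blast
    then show "\<forall>\<^sub>F k in sequentially. U (s k) \<in> hcarrier \<sigma> \<and> hdist \<sigma> (U (s k)) (U l) < e"
      by (rule eventually_mono) (simp add: dist[OF _ lH] D(5))
  qed
  have complete: "Metric_space.mcomplete (hcarrier \<sigma>) (hdist \<sigma>)"
    unfolding Metric_space.mcomplete_def[OF Ms]
  proof (intro allI impI)
    fix s assume s: "Metric_space.MCauchy (hcarrier \<sigma>) (hdist \<sigma>) s"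
    define r where "r = (\<lambda>k. inv_into (hcarrier \<pi>) U (s k))"
    have sr: "range s \<subseteq> hcarrier \<sigma>" using s unfolding Metric_space.MCauchy_def[OF Ms] by blast
    then have r: "r k \<in> hcarrier \<pi>" "U (r k) = s k" for k
      using im by (auto simp: r_def inv_into_into f_inv_into_f image_subset_iff)
    have "hdist \<sigma> (s j) (s k) = hdist \<pi> (r j) (r k)" for j k
      using dist[of "r j" "r k"] r by simp
    then have "Metric_space.MCauchy (hcarrier \<pi>) (hdist \<pi>) r"
      using s r unfolding Metric_space.MCauchy_def[OF Ms] Metric_space.MCauchy_def[OF Mp] by auto
    then obtain l where "limitin (htopology \<pi>) r l sequentially"
      using Hp(6) unfolding Metric_space.mcomplete_def[OF Mp] by blast
    from lim[OF this] r have "limitin (htopology \<sigma>) s (U l) sequentially"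
      by (auto simp: image_subset_iff)
    then show "\<exists>x. limitin (htopology \<sigma>) s x sequentially" by blast
  qed
  have hs: "hilbert_space \<sigma>" unfolding hilbert_space_def using S pre complete by blast
  let ?V = "inv_into (hcarrier \<pi>) U"
  have V: "unitary_map \<sigma> \<pi> ?V" by (rule unitary_map_inv[OF sub_pi U])
  have un: "unitary_map \<sigma> \<sigma> (rop \<sigma> n)" if n: "n \<in> carrier N" for n
  proof -
    have *: "unitary_map \<sigma> \<sigma> (U \<circ> (rop \<pi> n \<circ> ?V))"
      using unitary_map_trans[OF unitary_map_trans[OF V P(2)[OF n]] U] .
    have eq: "(U \<circ> (rop \<pi> n \<circ> ?V)) x = rop \<sigma> n x" if "x \<in> hcarrier \<sigma>" for x
      using that int[OF n, of "?V x"] im by (auto simp: inv_into_into f_inv_into_f)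
    have cl: "x + y \<in> hcarrier \<sigma>" "fscale c x \<in> hcarrier \<sigma>"
      if "x \<in> hcarrier \<sigma>" "y \<in> hcarrier \<sigma>" for x y c
      using that cfun.subspace_add[OF S] cfun.subspace_scale[OF S] by auto
    let ?R = "U \<circ> (rop \<pi> n \<circ> ?V)"
    note R = unitary_mapD[OF *]
    have "bij_betw (rop \<sigma> n) (hcarrier \<sigma>) (hcarrier \<sigma>)"
      using R(1) bij_betw_cong[of "hcarrier \<sigma>" ?R "rop \<sigma> n"] eq by blast
    moreover have "rop \<sigma> n (x + y) = rop \<sigma> n x + rop \<sigma> n y"
      if "x \<in> hcarrier \<sigma>" "y \<in> hcarrier \<sigma>" for x y
      using R(2)[OF that] unfolding eq[OF cl(1)[OF that]] eq[OF that(1)] eq[OF that(2)] .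
    moreover have "rop \<sigma> n (fscale c x) = fscale c (rop \<sigma> n x)"
      if "x \<in> hcarrier \<sigma>" for x c
      using R(3)[OF that, of c] unfolding eq[OF cl(2)[OF that that]] eq[OF that] .
    moreover have "hinner \<sigma> (rop \<sigma> n x) (rop \<sigma> n y) = hinner \<sigma> x y"
      if "x \<in> hcarrier \<sigma>" "y \<in> hcarrier \<sigma>" for x y
      using R(4)[OF that] unfolding eq[OF that(1)] eq[OF that(2)] .
    ultimately show ?thesis unfolding unitary_map_def by blast
  qed
  have mul: "rop \<sigma> (m \<otimes>\<^bsub>N\<^esub> n) w = rop \<sigma> m (rop \<sigma> n w)"
    if mn: "m \<in> carrier N" "n \<in> carrier N" and w: "w \<in> hcarrier \<sigma>" for m n w
  proof -
    obtain u where u: "u \<in> hcarrier \<pi>" "w = U u" using w unfolding im by (rule imageE)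
    show ?thesis
      unfolding u(2) int[OF N[OF mn] u(1), symmetric] int[OF mn(2) u(1), symmetric]
        int[OF mn(1) P(3)[OF mn(2) u(1)], symmetric] P(4)[OF mn u(1)] ..
  qed
  have "W = {0} \<or> W = hcarrier \<sigma>"
    if W: "cfun.subspace W" "closedin (htopology \<sigma>) W"
      "\<forall>n\<in>carrier N. \<forall>w\<in>W. rop \<sigma> n w \<in> W" for W
  proof -
    define X where "X = {u \<in> hcarrier \<pi>. U u \<in> W}"
    have Wseq: "W \<subseteq> hcarrier \<sigma>"
      "\<And>s l. range s \<subseteq> W \<Longrightarrow> limitin (htopology \<sigma>) s l sequentially \<Longrightarrow> l \<in> W"
      using W(2) unfolding Metric_space.metric_closedin_iff_sequentially_closed[OF Ms] by simp_all
    have WX: "W = U ` X"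
    proof
      show "W \<subseteq> U ` X"
      proof
        fix w assume w: "w \<in> W"
        then have "w \<in> U ` hcarrier \<pi>" using Wseq(1) im by auto
        then show "w \<in> U ` X" using w by (auto simp: X_def)
      qed
    qed (auto simp: X_def)
    have "cfun.subspace X"
      using cfun.subspace_0[OF W(1)] cfun.subspace_add[OF W(1)] cfun.subspace_scale[OF W(1)]
        cfun.subspace_0[OF sub_pi] cfun.subspace_add[OF sub_pi] cfun.subspace_scale[OF sub_pi]
      by (simp add: cfun.subspace_def X_def D(2,3) U0)
    moreover have "closedin (htopology \<pi>) X"
      unfolding Metric_space.metric_closedin_iff_sequentially_closed[OF Mp]
    proof (intro conjI allI impI)
      fix s l assume a: "range s \<subseteq> X \<and> limitin (htopology \<pi>) s l sequentially"
      then have "limitin (htopology \<sigma>) (\<lambda>k. U (s k)) (U l) sequentially"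
        using lim[of s l] X_def by auto
      moreover have "range (\<lambda>k. U (s k)) \<subseteq> W" using a X_def by auto
      ultimately have "U l \<in> W" by (rule Wseq(2)[rotated])
      moreover have "l \<in> hcarrier \<pi>" using a limitin_hdist[OF P(1)] by blast
      ultimately show "l \<in> X" by (simp add: X_def)
    qed (auto simp: X_def)
    moreover have "rop \<pi> n u \<in> X" if "n \<in> carrier N" "u \<in> X" for n u
      using that W(3) int P(3) by (simp add: X_def)
    ultimately have "X = {0} \<or> X = hcarrier \<pi>" by (rule P(6))
    then show ?thesis
    proof
      assume "X = {0}"
      then show ?thesis unfolding WX by (simp add: U0)
    next
      assume "X = hcarrier \<pi>"
      then show ?thesis unfolding WX by (simp add: im)
    qed
  qed
  moreover have "hcarrier \<sigma> \<noteq> {0}"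
  proof
    assume "hcarrier \<sigma> = {0}"
    then have "U u = U 0" if "u \<in> hcarrier \<pi>" for u
      using D(5)[OF that] U0 by simp
    then have "u = 0" if "u \<in> hcarrier \<pi>" for u
      using inj_onD[OF inj _ that cfun.subspace_0[OF sub_pi]] that by blast
    then show False using P(5) cfun.subspace_0[OF sub_pi] by blast
  qed
  ultimately show ?thesis
    unfolding irreducible_unitary_rep_def unitary_rep_def using hs un mul by simp
qed

text \<open>Every irreducible unitary representation of \<open>N\<close> on a Hilbert space of functions on any
  type is equivalent to one on a Hilbert space of functions on the type of \<open>N\<close> (via matrix
  coefficients), so \<^const>\<open>unitary_dual\<close> omits no class.\<close>

lemma unitary_dual_exhaustive:
  fixes N :: "('n, 'b) monoid_scheme" and \<pi> :: "('n, 'i) urep"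
  assumes "group N" and irr: "irreducible_unitary_rep N \<pi>"
  shows "\<exists>\<sigma> :: ('n, 'n) urep. irreducible_unitary_rep N \<sigma> \<and> rep_equiv N \<pi> \<sigma>"
proof -
  interpret group N by fact
  note P = irreducible_unitary_repD[OF irr]
  note Hp = hilbert_spaceD[OF P(1)]
  note sub = hcarrier_closed[OF P(1)]
  obtain v where v: "v \<in> hcarrier \<pi>" "v \<noteq> 0" using P(5) sub(1) by blast
  define U where "U = (\<lambda>u n. if n \<in> carrier N then hinner \<pi> u (rop \<pi> n v) else 0)"
  have lin: "U (u + w) = U u + U w" if "u \<in> hcarrier \<pi>" "w \<in> hcarrier \<pi>" for u w
    using that Hp(2) P(3) v by (auto simp: U_def fun_eq_iff)
  have scl: "U (fscale c u) = fscale c (U u)" if "u \<in> hcarrier \<pi>" for u c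
    using that Hp(3) P(3) v by (auto simp: U_def fun_eq_iff fscale_def)
  have one: "rop \<pi> \<one>\<^bsub>N\<^esub> u = u" if u: "u \<in> hcarrier \<pi>" for u
  proof -
    have "rop \<pi> \<one>\<^bsub>N\<^esub> (rop \<pi> \<one>\<^bsub>N\<^esub> u) = rop \<pi> \<one>\<^bsub>N\<^esub> u"
      using P(4)[of "\<one>\<^bsub>N\<^esub>" "\<one>\<^bsub>N\<^esub>" u] u by simp
    then show ?thesis
      using unitary_mapD(1)[OF P(2)[of "\<one>\<^bsub>N\<^esub>"]] u P(3)[of "\<one>\<^bsub>N\<^esub>" u]
      by (auto simp: bij_betw_def dest: inj_onD)
  qed
  have adj: "hinner \<pi> (rop \<pi> n u) w = hinner \<pi> u (rop \<pi> (inv\<^bsub>N\<^esub> n) w)"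
    if "n \<in> carrier N" "u \<in> hcarrier \<pi>" "w \<in> hcarrier \<pi>" for n u w
    using unitary_mapD(4)[OF P(2)[of n], of u "rop \<pi> (inv\<^bsub>N\<^esub> n) w"] that P(3)
      P(4)[of n "inv\<^bsub>N\<^esub> n" w] one by simp
  define W where "W = {u \<in> hcarrier \<pi>. \<forall>w\<in>(\<lambda>n. rop \<pi> n v) ` carrier N. hinner \<pi> u w = 0}"
  have WU: "W = {u \<in> hcarrier \<pi>. U u = 0}"
    by (auto simp: W_def U_def fun_eq_iff)
  have "closedin (htopology \<pi>) W"
    unfolding W_def using P(3) v by (intro closedin_annihilator[OF P(1)]) auto
  moreover have "cfun.subspace W"
    unfolding W_def cfun.subspace_def
    using sub Hp(2,3) hinner_zero[OF P(1)] P(3) v by auto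
  moreover have "rop \<pi> n w \<in> W" if n: "n \<in> carrier N" and w: "w \<in> W" for n w
  proof -
    have wH: "w \<in> hcarrier \<pi>" using w W_def by blast
    have "hinner \<pi> (rop \<pi> n w) (rop \<pi> m v) = 0" if m: "m \<in> carrier N" for m
    proof -
      have "hinner \<pi> (rop \<pi> n w) (rop \<pi> m v) = hinner \<pi> w (rop \<pi> (inv\<^bsub>N\<^esub> n \<otimes>\<^bsub>N\<^esub> m) v)"
        using adj[OF n wH P(3)[OF m v(1)]] P(4)[of "inv\<^bsub>N\<^esub> n" m v] n m v by simp
      also have "\<dots> = 0" using w n m unfolding W_def by blast
      finally show ?thesis .
    qed
    then show ?thesis unfolding W_def using P(3)[OF n wH] by blast
  qed
  ultimately have "W = {0} \<or> W = hcarrier \<pi>" using P(6) by blast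
  moreover have "v \<notin> W"
    using Hp(5)[OF v] one[OF v(1)] unfolding W_def by force
  ultimately have W0: "W = {0}" using v by blast
  have inj: "inj_on U (hcarrier \<pi>)"
  proof
    fix u w assume uw: "u \<in> hcarrier \<pi>" "w \<in> hcarrier \<pi>" "U u = U w"
    have "U (u - w) + U w = U u" using lin[of "u - w" w] uw sub(3) by simp
    then have "U (u - w) = 0" using uw by simp
    then have "u - w \<in> W" using WU uw sub(3) by simp
    then show "u = w" using W0 by simp
  qed
  define V where "V = inv_into (hcarrier \<pi>) U"
  have VU: "V (U u) = u" if "u \<in> hcarrier \<pi>" for u using inj that by (simp add: V_def)
  define \<sigma> :: "('n, 'n) urep" where
    "\<sigma> = \<lparr>hcarrier = U ` hcarrier \<pi>, hinner = (\<lambda>x y. hinner \<pi> (V x) (V y)),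
          rop = (\<lambda>n x. U (rop \<pi> n (V x)))\<rparr>"
  have "cfun.subspace (hcarrier \<sigma>)"
  proof -
    have "0 \<in> U ` hcarrier \<pi>" using lin[of 0 0] sub(1) by (metis add_cancel_right_right imageI)
    then show ?thesis
      unfolding cfun.subspace_def \<sigma>_def using sub by (auto simp flip: lin scl)
  qed
  moreover have U: "unitary_map \<pi> \<sigma> U"
    unfolding unitary_map_def using inj lin scl VU by (auto simp: \<sigma>_def bij_betw_def)
  moreover have int: "U (rop \<pi> n u) = rop \<sigma> n (U u)" if "u \<in> hcarrier \<pi>" for n u
    using VU[OF that] by (simp add: \<sigma>_def)
  ultimately have "irreducible_unitary_rep N \<sigma>"
    using unitary_image_irreducible[OF irr, of \<sigma> U] by blast
  moreover have "rep_equiv N \<pi> \<sigma>" unfolding rep_equiv_def using U int by blast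
  ultimately show ?thesis by blast
qed

definition class_kernel ::
  "('n, 'b) monoid_scheme \<Rightarrow> ('n, 'n) urep set \<Rightarrow> ('n \<Rightarrow> complex) set" where
  "class_kernel N P = (\<Inter>\<pi>\<in>P. rep_kernel N \<pi>)"

definition K :: "('n, 'b) monoid_scheme \<Rightarrow> ('n, 'n) urep set set \<Rightarrow> ('n \<Rightarrow> complex) set" where
  "K N \<Omega> = {f \<in> l1 N. \<forall>P\<in>\<Omega>. f \<in> class_kernel N P}"

definition conj_rep ::
  "('n, 'b) monoid_scheme \<Rightarrow> 'n \<Rightarrow> ('n, 'i) urep \<Rightarrow> ('n, 'i) urep" where
  "conj_rep G t \<pi> = \<pi>\<lparr>rop := \<lambda>n. rop \<pi> (inv\<^bsub>G\<^esub> t \<otimes>\<^bsub>G\<^esub> n \<otimes>\<^bsub>G\<^esub> t)\<rparr>"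

text \<open>The class of \<open>t \<cdot> \<pi>\<close> for \<open>\<pi>\<close> in the class \<open>P\<close>. The image of \<open>P\<close> under \<^const>\<open>conj_rep\<close> is
  saturated because the values of \<^const>\<open>rop\<close> off the group and off the Hilbert space are
  unconstrained.\<close>

definition dual_action ::
  "('n, 'b) monoid_scheme \<Rightarrow> 'n \<Rightarrow> ('n, 'n) urep set \<Rightarrow> ('n, 'n) urep set" where
  "dual_action G t P = rep_equiv_rel (FC_group G) `` (conj_rep G t ` P)"

definition dual_orbit ::
  "('n, 'b) monoid_scheme \<Rightarrow> ('n, 'n) urep set \<Rightarrow> ('n, 'n) urep set set" where
  "dual_orbit G P = (\<lambda>t. dual_action G t P) ` carrier G"

definition union_of_orbits :: "('n, 'b) monoid_scheme \<Rightarrow> ('n, 'n) urep set set \<Rightarrow> bool" where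
  "union_of_orbits G \<Omega> \<longleftrightarrow>
     (\<exists>\<P> \<subseteq> unitary_dual (FC_group G). \<Omega> = (\<Union>P\<in>\<P>. dual_orbit G P))"

end

theory Submission
  imports Defs
begin

text \<open>
  Write \<open>N\<close> for the finite normal subgroup \<open>FC(G)\<close>. Everything rests on one fact about a
  weak-star closed ideal \<open>I\<close>: if \<open>f \<in> I\<close>, then the restriction of \<open>f\<close> to \<open>N\<close> is again in \<open>I\<close>
  (\<open>weak_star_closed_restrict_FC\<close>). Indeed, the points outside \<open>N\<close> have infinite conjugacy classes, and by
  B. H. Neumann's theorem on coverings by cosets, finitely many of them can be conjugated
  simultaneously out of any finite set by an element \<open>s\<close> that commutes with \<open>N\<close>
  (\<open>conjugate_away_centralizing\<close>). A function vanishing at infinity therefore sees almost nothing of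
  \<open>\<delta>\<^sub>s * f * \<delta>\<^bsub>inv s\<^esub>\<close> except its part on \<open>N\<close>, which is that of \<open>f\<close>; so the restriction of \<open>f\<close> to \<open>N\<close>
  is a weak-star limit of conjugates of \<open>f\<close>.

  Applied to translates of \<open>f\<close>, this shows that the pieces of \<open>f\<close> on the cosets of \<open>N\<close>, moved back
  to \<open>N\<close>, lie in \<open>J = I \<inter> \<ell>\<^sup>1(N)\<close>. As \<open>f\<close> is the norm convergent sum of its pieces and \<open>I\<close> is norm
  closed, \<open>I\<close> is the direct sum of the translates of \<open>J\<close> (\<open>weak_star_closed_ideal_eq_direct_sum\<close>).
  The space \<open>J\<close> is an ideal of the finite-dimensional algebra \<open>\<ell>\<^sup>1(N)\<close>, invariant under conjugation by \<open>G\<close>.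
  Such an ideal is the intersection of the kernels of the irreducible representations that
  annihilate it: the regular representation on the orthogonal complement of \<open>J\<close> has kernel \<open>J\<close>
  and splits into irreducibles (\<open>ideal_separated_by_irreducible\<close>). The set of these
  representations is a union of orbits, because \<open>J\<close> is invariant under conjugation
  (\<open>conj_invariant_ideal_eq_K\<close>).

  Conversely, let \<open>J = K(\<Omega>)\<close> for a union of orbits \<open>\<Omega>\<close>. Its direct sum consists of the functions
  all of whose coset pieces lie in \<open>J\<close> (\<open>l1_direct_sum_eq_slices\<close>). A subspace of a finite-dimensional space is
  its own double orthogonal complement, so this is the common zero set of functionals given by
  finitely supported functions and hence weak-star closed; it is invariant under left translations by
  construction, under right translations because \<open>J\<close> is invariant under conjugation, and therefore an ideal
  (\<open>slices_ideal\<close>).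
\<close>

section \<open>Finite conjugacy classes\<close>

context group
begin

abbreviation conjugate :: "'a \<Rightarrow> 'a \<Rightarrow> 'a" where
  "conjugate s x \<equiv> s \<otimes> x \<otimes> inv s"

lemma conjugate_conjugate:
  assumes "s \<in> carrier G" "t \<in> carrier G" "x \<in> carrier G"
  shows "conjugate s (conjugate t x) = conjugate (s \<otimes> t) x"
  using assms by (simp add: inv_mult_group m_assoc)

lemma conjugate_mult:
  assumes "s \<in> carrier G" "x \<in> carrier G" "y \<in> carrier G"
  shows "conjugate s (x \<otimes> y) = conjugate s x \<otimes> conjugate s y"
  using assms by (simp add: m_assoc inv_solve_left)

lemma conjugate_eq_iff:
  assumes "s \<in> carrier G" "x \<in> carrier G" "y \<in> carrier G"
  shows "conjugate s x = y \<longleftrightarrow> x = conjugate (inv s) y"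
proof -
  have "conjugate (inv s) (conjugate s x) = x" "conjugate s (conjugate (inv s) y) = y"
    using conjugate_conjugate[of "inv s" s x] conjugate_conjugate[of s "inv s" y] assms by simp_all
  then show ?thesis by metis
qed

lemma conjugate_cancel:
  assumes "t \<in> carrier G" "x \<in> carrier G"
  shows "inv t \<otimes> conjugate t x \<otimes> t = x" "conjugate t (inv t \<otimes> x \<otimes> t) = x"
  using conjugate_conjugate[of "inv t" t x] conjugate_conjugate[of t "inv t" x] assms by simp_all

lemma FC_iff: "x \<in> FC G \<longleftrightarrow> x \<in> carrier G \<and> finite ((\<lambda>s. conjugate s x) ` carrier G)"
proof -
  have "{conjugate s x | s. s \<in> carrier G} = (\<lambda>s. conjugate s x) ` carrier G" by auto
  then show ?thesis by (simp add: FC_def)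
qed

lemma FC_I:
  assumes "x \<in> carrier G" "\<And>s. s \<in> carrier G \<Longrightarrow> conjugate s x \<in> B" "finite B"
  shows "x \<in> FC G"
  using assms finite_subset[of "(\<lambda>s. conjugate s x) ` carrier G" B] by (auto simp: FC_iff)

lemma FC_conjugate: 
  assumes "s \<in> carrier G" "x \<in> FC G"
  shows "conjugate s x \<in> FC G"
proof -
  have x: "x \<in> carrier G" using assms FC_iff by blast
  have "(\<lambda>t. conjugate t (conjugate s x)) ` carrier G \<subseteq> (\<lambda>t. conjugate t x) ` carrier G"
    using assms x by (auto simp: conjugate_conjugate)
  then show ?thesis using assms x by (auto simp: FC_iff intro: finite_subset)
qed

lemma subgroup_FC: "subgroup (FC G) G"
proof (rule subgroupI)
  show "FC G \<subseteq> carrier G" by (auto simp: FC_def)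
  have "(\<lambda>s. conjugate s \<one>) ` carrier G \<subseteq> {\<one>}" by auto
  then have "\<one> \<in> FC G" by (auto simp: FC_iff intro: finite_subset)
  then show "FC G \<noteq> {}" by blast
next
  fix a assume a: "a \<in> FC G"
  then have "a \<in> carrier G" by (simp add: FC_iff)
  then have "(\<lambda>s. conjugate s (inv a)) ` carrier G = (\<lambda>s. inv (conjugate s a)) ` carrier G"
    by (intro image_cong) (simp_all add: inv_mult_group m_assoc)
  also have "\<dots> = m_inv G ` (\<lambda>s. conjugate s a) ` carrier G"
    by (simp add: image_image)
  finally show "inv a \<in> FC G" using a by (simp add: FC_iff)
next
  fix a b assume ab: "a \<in> FC G" "b \<in> FC G"
  let ?c = "\<lambda>x. (\<lambda>s. conjugate s x) ` carrier G"
  show "a \<otimes> b \<in> FC G"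
  proof (rule FC_I)
    show "finite ((\<lambda>(x, y). x \<otimes> y) ` (?c a \<times> ?c b))" using ab by (simp add: FC_iff)
    show "conjugate s (a \<otimes> b) \<in> (\<lambda>(x, y). x \<otimes> y) ` (?c a \<times> ?c b)" if "s \<in> carrier G" for s
      using ab that by (auto simp: FC_iff conjugate_mult)
  qed (use ab in \<open>simp add: FC_iff\<close>)
qed

text \<open>B. H. Neumann's lemma: a group covered by finitely many cosets of finitely many subgroups has
  one of them as a subgroup of finite index. If the cosets of \<open>H\<close> alone do not cover, some coset \<open>xH\<close> is
  disjoint from all of those used. It is then covered by cosets of the other subgroups, and so is, by
  translation, every coset of \<open>H\<close>; hence \<open>H\<close> can be dropped.\<close>

lemma neumann_coset_covering:
  assumes "finite S" "\<And>H. H \<in> S \<Longrightarrow> subgroup H G"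
    and "finite A" "A \<subseteq> carrier G" "carrier G \<subseteq> (\<Union>a\<in>A. \<Union>H\<in>S. l_coset G a H)"
  shows "\<exists>H\<in>S. \<exists>R. finite R \<and> R \<subseteq> carrier G \<and> carrier G \<subseteq> (\<Union>r\<in>R. l_coset G r H)"
  using assms
proof (induction S arbitrary: A rule: finite_induct)
  case empty
  then show ?case using one_closed by auto
next
  case (insert H S)
  have H: "subgroup H G" using insert.prems(1) by blast
  show ?case
  proof (cases "carrier G \<subseteq> (\<Union>a\<in>A. l_coset G a H)")
    case True
    then show ?thesis using insert.prems by blast
  next
    case False
    then obtain x where x: "x \<in> carrier G" "\<And>a. a \<in> A \<Longrightarrow> x \<notin> l_coset G a H" by blast
    \<comment> \<open>Left multiplication by \<open>a (inv x)\<close> maps \<open>xH\<close> to \<open>aH\<close> and a coset of \<open>b\<close> to one of \<open>a (inv x) b\<close>.\<close>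
    define A' where "A' = A \<union> (\<lambda>(a, b). a \<otimes> inv x \<otimes> b) ` (A \<times> A)"
    have A': "finite A'" "A' \<subseteq> carrier G"
      using insert.prems x(1) by (auto simp: A'_def)
    have "carrier G \<subseteq> (\<Union>a\<in>A'. \<Union>H\<in>S. l_coset G a H)"
    proof
      fix g assume g: "g \<in> carrier G"
      with insert.prems(4) obtain a K where aK: "a \<in> A" "K \<in> insert H S" "g \<in> l_coset G a K" by blast
      show "g \<in> (\<Union>a\<in>A'. \<Union>H\<in>S. l_coset G a H)"
      proof (cases "K \<in> S")
        case True
        then show ?thesis using aK by (auto simp: A'_def)
      next
        case False
        then obtain h where h: "h \<in> H" "g = a \<otimes> h" using aK by (auto simp: l_coset_def)
        have aG: "a \<in> carrier G" using aK insert.prems by blast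
        have hG: "h \<in> carrier G" using subgroup.mem_carrier[OF H h(1)] .
        have "x \<otimes> h \<in> (\<Union>a\<in>A. \<Union>K\<in>insert H S. l_coset G a K)"
          using insert.prems(4) x(1) hG by (intro subsetD[OF insert.prems(4)]) simp
        then obtain b L where bL: "b \<in> A" "L \<in> insert H S" "x \<otimes> h \<in> l_coset G b L"
          by blast
        have bG: "b \<in> carrier G" using bL insert.prems by blast
        obtain l where l: "l \<in> L" "x \<otimes> h = b \<otimes> l" using bL by (auto simp: l_coset_def)
        have lG: "l \<in> carrier G"
          using subgroup.mem_carrier[OF insert.prems(1)[OF bL(2)] l(1)] .
        have "L \<noteq> H"
        proof
          assume "L = H"
          have "x = b \<otimes> (l \<otimes> inv h)"
            using l(2) x(1) hG bG lG by (simp add: m_assoc[symmetric] inv_solve_right)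
          moreover have "l \<otimes> inv h \<in> H"
            using \<open>L = H\<close> l(1) h(1) H by (simp add: subgroup.m_closed subgroup.m_inv_closed)
          ultimately show False using x(2)[OF bL(1)] by (auto simp: l_coset_def)
        qed
        then have L: "L \<in> S" using bL by blast
        have "g = a \<otimes> inv x \<otimes> (x \<otimes> h)"
          using h x(1) aG hG by (simp add: m_assoc inv_solve_left)
        then have "g = (a \<otimes> inv x \<otimes> b) \<otimes> l" using l aG x(1) bG lG by (simp add: m_assoc)
        then have "g \<in> l_coset G (a \<otimes> inv x \<otimes> b) L" using l by (auto simp: l_coset_def)
        moreover have "a \<otimes> inv x \<otimes> b \<in> A'" using aK bL by (auto simp: A'_def)
        ultimately show ?thesis using L by blast
      qed
    qed
    then have "\<exists>K\<in>S. \<exists>R. finite R \<and> R \<subseteq> carrier G \<and> carrier G \<subseteq> (\<Union>r\<in>R. l_coset G r K)"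
      using insert.prems(1) by (intro insert.IH[OF _ A']) simp_all
    then show ?thesis by (rule bexE) (rule bexI, assumption, simp)
  qed
qed

definition centralizer :: "'a \<Rightarrow> 'a set" where
  "centralizer x = {s \<in> carrier G. conjugate s x = x}"

lemma subgroup_centralizer:
  assumes "x \<in> carrier G"
  shows "subgroup (centralizer x) G"
proof (rule subgroupI)
  show "centralizer x \<subseteq> carrier G" unfolding centralizer_def by blast
  show "centralizer x \<noteq> {}" using assms by (auto simp: centralizer_def intro!: exI[of _ \<one>])
  show "inv a \<in> centralizer x" if a: "a \<in> centralizer x" for a
  proof -
    have a': "a \<in> carrier G" "conjugate a x = x" using a unfolding centralizer_def by blast+
    then have "conjugate (inv a) x = x"
      using conjugate_eq_iff[OF a'(1) assms assms] by (metis (no_types))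
    then show ?thesis using a'(1) unfolding centralizer_def by blast
  qed
  show "a \<otimes> b \<in> centralizer x" if ab: "a \<in> centralizer x" "b \<in> centralizer x" for a b
  proof -
    have ab': "a \<in> carrier G" "b \<in> carrier G" "conjugate a x = x" "conjugate b x = x"
      using ab unfolding centralizer_def by blast+
    have "conjugate (a \<otimes> b) x = x"
      using conjugate_conjugate[OF ab'(1,2) assms] unfolding ab'(3,4) ..
    then show ?thesis using ab'(1,2) unfolding centralizer_def by blast
  qed
qed

text \<open>The elements \<open>s\<close> that conjugate \<open>x\<close> to a given \<open>e\<close> form a coset of the centralizer of \<open>x\<close>. If every
  \<open>s\<close> took some \<open>x \<in> F\<close> into \<open>E\<close>, finitely many such cosets would cover \<open>G\<close>; by Neumann's lemma some
  centralizer would have finite index, and \<open>x\<close> would have only finitely many conjugates.\<close>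

lemma conjugate_away:
  assumes "finite F" "F \<subseteq> carrier G - FC G" "finite E"
  shows "\<exists>s\<in>carrier G. \<forall>x\<in>F. conjugate s x \<notin> E"
proof (rule ccontr)
  assume neg: "\<not> ?thesis"
  define p where "p = (\<lambda>(x, e). SOME s. s \<in> carrier G \<and> conjugate s x = e)"
  define A where "A = p ` {(x, e). x \<in> F \<and> e \<in> E \<and> (\<exists>s\<in>carrier G. conjugate s x = e)}"
  have p: "p (x, e) \<in> carrier G \<and> conjugate (p (x, e)) x = e"
    if "\<exists>s\<in>carrier G. conjugate s x = e" for x e
    unfolding p_def using someI_ex[of "\<lambda>s. s \<in> carrier G \<and> conjugate s x = e"] that by auto
  have "{(x, e). x \<in> F \<and> e \<in> E \<and> (\<exists>s\<in>carrier G. conjugate s x = e)} \<subseteq> F \<times> E" by blast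
  then have "finite A" unfolding A_def using assms by (meson finite_SigmaI finite_imageI finite_subset)
  moreover have "A \<subseteq> carrier G" unfolding A_def using p by auto
  moreover have "carrier G \<subseteq> (\<Union>a\<in>A. \<Union>H\<in>centralizer ` F. l_coset G a H)"
  proof
    fix s assume s: "s \<in> carrier G"
    then obtain x where x: "x \<in> F" "conjugate s x \<in> E" using neg by blast
    have xG: "x \<in> carrier G" using x assms by blast
    define a where "a = p (x, conjugate s x)"
    have a: "a \<in> carrier G" "conjugate a x = conjugate s x" "a \<in> A"
      using p[of x "conjugate s x"] s x by (auto simp: a_def A_def)
    then have "x = conjugate (inv a) (conjugate s x)"
      using s xG by (intro iffD1[OF conjugate_eq_iff]) simp_all
    then have "conjugate (inv a \<otimes> s) x = x"
      using a(1) s xG by (metis conjugate_conjugate inv_closed)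
    then have "inv a \<otimes> s \<in> centralizer x" using a s by (simp add: centralizer_def)
    moreover have "s = a \<otimes> (inv a \<otimes> s)" using a s by (simp add: m_assoc[symmetric])
    ultimately have "s \<in> l_coset G a (centralizer x)" by (auto simp: l_coset_def)
    then show "s \<in> (\<Union>a\<in>A. \<Union>H\<in>centralizer ` F. l_coset G a H)" using a x by blast
  qed
  ultimately have "\<exists>H\<in>centralizer ` F. \<exists>R. finite R \<and> R \<subseteq> carrier G \<and>
      carrier G \<subseteq> (\<Union>r\<in>R. l_coset G r H)"
    using assms(1,2) by (intro neumann_coset_covering) (auto intro!: subgroup_centralizer)
  then obtain x R where x: "x \<in> F"
    and R: "finite R" "R \<subseteq> carrier G" "carrier G \<subseteq> (\<Union>r\<in>R. l_coset G r (centralizer x))"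
    unfolding bex_simps by blast
  have xG: "x \<in> carrier G" using x assms by blast
  have "x \<in> FC G"
  proof (rule FC_I[OF xG])
    show "finite ((\<lambda>r. conjugate r x) ` R)" using R(1) by simp
    fix s assume s: "s \<in> carrier G"
    then obtain r h where r: "r \<in> R" "h \<in> centralizer x" "s = r \<otimes> h"
      using R(3) x by (auto simp: l_coset_def)
    then have "conjugate s x = conjugate r (conjugate h x)"
      using s xG R(2) by (subst conjugate_conjugate) (auto simp: centralizer_def)
    then have "conjugate s x = conjugate r x" using r by (simp add: centralizer_def)
    then show "conjugate s x \<in> (\<lambda>r. conjugate r x) ` R" using r by blast
  qed
  then show False using x assms by blast
qed

text \<open>Conjugation induces only finitely many permutations of the finite set \<open>FC G\<close>; let \<open>R\<close> represent
  them. An \<open>s\<close> that moves \<open>F\<close> away from all conjugates of \<open>E\<close> by elements of \<open>R\<close> can be corrected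
  by the element of \<open>R\<close> that acts on \<open>FC G\<close> as \<open>s\<close> does.\<close>

lemma conjugate_away_centralizing:
  assumes fin: "finite (FC G)" and F: "finite F" "F \<subseteq> carrier G - FC G" and E: "finite E"
  shows "\<exists>s\<in>carrier G. (\<forall>n\<in>FC G. conjugate s n = n) \<and> (\<forall>x\<in>F. conjugate s x \<notin> E)"
proof -
  define act where "act = (\<lambda>s. \<lambda>n\<in>FC G. conjugate s n)"
  have "act ` carrier G \<subseteq> FC G \<rightarrow>\<^sub>E FC G" using FC_conjugate by (auto simp: act_def)
  then have "finite (act ` carrier G)" using fin by (meson finite_PiE finite_subset)
  then obtain R where R: "finite R" "R \<subseteq> carrier G" "act ` carrier G = act ` R"
    by (metis finite_subset_image subset_refl)
  obtain s where s: "s \<in> carrier G" "\<forall>x\<in>F. conjugate s x \<notin> (\<Union>r\<in>R. conjugate r ` E)"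
    using conjugate_away[OF F, of "\<Union>r\<in>R. conjugate r ` E"] R E by auto
  obtain r where r: "r \<in> R" "act s = act r" using R(3) s(1) by (metis imageE imageI)
  have rG: "r \<in> carrier G" using r R by blast
  have "conjugate (inv r \<otimes> s) n = n" if n: "n \<in> FC G" for n
  proof -
    have nG: "n \<in> carrier G" using n FC_iff by blast
    have "conjugate s n = conjugate r n" using fun_cong[OF r(2), of n] n by (simp add: act_def)
    then have "n = conjugate (inv r) (conjugate s n)"
      using s(1) rG nG by (intro iffD1[OF conjugate_eq_iff]) simp_all
    then show ?thesis
      using rG s(1) nG by (metis conjugate_conjugate inv_closed)
  qed
  moreover have "conjugate (inv r \<otimes> s) x \<notin> E" if x: "x \<in> F" for x
  proof
    assume e: "conjugate (inv r \<otimes> s) x \<in> E"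
    have xG: "x \<in> carrier G" using x F by blast
    have "conjugate r (conjugate (inv r \<otimes> s) x) = conjugate s x"
      using rG s(1) xG conjugate_conjugate[of r "inv r \<otimes> s" x] m_assoc[of r "inv r" s, symmetric]
      by simp
    then have "conjugate s x \<in> conjugate r ` E" using imageI[OF e, of "conjugate r"] by simp
    then show False using s(2) x r(1) by blast
  qed
  ultimately show ?thesis using rG s(1) by blast
qed

end

section \<open>Pairings and weak-star closed sets\<close>

definition pairing :: "('a, 'b) monoid_scheme \<Rightarrow> ('a \<Rightarrow> complex) \<Rightarrow> ('a \<Rightarrow> complex) \<Rightarrow> complex" where
  "pairing G f \<phi> = (\<Sum>\<^sub>\<infinity>x\<in>carrier G. f x * \<phi> x)"

lemma l1_I:
  assumes "\<And>x. x \<notin> carrier G \<Longrightarrow> f x = 0" "(\<lambda>x. norm (f x)) summable_on carrier G"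
  shows "f \<in> l1 G"
  using assms by (simp add: l1_def)

lemma l1_zero_outside: "f \<in> l1 G \<Longrightarrow> x \<notin> carrier G \<Longrightarrow> f x = 0"
  by (simp add: l1_def)

lemma l1_summable: "f \<in> l1 G \<Longrightarrow> (\<lambda>x. norm (f x)) summable_on carrier G"
  by (simp add: l1_def)

lemma l1_dominated:
  assumes "f \<in> l1 G" "\<And>x. norm (g x) \<le> norm (f x)"
  shows "g \<in> l1 G"
proof (rule l1_I)
  show "g x = 0" if "x \<notin> carrier G" for x
    using assms(2)[of x] l1_zero_outside[OF assms(1) that] by simp
  show "(\<lambda>x. norm (g x)) summable_on carrier G"
    using l1_summable[OF assms(1)] by (rule summable_on_comparison_test) (use assms(2) in auto)
qed

lemma subspace_l1: "cfun.subspace (l1 G)"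
  unfolding cfun.subspace_def
proof (intro conjI ballI allI)
  show "0 \<in> l1 G" by (intro l1_I) simp_all
  fix f g assume f: "f \<in> l1 G" and g: "g \<in> l1 G"
  show "f + g \<in> l1 G"
  proof (rule l1_I)
    have "(\<lambda>x. norm (f x) + norm (g x)) summable_on carrier G"
      by (intro summable_on_add l1_summable f g)
    then show "(\<lambda>x. norm ((f + g) x)) summable_on carrier G"
      by (rule summable_on_comparison_test) (simp_all add: norm_triangle_ineq)
  qed (simp add: l1_zero_outside[OF f] l1_zero_outside[OF g])
next
  fix c f assume f: "f \<in> l1 G"
  show "fscale c f \<in> l1 G"
  proof (rule l1_I)
    show "(\<lambda>x. norm (fscale c f x)) summable_on carrier G"
      unfolding fscale_def norm_mult by (intro summable_on_cmult_right l1_summable f)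
  qed (simp add: fscale_def l1_zero_outside[OF f])
qed

lemma l1_sum:
  assumes "\<And>t. t \<in> A \<Longrightarrow> F t \<in> l1 G" shows "(\<Sum>t\<in>A. F t) \<in> l1 G"
  using assms by (rule cfun.subspace_sum[OF subspace_l1])

lemma c0_bounded:
  assumes "\<phi> \<in> c0 G"
  obtains B where "B > 0" "\<And>x. norm (\<phi> x) \<le> B"
proof -
  let ?X = "{x \<in> carrier G. norm (\<phi> x) \<ge> 1}"
  have fin: "finite ?X" using assms by (simp add: c0_def)
  let ?B = "1 + (\<Sum>x\<in>?X. norm (\<phi> x))"
  have nn: "(\<Sum>x\<in>?X. norm (\<phi> x)) \<ge> 0" by (simp add: sum_nonneg)
  have "norm (\<phi> x) \<le> ?B" for x
  proof (cases "x \<in> ?X")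
    case True
    then have "norm (\<phi> x) \<le> (\<Sum>x\<in>?X. norm (\<phi> x))" using fin by (intro member_le_sum) auto
    then show ?thesis by simp
  next
    case False
    then have "norm (\<phi> x) \<le> 1" using assms by (cases "x \<in> carrier G") (auto simp: c0_def)
    then show ?thesis using nn by linarith
  qed
  moreover have "?B > 0" using nn by linarith
  ultimately show thesis using that by blast
qed

lemma c0_uniformly_bounded:
  assumes "finite \<Phi>" "\<Phi> \<subseteq> c0 G"
  obtains M where "M > 0" "\<And>\<phi> x. \<phi> \<in> \<Phi> \<Longrightarrow> norm (\<phi> x) \<le> M"
proof -
  have "\<forall>\<phi>\<in>\<Phi>. \<exists>B>0. \<forall>x. norm (\<phi> x) \<le> B"
    using assms(2) c0_bounded by (metis subsetD)
  then obtain B where B: "\<And>\<phi>. \<phi> \<in> \<Phi> \<Longrightarrow> B \<phi> > 0" "\<And>\<phi> x. \<phi> \<in> \<Phi> \<Longrightarrow> norm (\<phi> x) \<le> B \<phi>"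
    by metis
  define M where "M = 1 + (\<Sum>\<phi>\<in>\<Phi>. B \<phi>)"
  have "M > 0"
    unfolding M_def using B(1) by (intro add_pos_nonneg sum_nonneg) (auto intro: less_imp_le)
  moreover have "norm (\<phi> x) \<le> M" if "\<phi> \<in> \<Phi>" for \<phi> x
  proof -
    have "B \<phi> \<le> (\<Sum>\<phi>\<in>\<Phi>. B \<phi>)"
      using that B(1) assms(1) by (intro member_le_sum) (auto intro: less_imp_le)
    then show ?thesis using B(2)[OF that, of x] by (simp add: M_def)
  qed
  ultimately show thesis using that by blast
qed

lemma c0_finite_support:
  assumes "finite S" "S \<subseteq> carrier G" "\<And>x. x \<notin> S \<Longrightarrow> \<phi> x = 0"
  shows "\<phi> \<in> c0 G"
proof -
  have "finite {x \<in> carrier G. norm (\<phi> x) \<ge> e}" if "e > 0" for e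
    using that assms by (intro finite_subset[OF _ assms(1)]) force
  then show ?thesis using assms by (auto simp: c0_def)
qed

lemma pairing_finite_support:
  assumes "finite S" "S \<subseteq> carrier G" "\<And>x. x \<notin> S \<Longrightarrow> \<phi> x = 0"
  shows "pairing G f \<phi> = (\<Sum>x\<in>S. f x * \<phi> x)"
proof -
  have "pairing G f \<phi> = (\<Sum>\<^sub>\<infinity>x\<in>S. f x * \<phi> x)"
    unfolding pairing_def using assms by (intro infsum_cong_neutral) auto
  then show ?thesis using assms(1) by simp
qed

lemma pairing_summable:
  assumes f: "f \<in> l1 G" and B: "\<And>x. x \<in> carrier G \<Longrightarrow> norm (\<phi> x) \<le> B"
  shows "(\<lambda>x. norm (f x * \<phi> x)) summable_on carrier G"
proof -
  have "(\<lambda>x. norm (f x) * B) summable_on carrier G"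
    by (intro summable_on_cmult_left l1_summable f)
  then show ?thesis
    by (rule summable_on_comparison_test) (simp_all add: norm_mult B mult_left_mono)
qed

lemma pairing_diff:
  assumes "f \<in> l1 G" "g \<in> l1 G" "\<And>x. norm (\<phi> x) \<le> B"
  shows "pairing G (f - g) \<phi> = pairing G f \<phi> - pairing G g \<phi>"
proof -
  have "f - g \<in> l1 G" using assms(1,2) by (rule cfun.subspace_diff[OF subspace_l1])
  then have "pairing G (f - g) \<phi> + pairing G g \<phi> =
      (\<Sum>\<^sub>\<infinity>x\<in>carrier G. (f - g) x * \<phi> x + g x * \<phi> x)"
    unfolding pairing_def using assms
    by (intro infsum_add[symmetric] abs_summable_summable[OF pairing_summable[of _ G \<phi> B]])
  also have "\<dots> = pairing G f \<phi>"
    unfolding pairing_def by (intro infsum_cong) (simp add: algebra_simps)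
  finally show ?thesis by (simp add: algebra_simps)
qed

lemma norm_pairing_le:
  assumes f: "f \<in> l1 G" and B: "\<And>x. norm (\<phi> x) \<le> B"
  shows "norm (pairing G f \<phi>) \<le> B * l1_norm G f"
proof -
  have "norm (pairing G f \<phi>) \<le> (\<Sum>\<^sub>\<infinity>x\<in>carrier G. norm (f x * \<phi> x))"
    unfolding pairing_def by (rule norm_infsum_bound[OF pairing_summable[OF assms]])
  also have "\<dots> \<le> (\<Sum>\<^sub>\<infinity>x\<in>carrier G. norm (f x) * B)"
    by (intro infsum_mono pairing_summable[OF assms] summable_on_cmult_left l1_summable f)
      (simp add: norm_mult B mult_left_mono)
  also have "\<dots> = B * l1_norm G f"
    using infsum_cmult_left[OF l1_summable[OF f], of B] by (simp add: l1_norm_def mult.commute)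
  finally show ?thesis .
qed

lemma topspace_weak_star: "topspace (weak_star G) = l1 G"
proof -
  have "(\<lambda>x. 0) \<in> c0 G" by (rule c0_finite_support[of "{}"]) auto
  then have "l1 G \<in> {{f \<in> l1 G. (\<Sum>\<^sub>\<infinity>x\<in>carrier G. f x * \<phi> x) \<in> U} | \<phi> U. \<phi> \<in> c0 G \<and> open U}"
    by (intro CollectI exI[of _ "\<lambda>x. 0"] exI[of _ UNIV]) auto
  then show ?thesis unfolding weak_star_def topology_generated_by_topspace by blast
qed

text \<open>The neighbourhoods described by finitely many functionals and one tolerance suffice, since such
  descriptions of two sets can be merged.\<close>

lemma weak_star_neighbourhood:
  assumes "openin (weak_star G) W" "h \<in> W"
  shows "\<exists>\<Phi> e. finite \<Phi> \<and> \<Phi> \<subseteq> c0 G \<and> e > 0 \<and>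
    (\<forall>g\<in>l1 G. (\<forall>\<phi>\<in>\<Phi>. norm (pairing G g \<phi> - pairing G h \<phi>) < e) \<longrightarrow> g \<in> W)"
proof -
  have "generate_topology_on
      {{f \<in> l1 G. (\<Sum>\<^sub>\<infinity>x\<in>carrier G. f x * \<phi> x) \<in> U} | \<phi> U. \<phi> \<in> c0 G \<and> open U} W"
    using assms(1) unfolding weak_star_def by (rule openin_topology_generated_by)
  then show ?thesis using assms(2)
  proof (induction rule: generate_topology_on.induct)
    case Empty
    then show ?case by simp
  next
    case (Int V W)
    then obtain \<Phi> e \<Psi> d where
      V: "finite \<Phi>" "\<Phi> \<subseteq> c0 G" "e > 0"
        "\<forall>g\<in>l1 G. (\<forall>\<phi>\<in>\<Phi>. norm (pairing G g \<phi> - pairing G h \<phi>) < e) \<longrightarrow> g \<in> V" and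
      W: "finite \<Psi>" "\<Psi> \<subseteq> c0 G" "d > 0"
        "\<forall>g\<in>l1 G. (\<forall>\<phi>\<in>\<Psi>. norm (pairing G g \<phi> - pairing G h \<phi>) < d) \<longrightarrow> g \<in> W"
      by blast
    then show ?case
      by (intro exI[of _ "\<Phi> \<union> \<Psi>"] exI[of _ "min d e"]) auto
  next
    case (UN K)
    then obtain k where k: "k \<in> K" "h \<in> k" by blast
    obtain \<Phi> e where "finite \<Phi>" "\<Phi> \<subseteq> c0 G" "e > 0"
        "\<forall>g\<in>l1 G. (\<forall>\<phi>\<in>\<Phi>. norm (pairing G g \<phi> - pairing G h \<phi>) < e) \<longrightarrow> g \<in> k"
      using UN.IH[OF k] by blast
    then show ?case using k(1) by blast
  next
    case (Basis s)
    then obtain \<phi> U where s: "s = {f \<in> l1 G. pairing G f \<phi> \<in> U}" "\<phi> \<in> c0 G" "open U"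
      unfolding pairing_def by blast
    then obtain e where "e > 0" "ball (pairing G h \<phi>) e \<subseteq> U"
      using Basis(2) openE by blast
    then show ?case
      using s by (intro exI[of _ "{\<phi>}"] exI[of _ e]) (auto simp: dist_norm norm_minus_commute)
  qed
qed

text \<open>This replaces the convergence of nets: closedness is used by producing one approximating element
  for each finite set of functionals and each tolerance.\<close>

lemma weak_star_closed_limit:
  assumes I: "closedin (weak_star G) I" and h: "h \<in> l1 G"
    and approx: "\<And>\<Phi> e. finite \<Phi> \<Longrightarrow> \<Phi> \<subseteq> c0 G \<Longrightarrow> e > 0 \<Longrightarrow>
      \<exists>g\<in>I. \<forall>\<phi>\<in>\<Phi>. norm (pairing G g \<phi> - pairing G h \<phi>) < e"
  shows "h \<in> I"
proof (rule ccontr)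
  assume "h \<notin> I"
  then have "h \<in> l1 G - I" using h by blast
  moreover have "openin (weak_star G) (l1 G - I)" "I \<subseteq> l1 G"
    using I by (auto simp: closedin_def topspace_weak_star)
  ultimately obtain \<Phi> e where \<Phi>: "finite \<Phi>" "\<Phi> \<subseteq> c0 G" "e > 0"
    "\<And>g. g \<in> l1 G \<Longrightarrow> (\<forall>\<phi>\<in>\<Phi>. norm (pairing G g \<phi> - pairing G h \<phi>) < e) \<Longrightarrow> g \<in> l1 G - I"
    using weak_star_neighbourhood[of G "l1 G - I" h] by blast
  obtain g where "g \<in> I" "\<forall>\<phi>\<in>\<Phi>. norm (pairing G g \<phi> - pairing G h \<phi>) < e"
    using approx[OF \<Phi>(1-3)] by blast
  then show False using \<Phi>(4)[of g] \<open>I \<subseteq> l1 G\<close> by blast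
qed

text \<open>Functionals given by bounded functions are norm continuous, so weak-star closed sets are norm
  closed.\<close>

lemma weak_star_closed_norm_limit:
  assumes I: "closedin (weak_star G) I" and h: "h \<in> l1 G"
    and approx: "\<And>e. e > 0 \<Longrightarrow> \<exists>g\<in>I. l1_norm G (h - g) < e"
  shows "h \<in> I"
proof (rule weak_star_closed_limit[OF I h])
  fix \<Phi> and e :: real assume \<Phi>: "finite \<Phi>" "\<Phi> \<subseteq> c0 G" and e: "e > 0"
  obtain M where M0: "M > 0" and M: "\<And>\<phi> x. \<phi> \<in> \<Phi> \<Longrightarrow> norm (\<phi> x) \<le> M"
    by (rule c0_uniformly_bounded[OF \<Phi>]) blast
  obtain g where g: "g \<in> I" "l1_norm G (h - g) < e / M"
    using approx[of "e / M"] e M0 by auto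
  have gl: "g \<in> l1 G" using g I by (auto simp: closedin_def topspace_weak_star)
  have hg: "h - g \<in> l1 G" using h gl by (rule cfun.subspace_diff[OF subspace_l1])
  have "norm (pairing G g \<phi> - pairing G h \<phi>) < e" if \<phi>: "\<phi> \<in> \<Phi>" for \<phi>
  proof -
    have "norm (pairing G g \<phi> - pairing G h \<phi>) = norm (pairing G (h - g) \<phi>)"
      using pairing_diff[OF h gl M[OF \<phi>]] by (simp add: norm_minus_commute)
    also have "\<dots> \<le> M * l1_norm G (h - g)"
      by (rule norm_pairing_le[OF hg M[OF \<phi>]])
    also have "\<dots> < e" using g(2) M0 by (simp add: field_simps)
    finally show ?thesis .
  qed
  then show "\<exists>g\<in>I. \<forall>\<phi>\<in>\<Phi>. norm (pairing G g \<phi> - pairing G h \<phi>) < e" using g(1) by blast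
qed

text \<open>Its complement is a union of subbasic open sets.\<close>

lemma weak_star_closed_annihilator:
  assumes "\<Phi> \<subseteq> c0 G"
  shows "closedin (weak_star G) {f \<in> l1 G. \<forall>\<phi>\<in>\<Phi>. pairing G f \<phi> = 0}"
proof -
  have "openin (weak_star G) {f \<in> l1 G. pairing G f \<phi> \<in> - {0}}" if "\<phi> \<in> \<Phi>" for \<phi>
    unfolding weak_star_def pairing_def using that assms
    by (intro topology_generated_by_Basis CollectI exI[of _ \<phi>] exI[of _ "- {0}"]) auto
  then have "openin (weak_star G) (\<Union>\<phi>\<in>\<Phi>. {f \<in> l1 G. pairing G f \<phi> \<in> - {0}})"
    by (intro openin_Union) (erule imageE, simp)
  moreover have "l1 G - {f \<in> l1 G. \<forall>\<phi>\<in>\<Phi>. pairing G f \<phi> = 0} =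
      (\<Union>\<phi>\<in>\<Phi>. {f \<in> l1 G. pairing G f \<phi> \<in> - {0}})" by auto
  ultimately show ?thesis by (simp add: closedin_def topspace_weak_star)
qed

section \<open>Convolution\<close>

lemma l1_norm_tail:
  assumes f: "f \<in> l1 G" and e: "e > 0"
  obtains F where "finite F" "F \<subseteq> carrier G"
    "\<And>F'. F \<subseteq> F' \<Longrightarrow> l1_norm G (\<lambda>x. if x \<in> F' then 0 else f x) < e"
proof -
  let ?n = "\<lambda>x. norm (f x)"
  have "((\<lambda>F. sum ?n F) \<longlongrightarrow> infsum ?n (carrier G)) (finite_subsets_at_top (carrier G))"
    using has_sum_infsum[OF l1_summable[OF f]] by (simp add: has_sum_def)
  then have "\<forall>\<^sub>F F in finite_subsets_at_top (carrier G). dist (sum ?n F) (infsum ?n (carrier G)) < e"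
    using e by (rule tendstoD)
  then obtain F where F: "finite F" "F \<subseteq> carrier G" "dist (sum ?n F) (infsum ?n (carrier G)) < e"
    unfolding eventually_finite_subsets_at_top by blast
  have "l1_norm G (\<lambda>x. if x \<in> F' then 0 else f x) < e" if F': "F \<subseteq> F'" for F'
  proof -
    have tail: "?n summable_on (carrier G - F)"
      by (rule summable_on_subset_banach[OF l1_summable[OF f]]) blast
    have "l1_norm G (\<lambda>x. if x \<in> F' then 0 else f x) = infsum ?n (carrier G - F')"
      unfolding l1_norm_def by (intro infsum_cong_neutral) auto
    also have "\<dots> \<le> infsum ?n (carrier G - F)"
      using F' by (intro infsum_mono_neutral tail summable_on_subset_banach[OF l1_summable[OF f]]) auto
    also have "\<dots> = infsum ?n (carrier G) - sum ?n F"
      using infsum_Diff[OF l1_summable[OF f], of F] F by simp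
    also have "\<dots> < e" using F(3) by (simp add: dist_norm)
    finally show ?thesis .
  qed
  then show thesis using that F by blast
qed

lemma infsum_sum_swap:
  fixes f :: "'i \<Rightarrow> 'a \<Rightarrow> complex"
  assumes "finite S" "\<And>i. i \<in> S \<Longrightarrow> f i summable_on A"
  shows "(\<Sum>\<^sub>\<infinity>y\<in>A. \<Sum>i\<in>S. f i y) = (\<Sum>i\<in>S. \<Sum>\<^sub>\<infinity>y\<in>A. f i y)"
proof -
  have "((\<lambda>y. \<Sum>i\<in>S. f i y) has_sum (\<Sum>i\<in>S. infsum (f i) A)) A"
    using assms by (induction S rule: finite_induct) (auto intro!: has_sum_add)
  then show ?thesis by (rule infsumI)
qed

context group
begin

lemma delta_l1: "t \<in> carrier G \<Longrightarrow> delta t \<in> l1 G"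
proof (rule l1_I)
  assume t: "t \<in> carrier G"
  have "(\<lambda>x. norm (delta t x)) summable_on {t}" by simp
  then show "(\<lambda>x. norm (delta t x)) summable_on carrier G"
    using t by (subst summable_on_cong_neutral[where T = "{t}"]) (auto simp: delta_def)
qed (auto simp: delta_def)

lemma conv_delta_left:
  assumes t: "t \<in> carrier G"
  shows "conv G (delta t) g x = (if x \<in> carrier G then g (inv t \<otimes> x) else 0)"
proof -
  have "(\<Sum>\<^sub>\<infinity>y\<in>carrier G. delta t y * g (inv y \<otimes> x)) = (\<Sum>\<^sub>\<infinity>y\<in>{t}. g (inv y \<otimes> x))"
    using t by (intro infsum_cong_neutral) (auto simp: delta_def)
  then show ?thesis by (simp add: conv_def)
qed

lemma conv_delta_right:
  assumes t: "t \<in> carrier G"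
  shows "conv G g (delta t) x = (if x \<in> carrier G then g (x \<otimes> inv t) else 0)"
proof (cases "x \<in> carrier G")
  case x: True
  have "(\<Sum>\<^sub>\<infinity>y\<in>carrier G. g y * delta t (inv y \<otimes> x)) = (\<Sum>\<^sub>\<infinity>y\<in>{x \<otimes> inv t}. g y)"
  proof (rule infsum_cong_neutral)
    show "g y * delta t (inv y \<otimes> x) = 0" if "y \<in> carrier G - {x \<otimes> inv t}" for y
    proof -
      have "inv y \<otimes> x \<noteq> t"
      proof
        assume "inv y \<otimes> x = t"
        then have "x = y \<otimes> t" using that x t by (simp add: inv_solve_left')
        then have "x \<otimes> inv t = y" using that t by (simp add: m_assoc)
        then show False using that by simp
      qed
      then show ?thesis by (simp add: delta_def)
    qed
    show "g y * delta t (inv y \<otimes> x) = g y" if "y \<in> carrier G \<inter> {x \<otimes> inv t}" for y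
      using that x t by (simp add: delta_def inv_mult_group m_assoc)
  qed (use x t in auto)
  then show ?thesis using x by (simp add: conv_def)
qed (simp add: conv_def)

text \<open>In this form \<open>f * g\<close> is a superposition of right translates of \<open>f\<close> with weights from \<open>g\<close>.\<close>

lemma conv_reindex:
  assumes x: "x \<in> carrier G"
  shows "conv G f g x = (\<Sum>\<^sub>\<infinity>z\<in>carrier G. g z * f (x \<otimes> inv z))"
proof -
  have "bij_betw (\<lambda>z. x \<otimes> inv z) (carrier G) (carrier G)"
  proof (rule bij_betw_byWitness[where f' = "\<lambda>y. inv y \<otimes> x"])
    show "\<forall>z\<in>carrier G. inv (x \<otimes> inv z) \<otimes> x = z"
      using x by (simp add: inv_mult_group m_assoc)
    show "\<forall>y\<in>carrier G. x \<otimes> inv (inv y \<otimes> x) = y"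
      using x by (simp add: inv_mult_group m_assoc[symmetric])
  qed (use x in auto)
  then have "conv G f g x = (\<Sum>\<^sub>\<infinity>z\<in>carrier G. f (x \<otimes> inv z) * g (inv (x \<otimes> inv z) \<otimes> x))"
    using x infsum_reindex_bij_betw[of "\<lambda>z. x \<otimes> inv z" "carrier G" "carrier G"
        "\<lambda>y. f y * g (inv y \<otimes> x)"] by (simp add: conv_def)
  also have "\<dots> = (\<Sum>\<^sub>\<infinity>z\<in>carrier G. g z * f (x \<otimes> inv z))"
    using x by (intro infsum_cong) (simp add: inv_mult_group m_assoc mult.commute)
  finally show ?thesis .
qed

text \<open>Up to the bijection \<open>(x, y) \<mapsto> (y, inv y \<otimes> x)\<close> this family is the product of two summable
  families.\<close>

lemma conv_product_summable:
  assumes f: "f \<in> l1 G" and g: "g \<in> l1 G"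
  shows "(\<lambda>(x, y). norm (f y * g (inv y \<otimes> x))) summable_on (carrier G \<times> carrier G)"
proof -
  have "(\<lambda>p. norm ((\<lambda>(y, z). f y * g z) p)) summable_on (carrier G \<times> carrier G)"
    unfolding Infinite_Sum.abs_summable_on_Sigma_iff
    using f g by (auto simp: norm_mult infsum_cmult_right' abs_mult
        intro!: summable_on_cmult_right summable_on_cmult_left l1_summable)
  then have "(\<lambda>(y, z). norm (f y * g z)) summable_on (carrier G \<times> carrier G)"
    by (simp add: case_prod_unfold)
  moreover have "bij_betw (\<lambda>(x, y). (y, inv y \<otimes> x)) (carrier G \<times> carrier G) (carrier G \<times> carrier G)"
    by (rule bij_betw_byWitness[where f' = "\<lambda>(y, z). (y \<otimes> z, y)"])
      (auto simp: m_assoc[symmetric])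
  ultimately show ?thesis
    using summable_on_reindex_bij_betw[of "\<lambda>(x, y). (y, inv y \<otimes> x)" "carrier G \<times> carrier G"
        "carrier G \<times> carrier G" "\<lambda>(y, z). norm (f y * g z)"]
    by (simp add: case_prod_unfold)
qed

lemma conv_l1:
  assumes f: "f \<in> l1 G" and g: "g \<in> l1 G"
  shows "conv G f g \<in> l1 G"
proof (rule l1_I)
  have *: "(\<lambda>p. norm ((\<lambda>(x, y). f y * g (inv y \<otimes> x)) p)) summable_on (carrier G \<times> carrier G)"
    using conv_product_summable[OF assms] by (simp add: case_prod_unfold)
  note ** = iffD1[OF Infinite_Sum.abs_summable_on_Sigma_iff *]
  have row: "(\<lambda>y. norm (f y * g (inv y \<otimes> x))) summable_on carrier G" if "x \<in> carrier G" for x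
    using conjunct1[OF **] that by simp
  have "(\<lambda>x. norm (\<Sum>\<^sub>\<infinity>y\<in>carrier G. norm (f y * g (inv y \<otimes> x)))) summable_on carrier G"
    using conjunct2[OF **] by simp
  then show "(\<lambda>x. norm (conv G f g x)) summable_on carrier G"
  proof (rule summable_on_comparison_test)
    fix x assume x: "x \<in> carrier G"
    have "norm (conv G f g x) \<le> (\<Sum>\<^sub>\<infinity>y\<in>carrier G. norm (f y * g (inv y \<otimes> x)))"
      using x norm_infsum_bound[OF row[OF x]] by (simp add: conv_def)
    then show "norm (conv G f g x) \<le> norm (\<Sum>\<^sub>\<infinity>y\<in>carrier G. norm (f y * g (inv y \<otimes> x)))" by simp
  qed simp
qed (simp add: conv_def)

lemma norm_le_l1_norm:
  assumes "f \<in> l1 G" shows "norm (f x) \<le> l1_norm G f"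
proof (cases "x \<in> carrier G")
  case True
  have "(\<Sum>\<^sub>\<infinity>y\<in>{x}. norm (f y)) \<le> l1_norm G f"
    unfolding l1_norm_def using True l1_summable[OF assms]
    by (intro infsum_mono_neutral) auto
  then show ?thesis by simp
qed (use assms in \<open>simp add: l1_zero_outside l1_norm_def infsum_nonneg\<close>)

text \<open>Both \<open>g * f\<close> and \<open>f * g\<close> are absolutely convergent combinations of translates of \<open>f\<close>, with the
  values of \<open>g\<close> as weights. A functional with finite support may be applied term by term, so for the
  annihilator of such functionals invariance under translations already gives an ideal.\<close>

lemma annihilator_ideal:
  fixes \<Phi> :: "('a \<Rightarrow> complex) set"
  defines "D \<equiv> {f \<in> l1 G. \<forall>\<phi>\<in>\<Phi>. pairing G f \<phi> = 0}"
  assumes \<Phi>: "\<And>\<phi>. \<phi> \<in> \<Phi> \<Longrightarrow> \<exists>S. finite S \<and> S \<subseteq> carrier G \<and> (\<forall>x. x \<notin> S \<longrightarrow> \<phi> x = 0)"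
    and left: "\<And>s f. s \<in> carrier G \<Longrightarrow> f \<in> D \<Longrightarrow> conv G (delta s) f \<in> D"
    and right: "\<And>s f. s \<in> carrier G \<Longrightarrow> f \<in> D \<Longrightarrow> conv G f (delta s) \<in> D"
  shows "l1_ideal G D"
proof -
  have "pairing G (conv G g f) \<phi> = 0 \<and> pairing G (conv G f g) \<phi> = 0"
    if g: "g \<in> l1 G" and f: "f \<in> D" and \<phi>: "\<phi> \<in> \<Phi>" for f g \<phi>
  proof -
    obtain S where S: "finite S" "S \<subseteq> carrier G" "\<And>x. x \<notin> S \<Longrightarrow> \<phi> x = 0" using \<Phi>[OF \<phi>] by blast
    have pair: "pairing G k \<phi> = (\<Sum>x\<in>S. k x * \<phi> x)" for k
      by (rule pairing_finite_support[OF S(1,2)]) (rule S(3))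
    have fl: "f \<in> l1 G" using f D_def by blast
    have *: "(\<Sum>x\<in>S. (\<Sum>\<^sub>\<infinity>y\<in>carrier G. g y * h x y) * \<phi> x) = 0"
      if h: "\<And>x y. x \<in> S \<Longrightarrow> y \<in> carrier G \<Longrightarrow> norm (h x y) \<le> l1_norm G f"
        and 0: "\<And>y. y \<in> carrier G \<Longrightarrow> (\<Sum>x\<in>S. h x y * \<phi> x) = 0" for h
    proof -
      have "(\<Sum>x\<in>S. (\<Sum>\<^sub>\<infinity>y\<in>carrier G. g y * h x y) * \<phi> x)
          = (\<Sum>x\<in>S. \<Sum>\<^sub>\<infinity>y\<in>carrier G. g y * h x y * \<phi> x)"
        by (intro sum.cong refl infsum_cmult_left[symmetric] abs_summable_summable[OF pairing_summable[OF g h]])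
      also have "\<dots> = (\<Sum>\<^sub>\<infinity>y\<in>carrier G. \<Sum>x\<in>S. g y * h x y * \<phi> x)"
        by (intro infsum_sum_swap[symmetric] S(1) summable_on_cmult_left abs_summable_summable[OF pairing_summable[OF g h]])
      also have "\<dots> = (\<Sum>\<^sub>\<infinity>y\<in>carrier G. g y * (\<Sum>x\<in>S. h x y * \<phi> x))"
        by (simp add: sum_distrib_left mult.assoc)
      also have "\<dots> = 0" using 0 by (simp cong: infsum_cong)
      finally show ?thesis .
    qed
    have "pairing G (conv G g f) \<phi> = (\<Sum>x\<in>S. (\<Sum>\<^sub>\<infinity>y\<in>carrier G. g y * f (inv y \<otimes> x)) * \<phi> x)"
      unfolding pair using S(2) by (intro sum.cong) (auto simp: conv_def)
    also have "\<dots> = 0"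
    proof (rule *)
      fix y assume y: "y \<in> carrier G"
      have "pairing G (conv G (delta y) f) \<phi> = 0" using left[OF y f] \<phi> by (simp add: D_def)
      then show "(\<Sum>x\<in>S. f (inv y \<otimes> x) * \<phi> x) = 0"
        unfolding pair using S(2) y by (simp add: conv_delta_left subset_iff cong: sum.cong)
    qed (rule norm_le_l1_norm[OF fl])
    finally have "pairing G (conv G g f) \<phi> = 0" .
    moreover have "pairing G (conv G f g) \<phi> = (\<Sum>x\<in>S. (\<Sum>\<^sub>\<infinity>y\<in>carrier G. g y * f (x \<otimes> inv y)) * \<phi> x)"
      unfolding pair using S(2) by (intro sum.cong) (auto simp: conv_reindex)
    moreover have "\<dots> = 0"
    proof (rule *)
      fix y assume y: "y \<in> carrier G"
      have "pairing G (conv G f (delta y)) \<phi> = 0" using right[OF y f] \<phi> by (simp add: D_def)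
      then show "(\<Sum>x\<in>S. f (x \<otimes> inv y) * \<phi> x) = 0"
        unfolding pair using S(2) y by (simp add: conv_delta_right subset_iff cong: sum.cong)
    qed (rule norm_le_l1_norm[OF fl])
    ultimately show ?thesis by simp
  qed
  moreover have "cfun.subspace D"
    unfolding cfun.subspace_def
  proof (intro conjI ballI allI)
    have pair: "\<exists>S. \<forall>f. pairing G f \<phi> = (\<Sum>x\<in>S. f x * \<phi> x)" if "\<phi> \<in> \<Phi>" for \<phi>
      using \<Phi>[OF that] pairing_finite_support by metis
    show "0 \<in> D" using cfun.subspace_0[OF subspace_l1] by (simp add: D_def pairing_def)
    show "f + g \<in> D" if "f \<in> D" "g \<in> D" for f g
    proof -
      have "pairing G (f + g) \<phi> = pairing G f \<phi> + pairing G g \<phi>" if "\<phi> \<in> \<Phi>" for \<phi>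
        using pair[OF that] by (auto simp: distrib_right sum.distrib)
      then show ?thesis using that cfun.subspace_add[OF subspace_l1, of f G g] by (simp add: D_def)
    qed
    show "fscale c f \<in> D" if "f \<in> D" for c f
    proof -
      have "pairing G (fscale c f) \<phi> = c * pairing G f \<phi>" if "\<phi> \<in> \<Phi>" for \<phi>
        using pair[OF that] by (auto simp: fscale_def sum_distrib_left mult.assoc)
      then show ?thesis using that cfun.subspace_scale[OF subspace_l1, of f G c] by (simp add: D_def)
    qed
  qed
  ultimately show ?thesis unfolding l1_ideal_def using conv_l1 by (auto simp: D_def)
qed

text \<open>The difference between a conjugate of \<open>f\<close> by an \<open>s\<close> centralizing \<open>FC G\<close> and the restriction of
  \<open>f\<close> lives outside \<open>FC G\<close>. Up to a small tail it is carried by a finite set, which a suitable \<open>s\<close> moves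
  to where the given functions in \<open>c0 G\<close> are small.\<close>

lemma weak_star_closed_restrict_FC:
  assumes fin: "finite (FC G)" and I: "closedin (weak_star G) I" and f: "f \<in> I"
    and conj: "\<And>s. s \<in> carrier G \<Longrightarrow> conv G (conv G (delta s) f) (delta (inv s)) \<in> I"
  shows "(\<lambda>x. if x \<in> FC G then f x else 0) \<in> I"
proof (rule weak_star_closed_limit[OF I])
  let ?h = "\<lambda>x. if x \<in> FC G then f x else 0"
  let ?k = "\<lambda>x. if x \<in> FC G then 0 else f x"
  have fl: "f \<in> l1 G" using f I by (auto simp: closedin_def topspace_weak_star)
  show hl: "?h \<in> l1 G" by (rule l1_dominated[OF fl]) simp
  have FCG: "FC G \<subseteq> carrier G" by (auto simp: FC_def)
  fix \<Phi> and e :: real assume \<Phi>: "finite \<Phi>" "\<Phi> \<subseteq> c0 G" and e: "e > 0"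
  obtain M where M0: "M > 0" and M: "\<And>\<phi> x. \<phi> \<in> \<Phi> \<Longrightarrow> norm (\<phi> x) \<le> M"
    by (rule c0_uniformly_bounded[OF \<Phi>]) blast
  have n0: "l1_norm G f \<ge> 0" by (simp add: l1_norm_def infsum_nonneg)
  \<comment> \<open>The tolerances \<open>d\<close> for the functions in \<open>\<Phi>\<close> off \<open>E\<close> and \<open>e / (2 * M)\<close> for the tail of \<open>f\<close> each
    contribute at most \<open>e / 2\<close>.\<close>
  define d where "d = e / (2 * (l1_norm G f + 1))"
  have d: "d > 0" "d * l1_norm G f < e / 2" using e n0 by (simp_all add: d_def field_simps)
  obtain F where F: "finite F" "F \<subseteq> carrier G"
    "\<And>F'. F \<subseteq> F' \<Longrightarrow> l1_norm G (\<lambda>x. if x \<in> F' then 0 else f x) < e / (2 * M)"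
    using l1_norm_tail[OF fl, of "e / (2 * M)"] e M0 by auto
  let ?r = "\<lambda>x. if x \<in> F then 0 else f x"
  have rl: "?r \<in> l1 G" by (rule l1_dominated[OF fl]) simp
  define E where "E = (\<Union>\<phi>\<in>\<Phi>. {x \<in> carrier G. norm (\<phi> x) \<ge> d})"
  have "finite E" unfolding E_def using \<Phi> d(1) by (auto simp: c0_def)
  then obtain s where s: "s \<in> carrier G" "\<And>n. n \<in> FC G \<Longrightarrow> conjugate s n = n"
    "\<And>x. x \<in> F - FC G \<Longrightarrow> conjugate s x \<notin> E"
    using conjugate_away_centralizing[OF fin, of "F - FC G" E] F(1,2) by blast
  define g where "g = conv G (conv G (delta s) f) (delta (inv s))"
  have g: "g x = f (inv s \<otimes> x \<otimes> s)" if "x \<in> carrier G" for x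
    unfolding g_def using that s(1) by (simp add: conv_delta_left conv_delta_right m_assoc)
  have "norm (pairing G g \<phi> - pairing G ?h \<phi>) < e" if \<phi>: "\<phi> \<in> \<Phi>" for \<phi>
  proof -
    let ?\<psi> = "\<lambda>x. \<phi> (conjugate s x)"
    note cancel = conjugate_cancel[OF s(1)]
    have bij: "bij_betw (conjugate s) (carrier G) (carrier G)"
      by (rule bij_betw_byWitness[where f' = "conjugate (inv s)"])
        (use s(1) cancel in auto)
    have "pairing G g \<phi> = (\<Sum>\<^sub>\<infinity>x\<in>carrier G. g (conjugate s x) * ?\<psi> x)"
      unfolding pairing_def using infsum_reindex_bij_betw[OF bij, of "\<lambda>x. g x * \<phi> x"] by simp
    also have "\<dots> = pairing G f ?\<psi>"
      unfolding pairing_def using s(1) by (intro infsum_cong) (simp add: g cancel(1))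
    finally have 1: "pairing G g \<phi> = pairing G f ?\<psi>" .
    have 2: "pairing G ?h \<phi> = pairing G ?h ?\<psi>"
      unfolding pairing_def by (intro infsum_cong) (simp add: s(2))
    have k: "f - ?h = ?k" by (simp add: fun_eq_iff)
    have kl: "?k \<in> l1 G" by (rule l1_dominated[OF fl]) simp
    have "pairing G g \<phi> - pairing G ?h \<phi> = pairing G ?k ?\<psi>"
      unfolding 1 2 k[symmetric] by (rule pairing_diff[symmetric, OF fl hl M[OF \<phi>]])
    then have "norm (pairing G g \<phi> - pairing G ?h \<phi>) \<le> (\<Sum>\<^sub>\<infinity>x\<in>carrier G. norm (?k x * ?\<psi> x))"
      unfolding pairing_def[of G ?k] by (simp add: norm_infsum_bound[OF pairing_summable[OF kl M[OF \<phi>]]])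
    also have "\<dots> \<le> (\<Sum>\<^sub>\<infinity>x\<in>carrier G. d * norm (f x) + M * norm (?r x))"
    proof (intro infsum_mono pairing_summable[OF kl M[OF \<phi>]] summable_on_add
        summable_on_cmult_right l1_summable[OF fl] l1_summable[OF rl])
      fix x assume x: "x \<in> carrier G"
      show "norm (?k x * ?\<psi> x) \<le> d * norm (f x) + M * norm (?r x)"
      proof (cases "x \<in> F - FC G")
        case True
        then have "conjugate s x \<notin> E" by (rule s(3))
        then have "norm (?\<psi> x) \<le> d" using \<phi> x s(1) by (force simp: E_def)
        then show ?thesis using True by (simp add: norm_mult mult.commute[of d] mult_left_mono)
      next
        case False
        have "0 \<le> d * norm (f x)" "0 \<le> M * norm (?r x)"
          using d(1) M0 by (simp_all only: zero_le_mult_iff norm_ge_zero less_imp_le simp_thms)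
        moreover have "norm (?k x * ?\<psi> x) \<le> M * norm (?r x)"
          using False M0 M[OF \<phi>, of "conjugate s x"]
          by (auto simp: norm_mult mult.commute[of M] intro: mult_left_mono)
        ultimately show ?thesis by linarith
      qed
    qed
    also have "\<dots> = d * l1_norm G f + M * l1_norm G ?r"
      unfolding l1_norm_def
      by (subst infsum_add) (simp_all only: summable_on_cmult_right l1_summable[OF fl]
          l1_summable[OF rl] infsum_cmult_right)
    also have "\<dots> < e / 2 + e / 2"
      using d(2) F(3)[OF subset_refl] M0 by (intro add_strict_mono) (simp_all add: field_simps)
    finally show ?thesis by simp
  qed
  moreover have "g \<in> I" unfolding g_def by (rule conj[OF s(1)])
  ultimately show "\<exists>g\<in>I. \<forall>\<phi>\<in>\<Phi>. norm (pairing G g \<phi> - pairing G ?h \<phi>) < e" by blast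
qed

end

section \<open>Functions supported on a finite set\<close>

lemma sum_apply: "(\<Sum>i\<in>A. F i) x = (\<Sum>i\<in>A. (F i x :: complex))"
  by (induction A rule: infinite_finite_induct) simp_all

definition supported :: "'a set \<Rightarrow> ('a \<Rightarrow> complex) set" where
  "supported N = {f. \<forall>x. x \<notin> N \<longrightarrow> f x = 0}"

definition l2_inner :: "'a set \<Rightarrow> ('a \<Rightarrow> complex) \<Rightarrow> ('a \<Rightarrow> complex) \<Rightarrow> complex" where
  "l2_inner N u v = (\<Sum>n\<in>N. u n * cnj (v n))"

lemma l2_inner_add_left: "l2_inner N (u + v) w = l2_inner N u w + l2_inner N v w"
  by (simp add: l2_inner_def distrib_right sum.distrib)

lemma l2_inner_scale_left: "l2_inner N (fscale c u) w = c * l2_inner N u w"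
  by (simp add: l2_inner_def fscale_def sum_distrib_left mult.assoc)

lemma l2_inner_diff_left: "l2_inner N (u - v) w = l2_inner N u w - l2_inner N v w"
  by (simp add: l2_inner_def left_diff_distrib sum_subtractf)

lemma l2_inner_commute: "l2_inner N v u = cnj (l2_inner N u v)"
  by (simp add: l2_inner_def mult.commute)

lemma l2_inner_add_right: "l2_inner N w (u + v) = l2_inner N w u + l2_inner N w v"
  by (simp add: l2_inner_def distrib_left sum.distrib)

lemma l2_inner_scale_right: "l2_inner N w (fscale c u) = cnj c * l2_inner N w u"
  by (simp add: l2_inner_def fscale_def sum_distrib_left mult.left_commute)

lemma l2_inner_zero_left: "l2_inner N 0 w = 0" by (simp add: l2_inner_def)

lemma l2_inner_self: "l2_inner N u u = of_real (\<Sum>n\<in>N. (norm (u n))\<^sup>2)"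
  unfolding l2_inner_def of_real_sum complex_norm_square ..

lemma l2_inner_self_eq_0:
  assumes "finite N" "u \<in> supported N" "l2_inner N u u = 0"
  shows "u = 0"
proof -
  have "(\<Sum>n\<in>N. (norm (u n))\<^sup>2) = 0" using assms(3) unfolding l2_inner_self of_real_eq_0_iff .
  then have "u n = 0" if "n \<in> N" for n
    using assms(1) that by (simp add: sum_nonneg_eq_0_iff)
  then show ?thesis using assms(2) by (auto simp: supported_def fun_eq_iff)
qed

lemma supportedD: "f \<in> supported N \<Longrightarrow> x \<notin> N \<Longrightarrow> f x = 0"
  by (simp add: supported_def)

lemma subspace_supported: "cfun.subspace (supported N)"
  by (auto simp: cfun.subspace_def supported_def fscale_def)

lemma supported_subset_span:
  assumes "finite N" shows "supported N \<subseteq> cfun.span (delta ` N)"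
proof
  fix f assume f: "f \<in> supported N"
  have "f = (\<Sum>n\<in>N. fscale (f n) (delta n))"
  proof
    fix x
    have "(\<Sum>n\<in>N. fscale (f n) (delta n)) x = (\<Sum>n\<in>N. if n = x then f n else 0)"
      unfolding sum_apply by (intro sum.cong) (auto simp: fscale_def delta_def)
    then show "f x = (\<Sum>n\<in>N. fscale (f n) (delta n)) x"
      using f assms by (simp add: supported_def)
  qed
  then show "f \<in> cfun.span (delta ` N)"
    by (metis (no_types, lifting) cfun.span_base cfun.span_scale cfun.span_sum imageI)
qed

lemma finite_basis:
  assumes "finite N" "V \<subseteq> supported N" "cfun.subspace V" "cfun.independent C" "C \<subseteq> V"
  obtains B where "C \<subseteq> B" "B \<subseteq> V" "cfun.independent B" "finite B" "cfun.span B = V"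
proof -
  obtain B where B: "C \<subseteq> B" "B \<subseteq> V" "cfun.independent B" "V \<subseteq> cfun.span B"
    using cfun.maximal_independent_subset_extend[OF assms(5,4)] by blast
  have "finite B"
    using cfun.independent_span_bound[OF _ B(3), of "delta ` N"] B(2) assms(1,2)
      supported_subset_span by blast
  moreover have "cfun.span B = V"
    using B(2,4) assms(3) by (simp add: cfun.span_minimal subset_antisym)
  ultimately show thesis using that B by blast
qed

text \<open>The dimension serves as the measure for choosing a smallest invariant subspace.\<close>

lemma dim_psubset:
  assumes N: "finite N" and V: "V \<subseteq> supported N" "cfun.subspace V"
    and U: "cfun.subspace U" "U \<subset> V"
  shows "cfun.dim U < cfun.dim V"
proof -
  have U': "U \<subseteq> supported N" using U(2) V(1) by blast
  obtain C where C: "C \<subseteq> U" "cfun.independent C" "finite C" "cfun.span C = U"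
    by (rule finite_basis[OF N U' U(1) cfun.independent_empty empty_subsetI])
  have "C \<subseteq> V" using C(1) U(2) by blast
  then obtain B where B: "C \<subseteq> B" "B \<subseteq> V" "cfun.independent B" "finite B" "cfun.span B = V"
    by (rule finite_basis[OF N V C(2)])
  have "C \<noteq> B" using C(4) B(5) U(2) by blast
  then have "card C < card B" using B(1,4) by (intro psubset_card_mono) auto
  moreover have "cfun.dim U = card C" "cfun.dim V = card B"
    using cfun.dim_eq_card_independent C B by (metis cfun.dim_span)+
  ultimately show ?thesis by simp
qed

text \<open>Gram-Schmidt: the new vector \<open>b\<close> is replaced by its component \<open>c\<close> orthogonal to the span of \<open>B\<close>, and
  the projection onto \<open>c\<close> is added to the projection onto the span of \<open>B\<close>.\<close>

lemma orthogonal_projection_span: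
  assumes N: "finite N" and "finite B" "B \<subseteq> supported N"
  shows "\<exists>p\<in>cfun.span B. \<forall>v\<in>cfun.span B. l2_inner N (x - p) v = 0"
  using assms(2,3)
proof (induction B arbitrary: x rule: finite_induct)
  case empty
  then show ?case by (simp add: l2_inner_def)
next
  case (insert b B)
  obtain p where p: "p \<in> cfun.span B" "\<And>v. v \<in> cfun.span B \<Longrightarrow> l2_inner N (x - p) v = 0"
    using insert by blast
  obtain q where q: "q \<in> cfun.span B" "\<And>v. v \<in> cfun.span B \<Longrightarrow> l2_inner N (b - q) v = 0"
    using insert by blast
  define c where "c = b - q"
  have bB: "b \<in> cfun.span (insert b B)" "cfun.span B \<subseteq> cfun.span (insert b B)"
    by (simp_all add: cfun.span_base cfun.span_mono subset_insertI)
  have c: "c \<in> cfun.span (insert b B)" unfolding c_def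
    using q(1) bB by (intro cfun.span_diff) auto
  have "cfun.span (insert b B) \<subseteq> supported N"
    using insert.prems by (intro cfun.span_minimal subspace_supported)
  then have cs: "c \<in> supported N" using c by blast
  \<comment> \<open>If \<open>c = 0\<close>, then \<open>z = 0\<close> because division by zero gives zero.\<close>
  define z where "z = l2_inner N (x - p) c / l2_inner N c c"
  have z: "l2_inner N (x - p) c = z * l2_inner N c c"
  proof (cases "l2_inner N c c = 0")
    case True
    then have "c = 0" using l2_inner_self_eq_0[OF N cs] by blast
    then show ?thesis by (simp add: l2_inner_def)
  qed (simp add: z_def)
  let ?p = "p + fscale z c"
  have "l2_inner N (x - ?p) v = 0" if v: "v \<in> cfun.span (insert b B)" for v
  proof -
    obtain k where k: "v - fscale k b \<in> cfun.span B" using v cfun.span_breakdown_eq by blast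
    define s where "s = v - fscale k b + fscale k q"
    have s: "s \<in> cfun.span B" unfolding s_def using k q(1) by (intro cfun.span_add cfun.span_scale)
    have v': "v = fscale k c + s" by (simp add: s_def c_def fscale_def fun_eq_iff algebra_simps)
    have d: "x - ?p = (x - p) - fscale z c" by simp
    show ?thesis unfolding v' d
      using p(2)[OF s] q(2)[OF s] z
      by (simp add: l2_inner_diff_left l2_inner_scale_left l2_inner_add_right l2_inner_scale_right c_def)
  qed
  moreover have "?p \<in> cfun.span (insert b B)"
    using p(1) bB(2) c by (intro cfun.span_add cfun.span_scale) auto
  ultimately show ?case by blast
qed

lemma orthogonal_projection:
  assumes "finite N" "V \<subseteq> supported N" "cfun.subspace V"
  shows "\<exists>p\<in>V. \<forall>v\<in>V. l2_inner N (x - p) v = 0"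
proof -
  obtain B where B: "B \<subseteq> V" "finite B" "cfun.span B = V"
    by (rule finite_basis[OF assms cfun.independent_empty empty_subsetI])
  then have "B \<subseteq> supported N" using assms(2) by blast
  from orthogonal_projection_span[OF assms(1) B(2) this, of x] show ?thesis
    unfolding B(3) .
qed

text \<open>A subspace is cut out by the linear equations from its orthogonal complement. This gives the
  completeness of subspaces as well as the weak-star closedness of spaces defined by a
  finite-dimensional condition.\<close>

lemma orthogonal_complement_complement:
  assumes N: "finite N" and V: "V \<subseteq> supported N" "cfun.subspace V"
    and f: "f \<in> supported N"
    and 0: "\<And>w. w \<in> supported N \<Longrightarrow> (\<And>v. v \<in> V \<Longrightarrow> l2_inner N v w = 0) \<Longrightarrow> l2_inner N f w = 0"
  shows "f \<in> V"
proof -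
  obtain p where p: "p \<in> V" "\<And>v. v \<in> V \<Longrightarrow> l2_inner N (f - p) v = 0"
    using orthogonal_projection[OF N V, of f] by blast
  have w: "f - p \<in> supported N"
    using f p(1) V(1) by (intro cfun.subspace_diff[OF subspace_supported]) auto
  have "l2_inner N v (f - p) = 0" if "v \<in> V" for v
    using p(2)[OF that] l2_inner_commute[of N v "f - p"] by simp
  then have "l2_inner N f (f - p) = 0" "l2_inner N p (f - p) = 0" using 0[OF w] p(1) by blast+
  then have "l2_inner N (f - p) (f - p) = 0" by (simp add: l2_inner_diff_left)
  then have "f - p = 0" by (rule l2_inner_self_eq_0[OF N w])
  then show ?thesis using p(1) by simp
qed


section \<open>Subrepresentations of the regular representation\<close>

text \<open>A Cauchy sequence converges pointwise, and the limit stays in \<open>V\<close> because \<open>V\<close> is given by linear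
  equations.\<close>

lemma hilbert_space_supported:
  assumes N: "finite N" and V: "V \<subseteq> supported N" "cfun.subspace V"
    and H: "hcarrier H = V" "hinner H = l2_inner N"
  shows "hilbert_space H"
proof -
  have pos: "Re (l2_inner N u u) > 0" if u: "u \<in> V" "u \<noteq> 0" for u
  proof -
    have "l2_inner N u u \<noteq> 0" using l2_inner_self_eq_0[OF N] V(1) u by blast
    moreover have "(\<Sum>n\<in>N. (norm (u n))\<^sup>2) \<ge> 0" by (simp add: sum_nonneg)
    ultimately show ?thesis unfolding l2_inner_self of_real_eq_0_iff Re_complex_of_real by linarith
  qed
  have dist: "hdist H u v = sqrt (\<Sum>n\<in>N. (norm (u n - v n))\<^sup>2)" if "u \<in> V" "v \<in> V" for u v
    using that by (simp add: hdist_def H l2_inner_self del: of_real_sum)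
  have Ms: "Metric_space V (hdist H)"
  proof
    have l2: "hdist H u v = L2_set (\<lambda>n. norm (u n - v n)) N" if "u \<in> V" "v \<in> V" for u v
      using dist[OF that] by (simp add: L2_set_def)
    show "0 \<le> hdist H u v" for u v
      using l2[of u v] by (cases "u \<in> V \<and> v \<in> V") (simp, auto simp: hdist_def H)
    show "hdist H u v = hdist H v u" for u v
      using l2[of u v] l2[of v u]
      by (cases "u \<in> V \<and> v \<in> V") (simp add: norm_minus_commute, auto simp: hdist_def H)
    show "hdist H u v = 0 \<longleftrightarrow> u = v" if uv: "u \<in> V" "v \<in> V" for u v
    proof -
      have "u x = v x" if "x \<notin> N" for x
        using supportedD[OF subsetD[OF V(1) uv(1)] that] supportedD[OF subsetD[OF V(1) uv(2)] that] by simp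
      then show ?thesis using l2[OF uv] N by (auto simp: L2_set_eq_0_iff fun_eq_iff)
    qed
    show "hdist H u w \<le> hdist H u v + hdist H v w" if "u \<in> V" "v \<in> V" "w \<in> V" for u v w
    proof -
      have "L2_set (\<lambda>n. norm (u n - w n)) N
          \<le> L2_set (\<lambda>n. norm (u n - v n) + norm (v n - w n)) N"
        by (intro L2_set_mono) (metis diff_add_cancel add_diff_eq norm_triangle_ineq, simp)
      also have "\<dots> \<le> L2_set (\<lambda>n. norm (u n - v n)) N + L2_set (\<lambda>n. norm (v n - w n)) N"
        by (rule L2_set_triangle_ineq)
      finally show ?thesis using that by (simp add: l2)
    qed
  qed
  have "Metric_space.mcomplete V (hdist H)"
    unfolding Metric_space.mcomplete_def[OF Ms]
  proof (intro allI impI)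
    fix s assume "Metric_space.MCauchy V (hdist H) s"
    then have s: "\<And>k. s k \<in> V"
      and cau: "\<And>e. e > 0 \<Longrightarrow> \<exists>K. \<forall>j k. K \<le> j \<longrightarrow> K \<le> k \<longrightarrow> hdist H (s j) (s k) < e"
      unfolding Metric_space.MCauchy_def[OF Ms] image_subset_iff by simp_all
    have "Cauchy (\<lambda>k. s k x)" if x: "x \<in> N" for x
    proof (rule metric_CauchyI)
      fix e :: real assume "e > 0"
      then obtain K where K: "\<And>j k. K \<le> j \<Longrightarrow> K \<le> k \<Longrightarrow> hdist H (s j) (s k) < e"
        using cau by blast
      have "dist (s j x) (s k x) < e" if jk: "j \<ge> K" "k \<ge> K" for j k
      proof -
        have "(norm (s j x - s k x))\<^sup>2 \<le> (\<Sum>n\<in>N. (norm (s j n - s k n))\<^sup>2)"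
          using x N by (intro member_le_sum) auto
        then have "norm (s j x - s k x) \<le> hdist H (s j) (s k)"
          unfolding dist[OF s s] by (rule real_le_rsqrt)
        then show ?thesis using K[OF jk] by (simp add: dist_norm)
      qed
      then show "\<exists>M. \<forall>m\<ge>M. \<forall>n\<ge>M. dist (s m x) (s n x) < e" by blast
    qed
    then have "convergent (\<lambda>k. s k x)" if "x \<in> N" for x
      using that by (simp add: Cauchy_convergent_iff)
    moreover have zero: "s k x = 0" if "x \<notin> N" for k x
      by (rule supportedD[OF subsetD[OF V(1) s] that])
    ultimately have "\<exists>L. (\<lambda>k. s k x) \<longlonglongrightarrow> L" for x
      unfolding convergent_def by (cases "x \<in> N") auto
    then obtain l where l: "\<And>x. (\<lambda>k. s k x) \<longlonglongrightarrow> l x" by metis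
    have ls: "l \<in> supported N"
      unfolding supported_def
    proof (intro CollectI allI impI)
      fix x assume "x \<notin> N"
      then show "l x = 0" using l[of x] by (simp add: zero LIMSEQ_const_iff)
    qed
    have "l \<in> V"
    proof (rule orthogonal_complement_complement[OF N V ls])
      fix w assume "\<And>v. v \<in> V \<Longrightarrow> l2_inner N v w = 0"
      then have "l2_inner N (s k) w = 0" for k using s by blast
      moreover have "(\<lambda>k. l2_inner N (s k) w) \<longlonglongrightarrow> l2_inner N l w"
        unfolding l2_inner_def by (intro tendsto_intros l)
      ultimately show "l2_inner N l w = 0" by (simp add: LIMSEQ_const_iff)
    qed
    have "(\<lambda>k. hdist H (s k) l) \<longlonglongrightarrow> sqrt (\<Sum>n\<in>N. (norm (l n - l n))\<^sup>2)"
      unfolding dist[OF s \<open>l \<in> V\<close>] by (intro tendsto_intros l)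
    then have lim: "(\<lambda>k. hdist H (s k) l) \<longlonglongrightarrow> 0" by simp
    have "limitin (Metric_space.mtopology V (hdist H)) s l sequentially"
      unfolding Metric_space.limitin_metric[OF Ms]
      using s \<open>l \<in> V\<close> order_tendstoD(2)[OF lim] by (auto elim: eventually_mono)
    then show "\<exists>l. limitin (Metric_space.mtopology V (hdist H)) s l sequentially" by blast
  qed
  moreover have "\<forall>u\<in>V. \<forall>w\<in>V. l2_inner N w u = cnj (l2_inner N u w)" by (intro ballI l2_inner_commute)
  ultimately show ?thesis
    unfolding hilbert_space_def H l2_inner_add_left l2_inner_scale_left using V(2) pos by blast
qed

lemma l1_finite: "finite (carrier G) \<Longrightarrow> l1 G = supported (carrier G)"
  by (auto simp: l1_def supported_def)

lemma conv_add_right_finite: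
  assumes "finite (carrier G)"
  shows "conv G f (u + v) = conv G f u + conv G f v"
  using assms by (simp add: conv_def fun_eq_iff distrib_left sum.distrib)

lemma conv_scale_right_finite:
  assumes "finite (carrier G)"
  shows "conv G f (fscale c u) = fscale c (conv G f u)"
  using assms by (simp add: conv_def fun_eq_iff fscale_def sum_distrib_left mult.left_commute)

context group
begin

text \<open>For the left regular representation, the extension to the group algebra is convolution.\<close>

lemma conv_eq_sum_translates:
  assumes "finite (carrier G)"
  shows "conv G f g = (\<Sum>n\<in>carrier G. fscale (f n) (conv G (delta n) g))"
proof
  fix x show "conv G f g x = (\<Sum>n\<in>carrier G. fscale (f n) (conv G (delta n) g)) x"
    unfolding sum_apply using assms
    by (cases "x \<in> carrier G") (simp_all add: conv_delta_left fscale_def, simp_all add: conv_def)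
qed

lemma translate_mult:
  assumes "m \<in> carrier G" "n \<in> carrier G"
  shows "conv G (delta (m \<otimes> n)) u = conv G (delta m) (conv G (delta n) u)"
  using assms by (simp add: fun_eq_iff conv_delta_left inv_mult_group m_assoc)

lemma translate_one:
  assumes "u \<in> supported (carrier G)"
  shows "conv G (delta \<one>) u = u"
  using supportedD[OF assms] by (auto simp: fun_eq_iff conv_delta_left)

lemma translate_inverse:
  assumes "n \<in> carrier G" "u \<in> supported (carrier G)"
  shows "conv G (delta n) (conv G (delta (inv n)) u) = u"
    "conv G (delta (inv n)) (conv G (delta n) u) = u"
  using translate_mult[of n "inv n" u] translate_mult[of "inv n" n u] translate_one[of u] assms
  by simp_all

lemma l2_inner_translate:
  assumes n: "n \<in> carrier G"
  shows "l2_inner (carrier G) (conv G (delta n) u) (conv G (delta n) v) = l2_inner (carrier G) u v"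
proof -
  have bij: "bij_betw ((\<otimes>) (inv n)) (carrier G) (carrier G)"
    by (rule bij_betw_byWitness[where f' = "(\<otimes>) n"]) (use n in \<open>auto simp: m_assoc[symmetric]\<close>)
  have "l2_inner (carrier G) (conv G (delta n) u) (conv G (delta n) v) =
      (\<Sum>x\<in>carrier G. u (inv n \<otimes> x) * cnj (v (inv n \<otimes> x)))"
    unfolding l2_inner_def using n by (intro sum.cong) (simp_all add: conv_delta_left)
  also have "\<dots> = l2_inner (carrier G) u v"
    unfolding l2_inner_def by (rule sum.reindex_bij_betw[OF bij])
  finally show ?thesis .
qed

lemma l2_inner_translate_left:
  assumes n: "n \<in> carrier G" and v: "v \<in> supported (carrier G)"
  shows "l2_inner (carrier G) (conv G (delta n) u) v = l2_inner (carrier G) u (conv G (delta (inv n)) v)"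
  using l2_inner_translate[OF n, of u "conv G (delta (inv n)) v"] translate_inverse(1)[OF n v] by simp

text \<open>Convolution with a point mass is left translation, so this is the left regular representation on
  an invariant subspace \<open>V\<close>.\<close>

definition regular_subrep :: "('a \<Rightarrow> complex) set \<Rightarrow> ('a, 'a) urep" where
  "regular_subrep V = \<lparr>hcarrier = V, hinner = l2_inner (carrier G), rop = (\<lambda>n. conv G (delta n))\<rparr>"

lemma regular_subrep_unitary:
  assumes fin: "finite (carrier G)" and V: "V \<subseteq> supported (carrier G)" "cfun.subspace V"
    and inv: "\<And>n v. n \<in> carrier G \<Longrightarrow> v \<in> V \<Longrightarrow> conv G (delta n) v \<in> V"
  shows "unitary_rep G (regular_subrep V)"
proof -
  have "hilbert_space (regular_subrep V)"
    by (rule hilbert_space_supported[OF fin V]) (simp_all add: regular_subrep_def)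
  moreover have "unitary_map (regular_subrep V) (regular_subrep V) (rop (regular_subrep V) n)"
    if n: "n \<in> carrier G" for n
  proof -
    have "bij_betw (conv G (delta n)) V V"
    proof (rule bij_betw_byWitness[where f' = "conv G (delta (inv n))"])
      show "\<forall>v\<in>V. conv G (delta (inv n)) (conv G (delta n) v) = v"
        using translate_inverse(2)[OF n] V(1) by blast
      show "\<forall>v\<in>V. conv G (delta n) (conv G (delta (inv n)) v) = v"
        using translate_inverse(1)[OF n] V(1) by blast
    qed (use inv n in auto)
    then show ?thesis
      unfolding unitary_map_def regular_subrep_def
      using l2_inner_translate[OF n] fin by (simp add: conv_add_right_finite conv_scale_right_finite)
  qed
  ultimately show ?thesis
    unfolding unitary_rep_def by (simp add: regular_subrep_def translate_mult)
qed

text \<open>Let \<open>W\<close> be the orthogonal complement of \<open>J\<close>, which is invariant under left translations. For \<open>j \<in> J\<close> and \<open>w \<in> W\<close> the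
  function \<open>j * w\<close> lies in \<open>W\<close>, and in \<open>J\<close> because \<open>J\<close> is a right ideal, so \<open>J\<close> annihilates \<open>W\<close>. On the other
  hand \<open>f\<close> does not: write \<open>\<delta>\<^sub>1 = p + w\<close> with \<open>p \<in> J\<close> and \<open>w \<in> W\<close>; then \<open>f * w = f - f * p\<close> is not in \<open>J\<close>.
  An invariant subspace of \<open>W\<close> of least dimension on which \<open>f\<close> acts nontrivially is irreducible, since
  otherwise it would be the orthogonal sum of two smaller invariant subspaces, both annihilated by \<open>f\<close>.\<close>

lemma ideal_separated_by_irreducible:
  assumes fin: "finite (carrier G)" and J: "l1_ideal G J" and f: "f \<in> l1 G" "f \<notin> J"
  shows "\<exists>V. irreducible_unitary_rep G (regular_subrep V) \<and> V \<subseteq> supported (carrier G) \<and>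
    (\<forall>j\<in>J. \<forall>v\<in>V. conv G j v = 0) \<and> (\<exists>v\<in>V. conv G f v \<noteq> 0)"
proof -
  let ?N = "carrier G" and ?S = "supported (carrier G)"
  note l1 = l1_finite[OF fin]
  have JS: "J \<subseteq> ?S" and J_sub: "cfun.subspace J"
    and J_left: "\<And>g j. g \<in> ?S \<Longrightarrow> j \<in> J \<Longrightarrow> conv G g j \<in> J"
    and J_right: "\<And>g j. g \<in> ?S \<Longrightarrow> j \<in> J \<Longrightarrow> conv G j g \<in> J"
    using J by (auto simp: l1_ideal_def l1)
  have delta_S: "delta n \<in> ?S" if "n \<in> ?N" for n using delta_l1[OF that] l1 by simp
  have translate_S: "conv G g u \<in> ?S" for g u by (simp add: supported_def conv_def)
  define orth where "orth U V = {v \<in> V. \<forall>u\<in>U. l2_inner ?N v u = 0}" for U V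
  have orth_sub: "cfun.subspace (orth U V)" if "cfun.subspace V" for U V
    using that by (auto simp: cfun.subspace_def orth_def l2_inner_add_left l2_inner_scale_left l2_inner_zero_left)
  have orth_inv: "conv G (delta n) v \<in> orth U V"
    if "n \<in> ?N" "v \<in> orth U V" "U \<subseteq> ?S" "\<And>n u. n \<in> ?N \<Longrightarrow> u \<in> U \<Longrightarrow> conv G (delta n) u \<in> U"
      "\<And>n v. n \<in> ?N \<Longrightarrow> v \<in> V \<Longrightarrow> conv G (delta n) v \<in> V" for n v U V
    using that l2_inner_translate_left[OF that(1)] by (auto simp: orth_def)
  define W where "W = orth J ?S"
  have W_sub: "cfun.subspace W" unfolding W_def by (rule orth_sub[OF subspace_supported])
  have WS: "W \<subseteq> ?S" by (auto simp: W_def orth_def)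
  have W_inv: "conv G (delta n) w \<in> W" if "n \<in> ?N" "w \<in> W" for n w
    unfolding W_def using that J_left[OF delta_S] JS translate_S by (intro orth_inv) (auto simp: W_def)
  have kill: "conv G j w = 0" if j: "j \<in> J" and w: "w \<in> W" for j w
  proof -
    have "conv G j w \<in> W"
      unfolding conv_eq_sum_translates[OF fin, of j]
      using w W_inv by (intro cfun.subspace_sum[OF W_sub] cfun.subspace_scale[OF W_sub]) auto
    moreover have "conv G j w \<in> J" using J_right j w WS by blast
    ultimately have "l2_inner ?N (conv G j w) (conv G j w) = 0" by (simp add: W_def orth_def)
    then show ?thesis by (rule l2_inner_self_eq_0[OF fin translate_S])
  qed
  have moved: "\<exists>w\<in>W. conv G f w \<noteq> 0"
  proof -
    obtain p where p: "p \<in> J" "\<And>j. j \<in> J \<Longrightarrow> l2_inner ?N (delta \<one> - p) j = 0"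
      using orthogonal_projection[OF fin JS J_sub, of "delta \<one>"] by blast
    define w where "w = delta \<one> - p"
    have "w \<in> ?S" unfolding w_def
      using delta_S[of \<one>] p(1) JS by (intro cfun.subspace_diff[OF subspace_supported]) auto
    then have w: "w \<in> W" using p(2) by (simp add: W_def orth_def w_def)
    have "conv G f (delta \<one>) = f"
      using l1_zero_outside[OF f(1)] by (auto simp: fun_eq_iff conv_delta_right)
    then have "f = conv G f w + conv G f p"
      using conv_add_right_finite[OF fin, of f w p] by (simp add: w_def)
    moreover have "conv G f p \<in> J" using J_left p(1) f(1) l1 by blast
    ultimately have "conv G f w \<noteq> 0" using f(2) by auto
    then show ?thesis using w by blast
  qed
  define good where "good V \<longleftrightarrow> cfun.subspace V \<and> V \<subseteq> W \<and>
    (\<forall>n\<in>?N. \<forall>v\<in>V. conv G (delta n) v \<in> V) \<and> (\<exists>v\<in>V. conv G f v \<noteq> 0)" for V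
  have "good W" using W_sub W_inv moved by (simp add: good_def)
  then obtain V where V: "good V" and min: "\<And>U. good U \<Longrightarrow> cfun.dim V \<le> cfun.dim U"
    using ex_has_least_nat[of good W cfun.dim] by blast
  have V_sub: "cfun.subspace V" and VW: "V \<subseteq> W"
    and V_inv: "\<And>n v. n \<in> ?N \<Longrightarrow> v \<in> V \<Longrightarrow> conv G (delta n) v \<in> V"
    and V_moved: "\<exists>v\<in>V. conv G f v \<noteq> 0" using V by (auto simp: good_def)
  have VS: "V \<subseteq> ?S" using VW WS by blast
  have small: "conv G f u = 0"
    if U: "cfun.subspace U" "U \<subset> V" "\<And>n u. n \<in> ?N \<Longrightarrow> u \<in> U \<Longrightarrow> conv G (delta n) u \<in> U"
      and u: "u \<in> U" for U u
  proof (rule ccontr)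
    assume "conv G f u \<noteq> 0"
    then have "good U" using U u VW by (auto simp: good_def)
    then show False using min[of U] dim_psubset[OF fin VS V_sub U(1,2)] by simp
  qed
  have "U = {0} \<or> U = V"
    if U: "cfun.subspace U" "U \<subseteq> V" "\<And>n u. n \<in> ?N \<Longrightarrow> u \<in> U \<Longrightarrow> conv G (delta n) u \<in> U" for U
  proof (rule ccontr)
    assume neg: "\<not> (U = {0} \<or> U = V)"
    then obtain u where u: "u \<in> U" "u \<noteq> 0" using cfun.subspace_0[OF U(1)] by blast
    have US: "U \<subseteq> ?S" using U(2) VS by blast
    have "l2_inner ?N u u \<noteq> 0" using l2_inner_self_eq_0[OF fin, of u] u US by blast
    then have "u \<in> V - orth U V" using u U(2) by (auto simp: orth_def)
    then have prp: "orth U V \<subset> V" by (auto simp: orth_def)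
    have "conv G f v = 0" if v: "v \<in> V" for v
    proof -
      obtain p where p: "p \<in> U" "\<And>u. u \<in> U \<Longrightarrow> l2_inner ?N (v - p) u = 0"
        using orthogonal_projection[OF fin US U(1), of v] by blast
      have "v - p \<in> orth U V"
        using p v U(2) cfun.subspace_diff[OF V_sub] by (auto simp: orth_def)
      moreover have "conv G (delta n) u \<in> orth U V" if "n \<in> ?N" "u \<in> orth U V" for n u
        using that US U(3) V_inv by (rule orth_inv)
      ultimately have "conv G f (v - p) = 0"
        using small[OF orth_sub[OF V_sub] prp] by blast
      moreover have "conv G f p = 0" using neg U(2) by (intro small[OF U(1) _ U(3) p(1)]) auto
      ultimately show ?thesis using conv_add_right_finite[OF fin, of f "v - p" p] by simp
    qed
    then show False using V_moved by blast
  qed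
  moreover have "V \<noteq> {0}"
  proof
    assume "V = {0}"
    moreover have "conv G f 0 = 0" by (simp add: conv_def fun_eq_iff)
    ultimately show False using V_moved by simp
  qed
  moreover have un: "unitary_rep G (regular_subrep V)"
    by (rule regular_subrep_unitary[OF fin VS V_sub V_inv])
  moreover have "U \<subseteq> V" if "closedin (htopology (regular_subrep V)) U" for U
  proof -
    have H: "hilbert_space (regular_subrep V)" using un by (simp add: unitary_rep_def)
    show ?thesis using closedin_subset[OF that]
      by (simp add: Metric_space.topspace_mtopology[OF Metric_space_hdist[OF H]])
        (simp add: regular_subrep_def)
  qed
  ultimately have "irreducible_unitary_rep G (regular_subrep V)"
    unfolding irreducible_unitary_rep_def by (simp add: regular_subrep_def)
  then show ?thesis using kill VW VS V_moved by blast
qed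

end

section \<open>Kernels of representations of finite groups\<close>

lemma unitary_repD:
  assumes "unitary_rep N \<pi>"
  shows "hilbert_space \<pi>"
    and "\<And>n. n \<in> carrier N \<Longrightarrow> unitary_map \<pi> \<pi> (rop \<pi> n)"
    and "\<And>n u. n \<in> carrier N \<Longrightarrow> u \<in> hcarrier \<pi> \<Longrightarrow> rop \<pi> n u \<in> hcarrier \<pi>"
    and "\<And>m n u. m \<in> carrier N \<Longrightarrow> n \<in> carrier N \<Longrightarrow> u \<in> hcarrier \<pi> \<Longrightarrow>
        rop \<pi> (m \<otimes>\<^bsub>N\<^esub> n) u = rop \<pi> m (rop \<pi> n u)"
  using assms unitary_mapD(5) unfolding unitary_rep_def by blast+

lemma irreducible_imp_unitary_rep: "irreducible_unitary_rep N \<pi> \<Longrightarrow> unitary_rep N \<pi>"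
  by (simp add: irreducible_unitary_rep_def)

lemma unitary_map_sum:
  assumes U: "unitary_map H H' U" and H: "hilbert_space H" and A: "finite A"
    and v: "\<And>n. n \<in> A \<Longrightarrow> v n \<in> hcarrier H"
  shows "U (\<Sum>n\<in>A. fscale (c n) (v n)) = (\<Sum>n\<in>A. fscale (c n) (U (v n)))"
    "(\<Sum>n\<in>A. fscale (c n) (v n)) \<in> hcarrier H"
proof -
  note sub = hilbert_spaceD(1)[OF H] and D = unitary_mapD[OF U]
  have U0: "U 0 = 0" using D(2)[of 0 0] cfun.subspace_0[OF sub] by simp
  have "(\<Sum>n\<in>A. fscale (c n) (v n)) \<in> hcarrier H \<and>
      U (\<Sum>n\<in>A. fscale (c n) (v n)) = (\<Sum>n\<in>A. fscale (c n) (U (v n)))"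
    using A v
  proof (induction A rule: finite_induct)
    case empty
    show ?case unfolding sum.empty using U0 cfun.subspace_0[OF sub] by blast
  next
    case (insert a A)
    have a: "v a \<in> hcarrier H" using insert.prems by blast
    have IH: "(\<Sum>n\<in>A. fscale (c n) (v n)) \<in> hcarrier H"
      "U (\<Sum>n\<in>A. fscale (c n) (v n)) = (\<Sum>n\<in>A. fscale (c n) (U (v n)))"
      using insert.IH insert.prems by blast+
    have ca: "fscale (c a) (v a) \<in> hcarrier H" by (rule cfun.subspace_scale[OF sub a])
    show ?case
      unfolding sum.insert[OF insert.hyps]
      using cfun.subspace_add[OF sub ca IH(1)] D(2)[OF ca IH(1)] D(3)[OF a] IH(2) by metis
  qed
  then show "U (\<Sum>n\<in>A. fscale (c n) (v n)) = (\<Sum>n\<in>A. fscale (c n) (U (v n)))"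
    "(\<Sum>n\<in>A. fscale (c n) (v n)) \<in> hcarrier H" by auto
qed

definition rep_sum :: "('n, 'b) monoid_scheme \<Rightarrow> ('n, 'i) urep \<Rightarrow> ('n \<Rightarrow> complex) \<Rightarrow>
    ('i \<Rightarrow> complex) \<Rightarrow> 'i \<Rightarrow> complex" where
  "rep_sum N \<pi> f v = (\<Sum>n\<in>carrier N. fscale (f n) (rop \<pi> n v))"

lemma rep_sum_closed:
  assumes \<pi>: "unitary_rep N \<pi>" and v: "v \<in> hcarrier \<pi>"
  shows "rep_sum N \<pi> f v \<in> hcarrier \<pi>"
  unfolding rep_sum_def
  using hilbert_spaceD(1)[OF unitary_repD(1)[OF \<pi>]] unitary_repD(3)[OF \<pi> _ v]
  by (intro cfun.subspace_sum cfun.subspace_scale) auto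

text \<open>On a finite group the net of partial sums is eventually constant.\<close>

lemma rep_l1_finite:
  assumes fin: "finite (carrier N)" and \<pi>: "unitary_rep N \<pi>" and v: "v \<in> hcarrier \<pi>"
  shows "rep_l1 N \<pi> f v = rep_sum N \<pi> f v"
proof -
  note H = unitary_repD(1)[OF \<pi>]
  have F: "finite_subsets_at_top (carrier N) = principal {carrier N}"
    by (rule finite_subsets_at_top_finite[OF fin])
  have *: "limitin (htopology \<pi>) (\<lambda>A. \<Sum>n\<in>A. fscale (f n) (rop \<pi> n v)) u
      (finite_subsets_at_top (carrier N)) \<longleftrightarrow> u = rep_sum N \<pi> f v" for u
  proof -
    have "limitin (htopology \<pi>) (\<lambda>A. \<Sum>n\<in>A. fscale (f n) (rop \<pi> n v)) u
        (finite_subsets_at_top (carrier N)) \<longleftrightarrow>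
        u \<in> hcarrier \<pi> \<and> (\<forall>e>0. hdist \<pi> (rep_sum N \<pi> f v) u < e)"
      unfolding limitin_hdist[OF H] F eventually_principal
      using rep_sum_closed[OF \<pi> v, of f] by (simp add: rep_sum_def)
    also have "\<dots> \<longleftrightarrow> u \<in> hcarrier \<pi> \<and> hdist \<pi> (rep_sum N \<pi> f v) u = 0"
      using Metric_space.nonneg[OF Metric_space_hdist[OF H], of "rep_sum N \<pi> f v" u]
      by (metis less_le linorder_not_less order.irrefl)
    also have "\<dots> \<longleftrightarrow> u = rep_sum N \<pi> f v"
      using Metric_space.zero[OF Metric_space_hdist[OF H] rep_sum_closed[OF \<pi> v], of u]
        rep_sum_closed[OF \<pi> v, of f] by metis
    finally show ?thesis .
  qed
  show ?thesis unfolding rep_l1_def * by simp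
qed

lemma rep_kernel_finite:
  assumes "finite (carrier N)" "unitary_rep N \<pi>"
  shows "rep_kernel N \<pi> = {f \<in> l1 N. \<forall>v\<in>hcarrier \<pi>. rep_sum N \<pi> f v = 0}"
  using rep_l1_finite[OF assms] by (auto simp: rep_kernel_def)

lemma rep_kernel_equiv:
  assumes fin: "finite (carrier N)" and \<pi>: "unitary_rep N \<pi>" and \<sigma>: "unitary_rep N \<sigma>"
    and e: "rep_equiv N \<pi> \<sigma>"
  shows "rep_kernel N \<pi> = rep_kernel N \<sigma>"
proof -
  obtain U where U: "unitary_map \<pi> \<sigma> U"
    "\<And>n u. n \<in> carrier N \<Longrightarrow> u \<in> hcarrier \<pi> \<Longrightarrow> U (rop \<pi> n u) = rop \<sigma> n (U u)"
    using e unfolding rep_equiv_def by blast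
  note H = unitary_repD(1)[OF \<pi>]
  have int: "U (rep_sum N \<pi> f v) = rep_sum N \<sigma> f (U v)" if v: "v \<in> hcarrier \<pi>" for f v
    unfolding rep_sum_def using U(2) v
    by (subst unitary_map_sum(1)[OF U(1) H fin]) (simp_all add: unitary_repD(3)[OF \<pi>])
  have bij: "bij_betw U (hcarrier \<pi>) (hcarrier \<sigma>)" by (rule unitary_mapD(1)[OF U(1)])
  have z: "0 \<in> hcarrier \<pi>" by (rule cfun.subspace_0[OF hilbert_spaceD(1)[OF H]])
  have U0: "U 0 = 0" using unitary_mapD(2)[OF U(1) z z] by simp
  have "rep_sum N \<pi> f v = 0 \<longleftrightarrow> rep_sum N \<sigma> f (U v) = 0" if v: "v \<in> hcarrier \<pi>" for f v
    using int[OF v, of f] U0 inj_onD[OF bij_betw_imp_inj_on[OF bij] _ rep_sum_closed[OF \<pi> v] z, of f]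
    by auto
  then have "(\<forall>v\<in>hcarrier \<pi>. rep_sum N \<pi> f v = 0) \<longleftrightarrow> (\<forall>v\<in>hcarrier \<sigma>. rep_sum N \<sigma> f v = 0)" for f
    unfolding bij_betw_imp_surj_on[OF bij, symmetric] by simp
  then show ?thesis by (simp add: rep_kernel_finite[OF fin \<pi>] rep_kernel_finite[OF fin \<sigma>])
qed

lemma subspace_rep_kernel:
  assumes fin: "finite (carrier N)" and \<pi>: "unitary_rep N \<pi>"
  shows "cfun.subspace (rep_kernel N \<pi>)"
proof -
  have "rep_sum N \<pi> (f + g) v = rep_sum N \<pi> f v + rep_sum N \<pi> g v" for f g v
    by (simp add: rep_sum_def fun_eq_iff sum_apply fscale_def distrib_right sum.distrib)
  moreover have "rep_sum N \<pi> (fscale c f) v = fscale c (rep_sum N \<pi> f v)" for c f v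
    by (simp add: rep_sum_def fun_eq_iff sum_apply fscale_def sum_distrib_left mult.assoc)
  moreover have "rep_sum N \<pi> 0 v = 0" for v
    by (simp add: rep_sum_def fun_eq_iff sum_apply fscale_def)
  ultimately show ?thesis
    unfolding rep_kernel_finite[OF assms] cfun.subspace_def
    using subspace_l1[of N] by (simp add: cfun.subspace_def fscale_def zero_fun_def)
qed

lemma unitary_dual_members:
  assumes N: "group N" and P: "P \<in> unitary_dual N" and \<pi>: "\<pi> \<in> P"
  shows "irreducible_unitary_rep N \<pi>" "\<sigma> \<in> P \<Longrightarrow> rep_equiv N \<pi> \<sigma>"
proof -
  have rel: "(\<pi>, \<sigma>) \<in> rep_equiv_rel N" if "\<sigma> \<in> P" for \<sigma>
    using P \<pi> that quotient_eq_iff[OF equiv_rep_equiv_rel[OF N], of P P \<pi> \<sigma>]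
    unfolding unitary_dual_def by blast
  show "irreducible_unitary_rep N \<pi>" using rel[OF \<pi>] by (simp add: rep_equiv_rel_def)
  show "rep_equiv N \<pi> \<sigma>" if "\<sigma> \<in> P" using rel[OF that] by (simp add: rep_equiv_rel_def)
qed

lemma class_kernel_eq:
  assumes N: "group N" and fin: "finite (carrier N)"
    and P: "P \<in> unitary_dual N" and \<pi>: "\<pi> \<in> P"
  shows "class_kernel N P = rep_kernel N \<pi>"
  unfolding class_kernel_def
proof (rule INF_eq_const)
  show "P \<noteq> {}" using \<pi> by blast
  fix \<sigma> assume \<sigma>: "\<sigma> \<in> P"
  show "rep_kernel N \<sigma> = rep_kernel N \<pi>"
    by (rule rep_kernel_equiv[OF fin _ _ unitary_dual_members(2)[OF N P \<sigma> \<pi>]])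
      (intro irreducible_imp_unitary_rep unitary_dual_members(1)[OF N P] \<sigma> \<pi>)+
qed

lemma unitary_dual_eqI:
  assumes N: "group N" and "P \<in> unitary_dual N" "Q \<in> unitary_dual N" "\<pi> \<in> P" "\<sigma> \<in> Q"
    and "rep_equiv N \<pi> \<sigma>" "irreducible_unitary_rep N \<pi>" "irreducible_unitary_rep N \<sigma>"
  shows "P = Q"
  using quotient_eq_iff[OF equiv_rep_equiv_rel[OF N], of P Q \<pi> \<sigma>] assms
  by (simp add: unitary_dual_def rep_equiv_rel_def)

lemma unitary_dual_class:
  assumes N: "group N" and "irreducible_unitary_rep N \<pi>"
  shows "rep_equiv_rel N `` {\<pi>} \<in> unitary_dual N" "\<pi> \<in> rep_equiv_rel N `` {\<pi>}"
  unfolding unitary_dual_def using assms(2) equiv_class_self[OF equiv_rep_equiv_rel[OF N], of \<pi>]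
  by (auto intro: quotientI)

lemma unitary_dual_nonempty:
  assumes "group N" "P \<in> unitary_dual N" obtains \<pi> where "\<pi> \<in> P"
  using in_quotient_imp_non_empty[OF equiv_rep_equiv_rel[OF assms(1)]] assms(2)
  unfolding unitary_dual_def by blast

lemma rep_equiv_identity:
  assumes "hcarrier \<sigma> = hcarrier \<pi>" "hinner \<sigma> = hinner \<pi>"
    "\<And>n u. n \<in> carrier N \<Longrightarrow> u \<in> hcarrier \<pi> \<Longrightarrow> rop \<pi> n u = rop \<sigma> n u"
  shows "rep_equiv N \<pi> \<sigma>"
proof -
  have "unitary_map \<pi> \<sigma> (\<lambda>u. u)" unfolding unitary_map_def assms(1,2) by (simp add: bij_betw_def)
  then show ?thesis unfolding rep_equiv_def using assms(3) by (intro exI[of _ "\<lambda>u. u"]) simp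
qed


text \<open>Passing to a conjugate representation changes only the operators, and none of these notions
  mentions the operators.\<close>

lemma hspace_cong:
  fixes \<pi> \<sigma> :: "('n, 'i) urep"
  assumes "hcarrier \<sigma> = hcarrier \<pi>" "hinner \<sigma> = hinner \<pi>"
  shows "hdist \<sigma> = hdist \<pi>" "hilbert_space \<sigma> = hilbert_space \<pi>"
    "unitary_map \<sigma> \<sigma> = unitary_map \<pi> \<pi>"
proof -
  show d: "hdist \<sigma> = hdist \<pi>" using assms by (simp add: hdist_def fun_eq_iff)
  show "hilbert_space \<sigma> = hilbert_space \<pi>" by (simp add: hilbert_space_def assms d)
  show "unitary_map \<sigma> \<sigma> = unitary_map \<pi> \<pi>" by (simp add: unitary_map_def assms fun_eq_iff)
qed

section \<open>The action of the group on the dual of its FC-centre\<close>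

context group
begin

lemma FC_group_simps:
  "group (FC_group G)" "x \<in> FC G \<Longrightarrow> inv\<^bsub>FC_group G\<^esub> x = inv x"
  using subgroup_FC by (simp_all add: subgroup_imp_group m_inv_consistent)

lemma FC_closed:
  "x \<in> FC G \<Longrightarrow> x \<in> carrier G" "x \<in> FC G \<Longrightarrow> inv x \<in> FC G"
  "x \<in> FC G \<Longrightarrow> y \<in> FC G \<Longrightarrow> x \<otimes> y \<in> FC G" "\<one> \<in> FC G"
  "t \<in> carrier G \<Longrightarrow> x \<in> FC G \<Longrightarrow> inv t \<otimes> x \<otimes> t \<in> FC G"
  using subgroup.mem_carrier[OF subgroup_FC] subgroup.m_inv_closed[OF subgroup_FC]
    subgroup.m_closed[OF subgroup_FC] subgroup.one_closed[OF subgroup_FC]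
    FC_conjugate[of "inv t" x] by simp_all

lemma conj_rep_simps:
  "hcarrier (conj_rep G t \<pi>) = hcarrier \<pi>" "hinner (conj_rep G t \<pi>) = hinner \<pi>"
  "rop (conj_rep G t \<pi>) n = rop \<pi> (inv t \<otimes> n \<otimes> t)"
  by (simp_all add: conj_rep_def)

lemma conj_rep_irreducible:
  assumes t: "t \<in> carrier G" and \<pi>: "irreducible_unitary_rep (FC_group G) \<pi>"
  shows "irreducible_unitary_rep (FC_group G) (conj_rep G t \<pi>)"
proof -
  let ?\<sigma> = "conj_rep G t \<pi>"
  note u = unitary_repD[OF irreducible_imp_unitary_rep[OF \<pi>], simplified]
  note cong = hspace_cong[OF conj_rep_simps(1,2), of t \<pi>]
  have "rop ?\<sigma> (m \<otimes> n) v = rop ?\<sigma> m (rop ?\<sigma> n v)"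
    if "m \<in> FC G" "n \<in> FC G" "v \<in> hcarrier \<pi>" for m n v
  proof -
    have "inv t \<otimes> (m \<otimes> n) \<otimes> t = (inv t \<otimes> m \<otimes> t) \<otimes> (inv t \<otimes> n \<otimes> t)"
      using conjugate_mult[of "inv t" m n] t that FC_closed(1) by simp
    then show ?thesis using u(4) that FC_closed(5)[OF t] by (simp add: conj_rep_simps)
  qed
  then have "unitary_rep (FC_group G) ?\<sigma>"
    using u FC_closed(5)[OF t] by (simp add: unitary_rep_def cong conj_rep_simps)
  moreover have "rop \<pi> m w \<in> W"
    if W: "\<forall>n\<in>FC G. \<forall>w\<in>W. rop ?\<sigma> n w \<in> W" and m: "m \<in> FC G" and w: "w \<in> W" for W m w
  proof -
    have "inv t \<otimes> conjugate t m \<otimes> t = m"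
      by (rule conjugate_cancel(1)[OF t FC_closed(1)[OF m]])
    then show ?thesis using W FC_conjugate[OF t m] w by (metis conj_rep_simps(3))
  qed
  ultimately show ?thesis
    using \<pi> unfolding irreducible_unitary_rep_def by (simp add: cong conj_rep_simps(1))
qed

lemma rep_equiv_conj_rep:
  assumes "t \<in> carrier G" "rep_equiv (FC_group G) \<pi> \<sigma>"
  shows "rep_equiv (FC_group G) (conj_rep G t \<pi>) (conj_rep G t \<sigma>)"
proof -
  obtain U where U: "unitary_map \<pi> \<sigma> U"
    "\<And>n u. n \<in> FC G \<Longrightarrow> u \<in> hcarrier \<pi> \<Longrightarrow> U (rop \<pi> n u) = rop \<sigma> n (U u)"
    using assms(2) unfolding rep_equiv_def by auto
  have "unitary_map (conj_rep G t \<pi>) (conj_rep G t \<sigma>) U"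
    using U(1) by (simp add: unitary_map_def conj_rep_simps)
  then show ?thesis
    unfolding rep_equiv_def using U(2) FC_closed(5)[OF assms(1)]
    by (intro exI[of _ U]) (simp add: conj_rep_simps)
qed

text \<open>Conjugating equivalent representations gives equivalent representations, so the saturation in
  \<^const>\<open>dual_action\<close> is a single class.\<close>

lemma dual_action_class:
  assumes t: "t \<in> carrier G" and P: "P \<in> unitary_dual (FC_group G)" and \<pi>: "\<pi> \<in> P"
  shows "dual_action G t P \<in> unitary_dual (FC_group G)" "conj_rep G t \<pi> \<in> dual_action G t P"
proof -
  note N = FC_group_simps(1)
  note eq = equiv_rep_equiv_rel[OF N]
  have "(conj_rep G t \<pi>, conj_rep G t \<sigma>) \<in> rep_equiv_rel (FC_group G)" if \<sigma>: "\<sigma> \<in> P" for \<sigma>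
    unfolding rep_equiv_rel_def
    using conj_rep_irreducible[OF t unitary_dual_members(1)[OF N P \<pi>]]
      conj_rep_irreducible[OF t unitary_dual_members(1)[OF N P \<sigma>]]
      rep_equiv_conj_rep[OF t unitary_dual_members(2)[OF N P \<pi> \<sigma>]] by blast
  then have "rep_equiv_rel (FC_group G) `` {conj_rep G t \<sigma>} =
      rep_equiv_rel (FC_group G) `` {conj_rep G t \<pi>}" if "\<sigma> \<in> P" for \<sigma>
    using equiv_class_eq[OF eq] that by metis
  then have *: "dual_action G t P = rep_equiv_rel (FC_group G) `` {conj_rep G t \<pi>}"
    unfolding dual_action_def using \<pi> by blast
  have "irreducible_unitary_rep (FC_group G) \<pi>" by (rule unitary_dual_members(1)[OF N P \<pi>])
  then show "dual_action G t P \<in> unitary_dual (FC_group G)" "conj_rep G t \<pi> \<in> dual_action G t P"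
    unfolding * using unitary_dual_class[OF N conj_rep_irreducible[OF t]] by auto
qed



subsection \<open>Kernels of invariant families of representations\<close>

lemma bij_conjugate_FC:
  assumes t: "t \<in> carrier G"
  shows "bij_betw (conjugate t) (FC G) (FC G)"
proof (rule bij_betw_byWitness[where f' = "conjugate (inv t)"])
  show "\<forall>x\<in>FC G. conjugate (inv t) (conjugate t x) = x"
    using conjugate_cancel(1)[OF t FC_closed(1)] t by simp
  show "\<forall>x\<in>FC G. conjugate t (conjugate (inv t) x) = x"
    using conjugate_cancel(2)[OF t FC_closed(1)] t by simp
qed (use FC_conjugate[OF t] FC_closed(5)[OF t] t in auto)

lemma bij_mult_FC:
  assumes m: "m \<in> FC G"
  shows "bij_betw ((\<otimes>) m) (FC G) (FC G)"
  by (rule bij_betw_byWitness[where f' = "(\<otimes>) (inv m)"])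
    (use m in \<open>auto simp: m_assoc[symmetric] FC_closed\<close>)

text \<open>The counterpart of the action on representations: \<open>f\<close> is in the kernel of \<open>t \<cdot> \<pi>\<close> exactly if
  \<open>conj_fun t f\<close> is in the kernel of \<open>\<pi>\<close>.\<close>

definition conj_fun :: "'a \<Rightarrow> ('a \<Rightarrow> complex) \<Rightarrow> 'a \<Rightarrow> complex" where
  "conj_fun t f = (\<lambda>n. if n \<in> FC G then f (conjugate t n) else 0)"

text \<open>The part of \<open>f\<close> on the coset of \<open>t\<close>, moved back to \<open>FC G\<close>.\<close>

definition coset_slice :: "'a \<Rightarrow> ('a \<Rightarrow> complex) \<Rightarrow> 'a \<Rightarrow> complex" where
  "coset_slice t f = (\<lambda>n. if n \<in> FC G then f (t \<otimes> n) else 0)"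

lemma coset_slice_coset_slice:
  assumes "t \<in> carrier G" "m \<in> FC G"
  shows "coset_slice m (coset_slice t f) = coset_slice (t \<otimes> m) f"
  using assms by (auto simp: coset_slice_def fun_eq_iff m_assoc FC_closed)

text \<open>For \<open>m \<in> FC G\<close>, \<open>coset_slice m\<close> is a left translation. The right translation \<open>n \<mapsto> f (n \<otimes> m)\<close> is
  such a left translation followed by a conjugation, so for finite \<open>FC G\<close> these spaces are the
  ideals of \<open>l1 (FC_group G)\<close> that are invariant under conjugation by \<open>G\<close>.\<close>

definition conj_stable :: "('a \<Rightarrow> complex) set \<Rightarrow> bool" where
  "conj_stable J \<longleftrightarrow> J \<subseteq> supported (FC G) \<and> cfun.subspace J \<and>
    (\<forall>m\<in>FC G. \<forall>f\<in>J. coset_slice m f \<in> J) \<and> (\<forall>t\<in>carrier G. \<forall>f\<in>J. conj_fun t f \<in> J)"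

lemma l1_FC: "finite (FC G) \<Longrightarrow> l1 (FC_group G) = supported (FC G)"
  using l1_finite[of "FC_group G"] by simp

lemma rep_kernel_conj_rep:
  assumes fin: "finite (FC G)" and t: "t \<in> carrier G"
    and \<pi>: "irreducible_unitary_rep (FC_group G) \<pi>" and f: "f \<in> rep_kernel (FC_group G) (conj_rep G t \<pi>)"
  shows "conj_fun t f \<in> rep_kernel (FC_group G) \<pi>"
proof -
  have fin': "finite (carrier (FC_group G))" using fin by simp
  have "rep_sum (FC_group G) \<pi> (conj_fun t f) v = rep_sum (FC_group G) (conj_rep G t \<pi>) f v" for v
  proof -
    let ?g = "\<lambda>n. fscale (f n) (rop \<pi> (inv t \<otimes> n \<otimes> t) v)"
    have "inv t \<otimes> conjugate t n \<otimes> t = n" if "n \<in> FC G" for n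
      by (rule conjugate_cancel(1)[OF t FC_closed(1)[OF that]])
    then have "rep_sum (FC_group G) \<pi> (conj_fun t f) v = (\<Sum>n\<in>FC G. ?g (conjugate t n))"
      unfolding rep_sum_def by (simp add: conj_fun_def)
    also have "\<dots> = (\<Sum>n\<in>FC G. ?g n)" by (rule sum.reindex_bij_betw[OF bij_conjugate_FC[OF t]])
    finally show ?thesis by (simp add: rep_sum_def conj_rep_simps)
  qed
  moreover have "conj_fun t f \<in> supported (FC G)" by (simp add: supported_def conj_fun_def)
  ultimately show ?thesis
    using f unfolding rep_kernel_finite[OF fin' irreducible_imp_unitary_rep[OF \<pi>]]
      rep_kernel_finite[OF fin' irreducible_imp_unitary_rep[OF conj_rep_irreducible[OF t \<pi>]]]
    by (simp add: l1_FC[OF fin] conj_rep_simps(1))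
qed

text \<open>Applying the injective operator \<open>\<pi>(m)\<close> to the sum for the translated function gives the sum for
  \<open>f\<close>.\<close>

lemma rep_kernel_coset_slice:
  assumes fin: "finite (FC G)" and m: "m \<in> FC G"
    and \<pi>: "unitary_rep (FC_group G) \<pi>" and f: "f \<in> rep_kernel (FC_group G) \<pi>"
  shows "coset_slice m f \<in> rep_kernel (FC_group G) \<pi>"
proof -
  have fin': "finite (carrier (FC_group G))" using fin by simp
  note u = unitary_repD[OF \<pi>, simplified]
  have "rep_sum (FC_group G) \<pi> (coset_slice m f) v = 0" if v: "v \<in> hcarrier \<pi>" for v
  proof -
    let ?s = "rep_sum (FC_group G) \<pi> (coset_slice m f) v"
    have z: "0 \<in> hcarrier \<pi>" by (rule hcarrier_closed(1)[OF u(1)])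
    have "rop \<pi> m ?s = (\<Sum>n\<in>FC G. fscale (f (m \<otimes> n)) (rop \<pi> (m \<otimes> n) v))"
      unfolding rep_sum_def using m v fin u(3,4)
      by (simp add: unitary_map_sum(1)[OF u(2)[OF m] u(1)] coset_slice_def)
    also have "\<dots> = rep_sum (FC_group G) \<pi> f v"
      unfolding rep_sum_def
      using sum.reindex_bij_betw[OF bij_mult_FC[OF m], of "\<lambda>n. fscale (f n) (rop \<pi> n v)"] by simp
    also have "\<dots> = 0" using f v unfolding rep_kernel_finite[OF fin' \<pi>] by blast
    also have "\<dots> = rop \<pi> m 0"
      using unitary_mapD(2)[OF u(2)[OF m] z z] by simp
    finally show ?thesis
      using inj_onD[OF bij_betw_imp_inj_on[OF unitary_mapD(1)[OF u(2)[OF m]]]]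
        rep_sum_closed[OF \<pi> v] z by blast
  qed
  moreover have "coset_slice m f \<in> supported (FC G)" by (simp add: supported_def coset_slice_def)
  ultimately show ?thesis
    unfolding rep_kernel_finite[OF fin' \<pi>] by (simp add: l1_FC[OF fin])
qed

text \<open>The element \<open>s\<close> takes the class of \<open>t \<cdot> \<pi>\<close> to that of \<open>(s \<otimes> t) \<cdot> \<pi>\<close>, which is in the same orbit.\<close>

lemma union_of_orbits_closed:
  assumes \<Omega>: "union_of_orbits G \<Omega>" "\<Omega> \<subseteq> unitary_dual (FC_group G)"
    and P: "P \<in> \<Omega>" and s: "s \<in> carrier G"
  shows "dual_action G s P \<in> \<Omega>"
proof -
  note N = FC_group_simps(1)
  obtain \<P> where \<P>: "\<P> \<subseteq> unitary_dual (FC_group G)" "\<Omega> = (\<Union>P\<in>\<P>. dual_orbit G P)"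
    using \<Omega>(1) unfolding union_of_orbits_def by blast
  then obtain Q t where Q: "Q \<in> \<P>" "t \<in> carrier G" "P = dual_action G t Q"
    using P by (auto simp: dual_orbit_def)
  have Qd: "Q \<in> unitary_dual (FC_group G)" using Q \<P> by blast
  obtain \<pi> where \<pi>: "\<pi> \<in> Q" by (rule unitary_dual_nonempty[OF N Qd])
  note irr = unitary_dual_members(1)[OF N Qd \<pi>]
  note c1 = dual_action_class[OF Q(2) Qd \<pi>, folded Q(3)]
  note c2 = dual_action_class[OF s c1]
  have st: "s \<otimes> t \<in> carrier G" using s Q(2) by simp
  note c3 = dual_action_class[OF st Qd \<pi>]
  have "rep_equiv (FC_group G) (conj_rep G s (conj_rep G t \<pi>)) (conj_rep G (s \<otimes> t) \<pi>)"
  proof (rule rep_equiv_identity)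
    fix n assume n: "n \<in> carrier (FC_group G)"
    have "inv t \<otimes> (inv s \<otimes> n \<otimes> s) \<otimes> t = inv (s \<otimes> t) \<otimes> n \<otimes> (s \<otimes> t)"
      using n s Q(2) FC_closed(1) by (simp add: inv_mult_group m_assoc)
    then show "rop (conj_rep G s (conj_rep G t \<pi>)) n u = rop (conj_rep G (s \<otimes> t) \<pi>) n u" for u
      by (simp add: conj_rep_simps)
  qed (simp_all add: conj_rep_simps)
  then have "dual_action G s P = dual_action G (s \<otimes> t) Q"
    by (rule unitary_dual_eqI[OF N c2(1) c3(1) c2(2) c3(2)])
      (intro conj_rep_irreducible irr s Q(2) st)+
  then show ?thesis using Q(1) st \<P>(2) by (auto simp: dual_orbit_def)
qed

lemma dual_action_one:
  assumes P: "P \<in> unitary_dual (FC_group G)"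
  shows "dual_action G \<one> P = P"
proof -
  note N = FC_group_simps(1)
  obtain \<pi> where \<pi>: "\<pi> \<in> P" by (rule unitary_dual_nonempty[OF N P])
  note irr = unitary_dual_members(1)[OF N P \<pi>]
  note c = dual_action_class[OF one_closed P \<pi>]
  have "rep_equiv (FC_group G) (conj_rep G \<one> \<pi>) \<pi>"
    by (rule rep_equiv_identity) (simp_all add: conj_rep_simps FC_closed)
  then show ?thesis
    by (rule unitary_dual_eqI[OF N c(1) P c(2) \<pi>]) (intro conj_rep_irreducible irr one_closed)+
qed

lemma K_conj_stable:
  assumes fin: "finite (FC G)"
    and \<Omega>: "\<Omega> \<subseteq> unitary_dual (FC_group G)" "union_of_orbits G \<Omega>"
  shows "conj_stable (K (FC_group G) \<Omega>)"
proof -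
  let ?N = "FC_group G"
  note N = FC_group_simps(1)
  have fin': "finite (carrier ?N)" using fin by simp
  have irr: "irreducible_unitary_rep ?N \<pi>" if "P \<in> \<Omega>" "\<pi> \<in> P" for P \<pi>
    by (rule unitary_dual_members(1)[OF N subsetD[OF \<Omega>(1) that(1)] that(2)])
  have K: "K ?N \<Omega> = supported (FC G) \<inter> (\<Inter>\<pi>\<in>\<Union>\<Omega>. rep_kernel ?N \<pi>)"
    unfolding K_def class_kernel_def l1_FC[OF fin] by blast
  show ?thesis
    unfolding conj_stable_def
  proof (intro conjI ballI)
    show "K ?N \<Omega> \<subseteq> supported (FC G)" unfolding K by blast
    show "cfun.subspace (K ?N \<Omega>)"
      unfolding K
    proof (rule cfun.subspace_inter[OF subspace_supported], rule cfun.subspace_Inter, rule ballI)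
      fix S assume "S \<in> rep_kernel ?N ` \<Union>\<Omega>"
      then obtain P \<pi> where P: "P \<in> \<Omega>" "\<pi> \<in> P" and S: "S = rep_kernel ?N \<pi>" by blast
      show "cfun.subspace S"
        unfolding S by (rule subspace_rep_kernel[OF fin' irreducible_imp_unitary_rep[OF irr[OF P]]])
    qed
    show "coset_slice m f \<in> K ?N \<Omega>" if "m \<in> FC G" "f \<in> K ?N \<Omega>" for m f
    proof -
      have "coset_slice m f \<in> supported (FC G)" by (simp add: supported_def coset_slice_def)
      moreover have "coset_slice m f \<in> rep_kernel ?N \<pi>" if P: "P \<in> \<Omega>" "\<pi> \<in> P" for P \<pi>
      proof (rule rep_kernel_coset_slice[OF fin \<open>m \<in> FC G\<close> irreducible_imp_unitary_rep[OF irr[OF P]]])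
        show "f \<in> rep_kernel ?N \<pi>" using \<open>f \<in> K ?N \<Omega>\<close> P unfolding K by blast
      qed
      ultimately show ?thesis unfolding K by blast
    qed
    show "conj_fun t f \<in> K ?N \<Omega>" if t: "t \<in> carrier G" and f: "f \<in> K ?N \<Omega>" for t f
    proof -
      have "conj_fun t f \<in> supported (FC G)" by (simp add: supported_def conj_fun_def)
      moreover have "conj_fun t f \<in> rep_kernel ?N \<pi>" if P: "P \<in> \<Omega>" "\<pi> \<in> P" for P \<pi>
      proof -
        have "conj_rep G t \<pi> \<in> dual_action G t P" 
          by (rule dual_action_class(2)[OF t subsetD[OF \<Omega>(1) P(1)] P(2)])
        moreover have "dual_action G t P \<in> \<Omega>" by (rule union_of_orbits_closed[OF \<Omega>(2,1) P(1) t])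
        ultimately have "f \<in> rep_kernel ?N (conj_rep G t \<pi>)" using f unfolding K by blast
        then show ?thesis by (rule rep_kernel_conj_rep[OF fin t irr[OF P]])
      qed
      ultimately show ?thesis unfolding K by blast
    qed
  qed
qed

lemma rep_kernel_regular_subrep:
  assumes "finite (carrier G)" "irreducible_unitary_rep G (regular_subrep V)"
  shows "rep_kernel G (regular_subrep V) = {f \<in> l1 G. \<forall>v\<in>V. conv G f v = 0}"
proof -
  have "rep_sum G (regular_subrep V) f v = conv G f v" for f v
    by (subst conv_eq_sum_translates[OF assms(1), of f v]) (simp add: rep_sum_def regular_subrep_def)
  then show ?thesis
    unfolding rep_kernel_finite[OF assms(1) irreducible_imp_unitary_rep[OF assms(2)]]
    by (simp add: regular_subrep_def)
qed

text \<open>Take for \<open>\<Omega>\<close> all classes whose kernel contains \<open>J\<close>. Irreducible representations separate \<open>J\<close> from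
  the functions outside it, and \<open>\<Omega>\<close> is closed under the action because \<open>J\<close> is invariant under conjugation.\<close>

lemma conj_invariant_ideal_eq_K:
  assumes fin: "finite (FC G)" and J: "l1_ideal (FC_group G) J" "conj_stable J"
  shows "\<exists>\<Omega>. \<Omega> \<subseteq> unitary_dual (FC_group G) \<and> union_of_orbits G \<Omega> \<and> J = K (FC_group G) \<Omega>"
proof -
  let ?N = "FC_group G"
  note N = FC_group_simps(1)
  have fin': "finite (carrier ?N)" using fin by simp
  define \<Omega> where "\<Omega> = {P \<in> unitary_dual ?N. J \<subseteq> class_kernel ?N P}"
  have sub: "\<Omega> \<subseteq> unitary_dual ?N" by (auto simp: \<Omega>_def)
  have moved: "dual_action G t P \<in> \<Omega>" if t: "t \<in> carrier G" and P: "P \<in> \<Omega>" for t P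
  proof -
    have Pd: "P \<in> unitary_dual ?N" using P sub by blast
    obtain \<pi> where \<pi>: "\<pi> \<in> P" by (rule unitary_dual_nonempty[OF N Pd])
    note irr = unitary_dual_members(1)[OF N Pd \<pi>]
    note c = dual_action_class[OF t Pd \<pi>]
    have "f \<in> rep_kernel ?N (conj_rep G t \<pi>)" if f: "f \<in> J" for f
    proof -
      have it: "inv t \<in> carrier G" using t by simp
      have "conj_fun t f \<in> J" using J(2) t f by (simp add: conj_stable_def)
      then have "conj_fun t f \<in> rep_kernel ?N \<pi>"
        using P class_kernel_eq[OF N fin' Pd \<pi>] by (auto simp: \<Omega>_def)
      moreover have "rep_equiv ?N \<pi> (conj_rep G (inv t) (conj_rep G t \<pi>))"
      proof (rule rep_equiv_identity)
        fix n assume n: "n \<in> carrier ?N"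
        have "inv t \<otimes> conjugate t n \<otimes> t = n"
          using conjugate_cancel(1)[OF t FC_closed(1)] n by simp
        then show "rop \<pi> n u = rop (conj_rep G (inv t) (conj_rep G t \<pi>)) n u" for u
          using t by (simp add: conj_rep_simps)
      qed (simp_all add: conj_rep_simps)
      ultimately have "conj_fun t f \<in> rep_kernel ?N (conj_rep G (inv t) (conj_rep G t \<pi>))"
        using rep_kernel_equiv[OF fin' irreducible_imp_unitary_rep[OF irr]
            irreducible_imp_unitary_rep[OF conj_rep_irreducible[OF it conj_rep_irreducible[OF t irr]]]]
        by simp
      then have "conj_fun (inv t) (conj_fun t f) \<in> rep_kernel ?N (conj_rep G t \<pi>)"
        by (rule rep_kernel_conj_rep[OF fin it conj_rep_irreducible[OF t irr]])
      moreover have "conj_fun (inv t) (conj_fun t f) = f"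
      proof
        fix n show "conj_fun (inv t) (conj_fun t f) n = f n"
        proof (cases "n \<in> FC G")
          case True
          then have "conjugate t (conjugate (inv t) n) = n"
            using conjugate_cancel(2)[OF t FC_closed(1)] t by simp
          then show ?thesis using FC_conjugate[OF it True] True by (simp add: conj_fun_def)
        next
          case False
          moreover have "f \<in> supported (FC G)" using f J(2) by (auto simp: conj_stable_def)
          ultimately have "f n = 0" by (intro supportedD)
          then show ?thesis using False by (simp add: conj_fun_def)
        qed
      qed
      ultimately show ?thesis by simp
    qed
    then have "J \<subseteq> class_kernel ?N (dual_action G t P)"
      using class_kernel_eq[OF N fin' c] by blast
    then show ?thesis using c(1) by (simp add: \<Omega>_def)
  qed
  have "\<Omega> = (\<Union>P\<in>\<Omega>. dual_orbit G P)"
  proof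
    show "\<Omega> \<subseteq> (\<Union>P\<in>\<Omega>. dual_orbit G P)"
      using dual_action_one sub by (force simp: dual_orbit_def)
    show "(\<Union>P\<in>\<Omega>. dual_orbit G P) \<subseteq> \<Omega>" using moved by (auto simp: dual_orbit_def)
  qed
  then have "union_of_orbits G \<Omega>" unfolding union_of_orbits_def using sub by blast
  moreover have "J = K ?N \<Omega>"
  proof
    have "J \<subseteq> l1 ?N" using J(1) by (simp add: l1_ideal_def)
    then show "J \<subseteq> K ?N \<Omega>" by (auto simp: K_def \<Omega>_def)
    show "K ?N \<Omega> \<subseteq> J"
    proof
      fix f assume f: "f \<in> K ?N \<Omega>"
      then have fl: "f \<in> l1 ?N" by (simp add: K_def)
      show "f \<in> J"
      proof (rule ccontr)
        assume nf: "f \<notin> J"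
        obtain V where irr: "irreducible_unitary_rep ?N (group.regular_subrep ?N V)"
          and V: "V \<subseteq> supported (carrier ?N)"
          and kill: "\<forall>j\<in>J. \<forall>v\<in>V. conv ?N j v = 0" and moves: "\<exists>v\<in>V. conv ?N f v \<noteq> 0"
          using group.ideal_separated_by_irreducible[OF N fin' J(1) fl nf] by blast
        let ?\<pi> = "group.regular_subrep ?N V"
        let ?P = "rep_equiv_rel ?N `` {?\<pi>}"
        note P = unitary_dual_class[OF N irr]
        note ker = class_kernel_eq[OF N fin' P]
          group.rep_kernel_regular_subrep[OF N fin' irr]
        have "J \<subseteq> class_kernel ?N ?P"
          unfolding ker using kill \<open>J \<subseteq> l1 ?N\<close> by blast
        then have "?P \<in> \<Omega>" using P(1) by (simp add: \<Omega>_def)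
        then have "f \<in> class_kernel ?N ?P" using f by (simp add: K_def)
        then show False unfolding ker using moves by blast
      qed
    qed
  qed
  ultimately show ?thesis using sub by blast
qed

end

section \<open>Decomposition along the cosets of the FC-centre\<close>

context group
begin

lemma transversal_representative:
  assumes T: "transversal G (FC G) T"
  obtains r where "\<And>x. x \<in> carrier G \<Longrightarrow> r x \<in> T"
    "\<And>x t. x \<in> carrier G \<Longrightarrow> t \<in> T \<Longrightarrow> inv t \<otimes> x \<in> FC G \<longleftrightarrow> t = r x"
proof -
  have TG: "T \<subseteq> carrier G" using T by (simp add: transversal_def)
  have "\<exists>!t. t \<in> T \<and> inv t \<otimes> x \<in> FC G" if x: "x \<in> carrier G" for x
  proof -
    have mem: "t \<in> l_coset G x (FC G) \<longleftrightarrow> inv t \<otimes> x \<in> FC G" if t: "t \<in> T" for t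
    proof -
      have tG: "t \<in> carrier G" using t TG by blast
      have "t \<in> l_coset G x (FC G) \<longleftrightarrow> inv x \<otimes> t \<in> FC G"
      proof
        assume "t \<in> l_coset G x (FC G)"
        then obtain n where n: "n \<in> FC G" "t = x \<otimes> n" by (auto simp: l_coset_def)
        then show "inv x \<otimes> t \<in> FC G" using x FC_closed(1) by (simp add: m_assoc[symmetric])
      next
        assume "inv x \<otimes> t \<in> FC G"
        moreover have "t = x \<otimes> (inv x \<otimes> t)" using x tG by (simp add: m_assoc[symmetric])
        ultimately show "t \<in> l_coset G x (FC G)" by (auto simp: l_coset_def)
      qed
      also have "\<dots> \<longleftrightarrow> inv t \<otimes> x \<in> FC G"
        using FC_closed(2)[of "inv x \<otimes> t"] FC_closed(2)[of "inv t \<otimes> x"] x tG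
        by (auto simp: inv_mult_group)
      finally show ?thesis .
    qed
    have "l_coset G x (FC G) \<in> lcosets (FC G)" using x by (auto simp: LCOSETS_def)
    then have "\<exists>!t. t \<in> T \<and> t \<in> l_coset G x (FC G)" using T by (simp add: transversal_def)
    then show ?thesis using mem by (metis (no_types, lifting))
  qed
  then have *: "\<exists>t. x \<in> carrier G \<longrightarrow> t \<in> T \<and> (\<forall>t'\<in>T. inv t' \<otimes> x \<in> FC G \<longleftrightarrow> t' = t)" for x
    by (metis (no_types, lifting))
  then obtain r where "\<And>x. x \<in> carrier G \<longrightarrow> r x \<in> T \<and> (\<forall>t'\<in>T. inv t' \<otimes> x \<in> FC G \<longleftrightarrow> t' = r x)"
    by metis
  then show thesis using that by blast
qed

lemma translate_coset_slice:
  assumes "t \<in> carrier G"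
  shows "conv G (delta t) (coset_slice t f) x =
    (if x \<in> carrier G \<and> inv t \<otimes> x \<in> FC G then f x else 0)"
  using assms by (simp add: conv_delta_left coset_slice_def m_assoc[symmetric])

lemma supported_FC_l1:
  assumes "finite (FC G)" "f \<in> supported (FC G)" shows "f \<in> l1 G"
proof (rule l1_I)
  have "(\<lambda>x. norm (f x)) summable_on FC G" using assms(1) by simp
  then show "(\<lambda>x. norm (f x)) summable_on carrier G"
    using FC_closed(1) supportedD[OF assms(2)]
    by (subst summable_on_cong_neutral[where T = "FC G"]) auto
qed (use FC_closed(1) supportedD[OF assms(2)] in blast)

text \<open>The partial sum over \<open>A\<close> is the restriction of \<open>f\<close> to the cosets of the elements of \<open>A\<close>, so the
  remainder is a tail of \<open>f\<close>.\<close>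

lemma coset_decomposition:
  assumes T: "transversal G (FC G) T" and f: "f \<in> l1 G"
  shows "((\<lambda>A. l1_norm G (f - (\<Sum>t\<in>A. conv G (delta t) (coset_slice t f)))) \<longlongrightarrow> 0)
    (finite_subsets_at_top T)"
proof (rule tendstoI)
  fix e :: real assume e: "e > 0"
  have TG: "T \<subseteq> carrier G" using T by (simp add: transversal_def)
  obtain r where r: "\<And>x. x \<in> carrier G \<Longrightarrow> r x \<in> T"
    "\<And>x t. x \<in> carrier G \<Longrightarrow> t \<in> T \<Longrightarrow> inv t \<otimes> x \<in> FC G \<longleftrightarrow> t = r x"
    by (rule transversal_representative[OF T]) blast
  obtain F where F: "finite F" "F \<subseteq> carrier G"
    "\<And>F'. F \<subseteq> F' \<Longrightarrow> l1_norm G (\<lambda>x. if x \<in> F' then 0 else f x) < e"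
    using l1_norm_tail[OF f e] by blast
  have "dist (l1_norm G (f - (\<Sum>t\<in>A. conv G (delta t) (coset_slice t f)))) 0 < e"
    if A: "finite A" "r ` F \<subseteq> A" "A \<subseteq> T" for A
  proof -
    let ?X = "{x. x \<in> carrier G \<longrightarrow> r x \<in> A}"
    have "(\<Sum>t\<in>A. conv G (delta t) (coset_slice t f)) x = (if x \<in> ?X then f x else 0)" for x
    proof (cases "x \<in> carrier G")
      case x: True
      have "(\<Sum>t\<in>A. conv G (delta t) (coset_slice t f)) x = (\<Sum>t\<in>A. if r x = t then f x else 0)"
        unfolding sum_apply
      proof (intro sum.cong refl)
        fix t assume "t \<in> A"
        then have t: "t \<in> T" "t \<in> carrier G" using A(3) TG by auto
        show "conv G (delta t) (coset_slice t f) x = (if r x = t then f x else 0)"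
          using translate_coset_slice[OF t(2), of f x] r(2)[OF x t(1)] x by auto
      qed
      then show ?thesis using x A(1) by simp
    next
      case False
      then have "(\<Sum>t\<in>A. conv G (delta t) (coset_slice t f)) x = 0"
        unfolding sum_apply by (intro sum.neutral) (simp add: conv_def)
      then show ?thesis using False l1_zero_outside[OF f] by simp
    qed
    then have "f - (\<Sum>t\<in>A. conv G (delta t) (coset_slice t f)) = (\<lambda>x. if x \<in> ?X then 0 else f x)"
      by (simp add: fun_eq_iff)
    then have "l1_norm G (f - (\<Sum>t\<in>A. conv G (delta t) (coset_slice t f))) < e"
      using F(3)[of ?X] A(2) by (simp add: image_subset_iff subset_iff)
    moreover have "l1_norm G g \<ge> 0" for g :: "'a \<Rightarrow> complex" by (simp add: l1_norm_def infsum_nonneg)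
    ultimately show ?thesis by simp
  qed
  then show "\<forall>\<^sub>F A in finite_subsets_at_top T.
      dist (l1_norm G (f - (\<Sum>t\<in>A. conv G (delta t) (coset_slice t f)))) 0 < e"
    unfolding eventually_finite_subsets_at_top using F(1,2) r(1)
    by (intro exI[of _ "r ` F"]) auto
qed

text \<open>The summands live on disjoint cosets. On the coset of \<open>t\<close> every partial sum that contains \<open>t\<close> is
  therefore the translate of \<open>F t\<close>, and convergence in norm forces \<open>F t\<close> to be the slice of \<open>f\<close> at \<open>t\<close>. The other
  elements of the coset give translates of this slice, so that the transversal disappears from the
  description.\<close>

lemma l1_direct_sum_eq_slices:
  assumes fin: "finite (FC G)" and T: "transversal G (FC G) T"
    and J: "J \<subseteq> supported (FC G)" and left: "\<And>m f. m \<in> FC G \<Longrightarrow> f \<in> J \<Longrightarrow> coset_slice m f \<in> J"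
  shows "l1_direct_sum G T J = {f \<in> l1 G. \<forall>t\<in>carrier G. coset_slice t f \<in> J}"
proof (intro subset_antisym subsetI CollectI conjI ballI)
  have TG: "T \<subseteq> carrier G" using T by (simp add: transversal_def)
  fix f assume f: "f \<in> {f \<in> l1 G. \<forall>t\<in>carrier G. coset_slice t f \<in> J}"
  then show "f \<in> l1_direct_sum G T J"
    unfolding l1_direct_sum_def using coset_decomposition[OF T, of f] TG
    by (intro CollectI conjI exI[of _ "\<lambda>t. coset_slice t f"]) auto
next
  fix f assume f: "f \<in> l1_direct_sum G T J"
  then show fl: "f \<in> l1 G" by (simp add: l1_direct_sum_def)
  fix x assume x: "x \<in> carrier G"
  have TG: "T \<subseteq> carrier G" using T by (simp add: transversal_def)
  obtain r where r: "\<And>x. x \<in> carrier G \<Longrightarrow> r x \<in> T"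
    "\<And>x t. x \<in> carrier G \<Longrightarrow> t \<in> T \<Longrightarrow> inv t \<otimes> x \<in> FC G \<longleftrightarrow> t = r x"
    by (rule transversal_representative[OF T]) blast
  obtain F where F: "\<And>t. t \<in> T \<Longrightarrow> F t \<in> J" and
    lim: "((\<lambda>A. l1_norm G (f - (\<Sum>t\<in>A. conv G (delta t) (F t)))) \<longlongrightarrow> 0) (finite_subsets_at_top T)"
    using f by (auto simp: l1_direct_sum_def)
  define t where "t = r x"
  have t: "t \<in> T" "t \<in> carrier G" "inv t \<otimes> x \<in> FC G"
    using r(1)[OF x] r(2)[OF x r(1)[OF x]] TG by (auto simp: t_def)
  have "coset_slice t f = F t"
  proof
    fix n
    show "coset_slice t f n = F t n"
    proof (cases "n \<in> FC G")
      case n: True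
      have nG: "n \<in> carrier G" using n FC_closed(1) by blast
      have tn: "t \<otimes> n \<in> carrier G" using t(2) nG by simp
      have part: "(\<Sum>s\<in>A. conv G (delta s) (F s)) (t \<otimes> n) = F t n"
        if A: "finite A" "{t} \<subseteq> A" "A \<subseteq> T" for A
      proof -
        have "conv G (delta s) (F s) (t \<otimes> n) = (if t = s then F t n else 0)" if s: "s \<in> A" for s
        proof (cases "s = t")
          case True
          then show ?thesis using t(2) nG tn by (simp add: conv_delta_left m_assoc[symmetric])
        next
          case False
          have sT: "s \<in> T" "s \<in> carrier G" using s A TG by auto
          have "inv t \<otimes> (t \<otimes> n) \<in> FC G" using t(2) nG n by (simp add: m_assoc[symmetric])
          then have "r (t \<otimes> n) = t" using r(2)[OF tn t(1)] by simp
          then have "inv s \<otimes> (t \<otimes> n) \<notin> FC G" using r(2)[OF tn sT(1)] False by simp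
          moreover have "F s \<in> supported (FC G)" using F[OF sT(1)] J by blast
          ultimately have "F s (inv s \<otimes> (t \<otimes> n)) = 0" by (intro supportedD)
          then show ?thesis using False sT(2) by (simp add: conv_delta_left)
        qed
        then have "(\<Sum>s\<in>A. conv G (delta s) (F s)) (t \<otimes> n) = (\<Sum>s\<in>A. if t = s then F t n else 0)"
          unfolding sum_apply by (intro sum.cong refl)
        then show ?thesis using A by simp
      qed
      have "norm (f (t \<otimes> n) - F t n) \<le> e" if e: "e > 0" for e
      proof -
        have "\<forall>\<^sub>F A in finite_subsets_at_top T.
            dist (l1_norm G (f - (\<Sum>t\<in>A. conv G (delta t) (F t)))) 0 < e"
          using lim e by (rule tendstoD)
        moreover have "\<forall>\<^sub>F A in finite_subsets_at_top T. finite A \<and> {t} \<subseteq> A \<and> A \<subseteq> T"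
          unfolding eventually_finite_subsets_at_top using t(1) by (intro exI[of _ "{t}"]) auto
        ultimately have "\<forall>\<^sub>F A in finite_subsets_at_top T.
            dist (l1_norm G (f - (\<Sum>t\<in>A. conv G (delta t) (F t)))) 0 < e \<and>
            (finite A \<and> {t} \<subseteq> A \<and> A \<subseteq> T)"
          by (rule eventually_conj)
        from eventually_happens'[OF finite_subsets_at_top_neq_bot this]
        obtain A where A: "finite A" "{t} \<subseteq> A" "A \<subseteq> T"
          "l1_norm G (f - (\<Sum>t\<in>A. conv G (delta t) (F t))) < e"
          by auto
        have "conv G (delta s) (F s) \<in> l1 G" if "s \<in> A" for s
        proof -
          have "F s \<in> l1 G" using F J A(3) that by (intro supported_FC_l1[OF fin]) auto
          then show ?thesis using that A(3) TG by (intro conv_l1 delta_l1) auto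
        qed
        then have "f - (\<Sum>t\<in>A. conv G (delta t) (F t)) \<in> l1 G"
          by (intro cfun.subspace_diff[OF subspace_l1] fl l1_sum)
        from norm_le_l1_norm[OF this, of "t \<otimes> n"] show ?thesis
          using A(4) part[OF A(1-3)] by simp
      qed
      then have "norm (f (t \<otimes> n) - F t n) \<le> 0" by (rule dense_ge)
      then show ?thesis using n by (simp add: coset_slice_def)
    next
      case False
      have "F t \<in> supported (FC G)" using F[OF t(1)] J by blast
      then have "F t n = 0" using False by (rule supportedD)
      then show ?thesis using False by (simp add: coset_slice_def)
    qed
  qed
  then have "coset_slice (inv t \<otimes> x) (coset_slice t f) \<in> J"
    using left[OF t(3) F[OF t(1)]] by simp
  then show "coset_slice x f \<in> J"
    using coset_slice_coset_slice[OF t(2,3), of f] t(2) x by (simp add: m_assoc[symmetric])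
qed

lemma coset_slice_translate_left:
  assumes "s \<in> carrier G" "t \<in> carrier G"
  shows "coset_slice t (conv G (delta s) f) = coset_slice (inv s \<otimes> t) f"
  using assms FC_closed(1) by (auto simp: coset_slice_def conv_delta_left fun_eq_iff m_assoc)

lemma coset_slice_translate_right:
  assumes s: "s \<in> carrier G" and t: "t \<in> carrier G"
  shows "coset_slice t (conv G f (delta s)) = conj_fun s (coset_slice (t \<otimes> inv s) f)"
proof -
  have "t \<otimes> inv s \<otimes> conjugate s n = t \<otimes> n \<otimes> inv s" if "n \<in> carrier G" for n
  proof -
    have "t \<otimes> inv s \<otimes> conjugate s n = t \<otimes> (inv s \<otimes> s) \<otimes> n \<otimes> inv s"
      using s t that by (simp only: m_assoc m_closed inv_closed)
    then show ?thesis using s t that by simp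
  qed
  then show ?thesis
    using s t FC_closed(1) FC_conjugate[OF s]
    by (auto simp: coset_slice_def conj_fun_def conv_delta_right fun_eq_iff)
qed

text \<open>Membership of a slice in \<open>J\<close> means orthogonality to all \<open>w\<close> in the orthogonal complement \<open>W\<close> of \<open>J\<close>, and
  the inner product of the slice at \<open>t\<close> with \<open>w\<close> is the pairing of \<open>f\<close> with the finitely supported
  function \<open>\<phi> t w\<close>.\<close>

lemma slices_ideal:
  assumes fin: "finite (FC G)" and J: "conj_stable J"
  defines "D \<equiv> {f \<in> l1 G. \<forall>t\<in>carrier G. coset_slice t f \<in> J}"
  shows "l1_ideal G D" "closedin (weak_star G) D"
proof -
  let ?N = "FC G"
  have JS: "J \<subseteq> supported ?N" and J_sub: "cfun.subspace J"
    and J_conj: "\<And>t f. t \<in> carrier G \<Longrightarrow> f \<in> J \<Longrightarrow> conj_fun t f \<in> J"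
    using J by (auto simp: conj_stable_def)
  define \<phi> where "\<phi> t w x = (if x \<in> (\<otimes>) t ` ?N then cnj (w (inv t \<otimes> x)) else 0)" for t w x
  define W where "W = {w \<in> supported ?N. \<forall>j\<in>J. l2_inner ?N j w = 0}"
  define \<Phi> where "\<Phi> = {\<phi> t w | t w. t \<in> carrier G \<and> w \<in> W}"
  have supp: "finite ((\<otimes>) t ` ?N)" "(\<otimes>) t ` ?N \<subseteq> carrier G" "x \<notin> (\<otimes>) t ` ?N \<Longrightarrow> \<phi> t w x = 0"
    if "t \<in> carrier G" for t w x
    using that fin FC_closed(1) by (auto simp: \<phi>_def)
  have pair: "pairing G f (\<phi> t w) = l2_inner ?N (coset_slice t f) w" if t: "t \<in> carrier G" for f t w
  proof -
    have "pairing G f (\<phi> t w) = (\<Sum>x\<in>(\<otimes>) t ` ?N. f x * \<phi> t w x)"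
      by (rule pairing_finite_support[OF supp(1,2)[OF t]]) (rule supp(3)[OF t])
    also have "\<dots> = (\<Sum>n\<in>?N. f (t \<otimes> n) * \<phi> t w (t \<otimes> n))"
      using t FC_closed(1) by (subst sum.reindex) (auto simp: inj_on_def)
    also have "\<dots> = l2_inner ?N (coset_slice t f) w"
      unfolding l2_inner_def using t FC_closed(1)
      by (intro sum.cong refl) (simp add: \<phi>_def coset_slice_def m_assoc[symmetric])
    finally show ?thesis .
  qed
  have slice: "coset_slice t f \<in> J \<longleftrightarrow> (\<forall>w\<in>W. l2_inner ?N (coset_slice t f) w = 0)" for t f
  proof
    assume "\<forall>w\<in>W. l2_inner ?N (coset_slice t f) w = 0"
    moreover have "coset_slice t f \<in> supported ?N" by (simp add: supported_def coset_slice_def)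
    ultimately show "coset_slice t f \<in> J"
      by (intro orthogonal_complement_complement[OF fin JS J_sub]) (auto simp: W_def)
  qed (auto simp: W_def)
  have D: "D = {f \<in> l1 G. \<forall>\<psi>\<in>\<Phi>. pairing G f \<psi> = 0}"
  proof -
    have "(\<forall>t\<in>carrier G. coset_slice t f \<in> J) \<longleftrightarrow> (\<forall>t\<in>carrier G. \<forall>w\<in>W. pairing G f (\<phi> t w) = 0)" for f
      by (simp add: pair slice)
    then show ?thesis unfolding D_def \<Phi>_def by blast
  qed
  have finsupp: "\<exists>S. finite S \<and> S \<subseteq> carrier G \<and> (\<forall>x. x \<notin> S \<longrightarrow> \<psi> x = 0)" if "\<psi> \<in> \<Phi>" for \<psi>
  proof -
    obtain t w where t: "t \<in> carrier G" "\<psi> = \<phi> t w" using \<open>\<psi> \<in> \<Phi>\<close> by (auto simp: \<Phi>_def)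
    show ?thesis
      unfolding t(2) by (intro exI[of _ "(\<otimes>) t ` ?N"] conjI allI impI supp[OF t(1)])
  qed
  have left: "conv G (delta s) f \<in> D" if s: "s \<in> carrier G" and f: "f \<in> D" for s f
    using f s conv_l1[OF delta_l1[OF s], of f] by (simp add: D_def coset_slice_translate_left)
  have right: "conv G f (delta s) \<in> D" if s: "s \<in> carrier G" and f: "f \<in> D" for s f
    using f s conv_l1[OF _ delta_l1[OF s], of f] J_conj by (simp add: D_def coset_slice_translate_right)
  show "l1_ideal G D"
    unfolding D by (rule annihilator_ideal[OF finsupp]) (use left right in \<open>simp_all add: D\<close>)
  have "\<Phi> \<subseteq> c0 G"
  proof
    fix \<psi> assume "\<psi> \<in> \<Phi>"
    from finsupp[OF this] obtain S where S: "finite S" "S \<subseteq> carrier G" "\<forall>x. x \<notin> S \<longrightarrow> \<psi> x = 0" by blast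
    show "\<psi> \<in> c0 G" by (rule c0_finite_support[OF S(1,2)]) (use S(3) in simp)
  qed
  then show "closedin (weak_star G) D" unfolding D by (rule weak_star_closed_annihilator)
qed

lemma conv_FC:
  assumes f: "f \<in> supported (FC G)" and g: "g \<in> supported (FC G)"
  shows "conv (FC_group G) f g = conv G f g"
proof
  fix x
  show "conv (FC_group G) f g x = conv G f g x"
  proof (cases "x \<in> FC G")
    case True
    have "(\<Sum>\<^sub>\<infinity>y\<in>FC G. f y * g (inv\<^bsub>FC_group G\<^esub> y \<otimes> x)) = (\<Sum>\<^sub>\<infinity>y\<in>carrier G. f y * g (inv y \<otimes> x))"
      using supportedD[OF f] FC_closed(1)
      by (intro infsum_cong_neutral) (auto simp: FC_group_simps(2))
    then show ?thesis using True FC_closed(1)[OF True] by (simp add: conv_def)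
  next
    case False
    have "f y * g (inv y \<otimes> x) = 0" if x: "x \<in> carrier G" and y: "y \<in> carrier G" for y
    proof (cases "y \<in> FC G")
      case yF: True
      have "inv y \<otimes> x \<notin> FC G"
      proof
        assume "inv y \<otimes> x \<in> FC G"
        then have "y \<otimes> (inv y \<otimes> x) \<in> FC G" using yF FC_closed(3) by blast
        then show False using False x y by (simp add: m_assoc[symmetric])
      qed
      then show ?thesis using supportedD[OF g] by simp
    qed (simp add: supportedD[OF f])
    then show ?thesis using False by (simp add: conv_def infsum_0)
  qed
qed

text \<open>A slice of \<open>f\<close> is the restriction to \<open>FC G\<close> of a left translate of \<open>f\<close>; the invariance properties of
  \<open>I \<inter> l1 (FC_group G)\<close> come from multiplication in \<open>l1 G\<close> by point masses.\<close>

lemma weak_star_closed_ideal_slices: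
  assumes fin: "finite (FC G)" and I: "l1_ideal G I" "closedin (weak_star G) I"
  shows "f \<in> I \<Longrightarrow> t \<in> carrier G \<Longrightarrow> coset_slice t f \<in> I"
    "conj_stable (I \<inter> supported (FC G))" "l1_ideal (FC_group G) (I \<inter> supported (FC G))"
proof -
  have Il1: "I \<subseteq> l1 G" and I_sub: "cfun.subspace I"
    and ideal: "\<And>f g. f \<in> l1 G \<Longrightarrow> g \<in> I \<Longrightarrow> conv G f g \<in> I \<and> conv G g f \<in> I"
    using I(1) by (auto simp: l1_ideal_def)
  have left: "conv G (delta s) f \<in> I" and right: "conv G f (delta s) \<in> I"
    if "s \<in> carrier G" "f \<in> I" for s f using ideal[OF delta_l1] that by blast+
  show slice: "coset_slice t f \<in> I" if f: "f \<in> I" and t: "t \<in> carrier G" for f t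
  proof -
    have it: "inv t \<in> carrier G" using t by simp
    let ?g = "conv G (delta (inv t)) f"
    have "(\<lambda>x. if x \<in> FC G then ?g x else 0) \<in> I"
    proof (rule weak_star_closed_restrict_FC[OF fin I(2) left[OF it f]])
      fix s assume s: "s \<in> carrier G"
      then have "inv s \<in> carrier G" by simp
      then show "conv G (conv G (delta s) ?g) (delta (inv s)) \<in> I"
        by (intro right left s it f)
    qed
    moreover have "(\<lambda>x. if x \<in> FC G then ?g x else 0) = coset_slice t f"
      using t FC_closed(1) by (auto simp: coset_slice_def conv_delta_left[OF it] fun_eq_iff)
    ultimately show ?thesis by simp
  qed
  let ?J = "I \<inter> supported (FC G)"
  have J_sub: "cfun.subspace ?J" using I_sub subspace_supported by (rule cfun.subspace_inter)
  show "conj_stable ?J"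
    unfolding conj_stable_def
  proof (intro conjI ballI J_sub)
    show "coset_slice m f \<in> ?J" if "m \<in> FC G" "f \<in> ?J" for m f
      using slice[of f m] that FC_closed(1) by (simp add: supported_def coset_slice_def)
    show "conj_fun t f \<in> ?J" if t: "t \<in> carrier G" and f: "f \<in> ?J" for t f
    proof -
      have it: "inv t \<in> carrier G" using t by simp
      have fS: "f \<in> supported (FC G)" using f by blast
      have "conj_fun t f = conv G (conv G (delta (inv t)) f) (delta t)"
      proof
        fix x
        show "conj_fun t f x = conv G (conv G (delta (inv t)) f) (delta t) x"
        proof (cases "x \<in> FC G")
          case True
          then show ?thesis
            using t FC_closed(1) by (simp add: conj_fun_def conv_delta_left conv_delta_right m_assoc)
        next
          case False
          have "f (conjugate t x) = 0" if x: "x \<in> carrier G"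
          proof (rule supportedD[OF fS])
            show "conjugate t x \<notin> FC G"
            proof
              assume "conjugate t x \<in> FC G"
              then have "inv t \<otimes> conjugate t x \<otimes> t \<in> FC G" by (rule FC_closed(5)[OF t])
              then show False
                using False conjugate_cancel(1)[OF t x] by simp
            qed
          qed
          then show ?thesis
            using False t by (simp add: conj_fun_def conv_delta_left conv_delta_right m_assoc)
        qed
      qed
      then have "conj_fun t f \<in> I" using right[OF t left[OF it]] f by simp
      moreover have "conj_fun t f \<in> supported (FC G)" by (simp add: supported_def conj_fun_def)
      ultimately show ?thesis by blast
    qed
  qed blast
  show "l1_ideal (FC_group G) ?J"
    unfolding l1_ideal_def l1_FC[OF fin]
  proof (intro conjI ballI J_sub)
    fix f g assume f: "f \<in> supported (FC G)" and g: "g \<in> ?J"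
    have gS: "g \<in> supported (FC G)" using g by blast
    have fl: "f \<in> l1 G" by (rule supported_FC_l1[OF fin f])
    have "conv (FC_group G) h k \<in> supported (FC G)" for h k by (simp add: supported_def conv_def)
    then show "conv (FC_group G) f g \<in> ?J" "conv (FC_group G) g f \<in> ?J"
      using ideal[OF fl, of g] g conv_FC[OF f gS] conv_FC[OF gS f] by (metis IntI IntD1)+
  qed blast
qed

text \<open>A function in the direct sum is a norm limit of finite sums of translates of its slices, which
  lie in \<open>I\<close>.\<close>

lemma weak_star_closed_ideal_eq_direct_sum:
  assumes fin: "finite (FC G)" and T: "transversal G (FC G) T"
    and I: "l1_ideal G I" "closedin (weak_star G) I"
  shows "I = l1_direct_sum G T (I \<inter> supported (FC G))"
proof -
  let ?J = "I \<inter> supported (FC G)"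
  note slice = weak_star_closed_ideal_slices(1)[OF fin I]
    and stable = weak_star_closed_ideal_slices(2)[OF fin I]
  have D: "l1_direct_sum G T ?J = {f \<in> l1 G. \<forall>t\<in>carrier G. coset_slice t f \<in> ?J}"
    using stable by (intro l1_direct_sum_eq_slices[OF fin T]) (auto simp: conj_stable_def)
  have Il1: "I \<subseteq> l1 G" and I_sub: "cfun.subspace I"
    and ideal: "\<And>f g. f \<in> l1 G \<Longrightarrow> g \<in> I \<Longrightarrow> conv G f g \<in> I"
    using I(1) by (auto simp: l1_ideal_def)
  have TG: "T \<subseteq> carrier G" using T by (simp add: transversal_def)
  show ?thesis
  proof
    have "coset_slice t f \<in> supported (FC G)" for t f by (simp add: supported_def coset_slice_def)
    then show "I \<subseteq> l1_direct_sum G T ?J" unfolding D using slice Il1 by blast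
    show "l1_direct_sum G T ?J \<subseteq> I"
    proof
      fix f assume f: "f \<in> l1_direct_sum G T ?J"
      then have fl: "f \<in> l1 G" and fs: "\<And>t. t \<in> carrier G \<Longrightarrow> coset_slice t f \<in> I" unfolding D by blast+
      show "f \<in> I"
      proof (rule weak_star_closed_norm_limit[OF I(2) fl])
        fix e :: real assume e: "e > 0"
        have "\<forall>\<^sub>F A in finite_subsets_at_top T.
            dist (l1_norm G (f - (\<Sum>t\<in>A. conv G (delta t) (coset_slice t f)))) 0 < e"
          using coset_decomposition[OF T fl] e by (rule tendstoD)
        moreover have "\<forall>\<^sub>F A in finite_subsets_at_top T. A \<subseteq> T"
          unfolding eventually_finite_subsets_at_top by blast
        ultimately have "\<forall>\<^sub>F A in finite_subsets_at_top T.
            dist (l1_norm G (f - (\<Sum>t\<in>A. conv G (delta t) (coset_slice t f)))) 0 < e \<and> A \<subseteq> T"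
          by (rule eventually_conj)
        from eventually_happens'[OF finite_subsets_at_top_neq_bot this]
        obtain A where A: "A \<subseteq> T"
          "l1_norm G (f - (\<Sum>t\<in>A. conv G (delta t) (coset_slice t f))) < e"
          by auto
        have "(\<Sum>t\<in>A. conv G (delta t) (coset_slice t f)) \<in> I"
          using A(1) TG by (intro cfun.subspace_sum[OF I_sub] ideal delta_l1 fs) auto
        then show "\<exists>g\<in>I. l1_norm G (f - g) < e" using A(2) by blast
      qed
    qed
  qed
qed

end

theorem theorem1p3:
  fixes G :: "('a, 'b) monoid_scheme" and T :: "'a set"
  assumes "group G"
    and "finite (FC G)"
    and "transversal G (FC G) T"
  shows "{I. l1_ideal G I \<and> closedin (weak_star G) I} =
    {l1_direct_sum G T (K (FC_group G) \<Omega>) | \<Omega>.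
       \<Omega> \<subseteq> unitary_dual (FC_group G) \<and> union_of_orbits G \<Omega>}"
proof -
  interpret group G by fact
  note fin = assms(2) and T = assms(3)
  show ?thesis
  proof (intro subset_antisym subsetI)
    fix I assume "I \<in> {I. l1_ideal G I \<and> closedin (weak_star G) I}"
    then have I: "l1_ideal G I" "closedin (weak_star G) I" by blast+
    note slices = weak_star_closed_ideal_slices[OF fin I]
    obtain \<Omega> where \<Omega>: "\<Omega> \<subseteq> unitary_dual (FC_group G)" "union_of_orbits G \<Omega>"
        "I \<inter> supported (FC G) = K (FC_group G) \<Omega>"
      using conj_invariant_ideal_eq_K[OF fin slices(3,2)] by blast
    have "I = l1_direct_sum G T (K (FC_group G) \<Omega>)"
      unfolding \<Omega>(3)[symmetric] by (rule weak_star_closed_ideal_eq_direct_sum[OF fin T I])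
    then show "I \<in> {l1_direct_sum G T (K (FC_group G) \<Omega>) | \<Omega>.
        \<Omega> \<subseteq> unitary_dual (FC_group G) \<and> union_of_orbits G \<Omega>}" using \<Omega>(1,2) by blast
  next
    fix I assume "I \<in> {l1_direct_sum G T (K (FC_group G) \<Omega>) | \<Omega>.
        \<Omega> \<subseteq> unitary_dual (FC_group G) \<and> union_of_orbits G \<Omega>}"
    then obtain \<Omega> where \<Omega>: "\<Omega> \<subseteq> unitary_dual (FC_group G)" "union_of_orbits G \<Omega>"
      and I: "I = l1_direct_sum G T (K (FC_group G) \<Omega>)" by blast
    note stable = K_conj_stable[OF fin \<Omega>]
    have "I = {f \<in> l1 G. \<forall>t\<in>carrier G. coset_slice t f \<in> K (FC_group G) \<Omega>}"
      unfolding I using stable by (intro l1_direct_sum_eq_slices[OF fin T]) (auto simp: conj_stable_def)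
    then show "I \<in> {I. l1_ideal G I \<and> closedin (weak_star G) I}"
      using slices_ideal[OF fin stable] by simp
  qed
qed

end
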